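(* Let $(\Omega,\Sigma,\mu)$ be a complete $\sigma$-finite measure space and suppose $1\le p<\infty$. (a) Let $\varphi$ be an Orlicz function such that $\psi(u)=\varphi(u^{1/p})$ is a convex function, and let $T\in\mathcal{A}(L^p,L^\infty)$ with $M:=\max\{\|T\|_{L^p\to L^p},\|T\|_{L^\infty\to L^\infty}\}>0$. Then \[ I_\varphi\left(\frac{Tx}{2^{1-1/p}M}\right)\le I_\varphi(x)\quad\text{for all } x\in L^p+L^\infty . \] (b) Let $\varphi^{-1}(u)=u^{1/p}\rho(u^{-1/p})$ for all $u>0$, with $\rho\in\widetilde{\mathcal{P}}$ such that $\rho_*(\mathbb{R}_+)=\mathbb{R}_+$, where $\rho_*(t):=t\rho(1/t)$ for $t>0$. Then the Orlicz space $L^\varphi$ (with both the Luxemburg-Nakano norm and the Orlicz norm) is an interpolation space for subadditive operators between $L^p$ and $L^\infty$, and \[ \|T\|_{L^\varphi\to L^\varphi}\le C\max\big\{\|T\|_{L^p\to L^p},\|T\|_{L^\infty\to L^\infty}\big\} \] for any $T\in\mathcal{A}(L^p,L^\infty)$, where the constant $C$ satisfies $C\le2^{1-1/p}$.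
   Context: All function spaces are spaces of (equivalence classes of) real or complex-valued measurable functions on $(\Omega,\Sigma,\mu)$; $\mathbb{R}_+:=(0,\infty)$. Subadditive operators. Let $X_0,X_1$ be Banach lattices of functions on $\Omega$ (e.g. Lebesgue spaces); $X_0\cap X_1$ and $X_0+X_1$ carry the standard norms. An operator $T:X_0+X_1\to X_0+X_1$ is subadditive if $|T(x+y)(t)|\le|Tx(t)|+|Ty(t)|$ $\mu$-a.e. for all $x,y\in X_0+X_1$ (no homogeneity is required). $\mathcal{A}(X_0,X_1)$ is the class of subadditive operators $T:X_0+X_1\to X_0+X_1$ such that, for $i=0,1$, $T$ maps $X_i$ into $X_i$ and $\|T\|_{X_i\to X_i}<\infty$, where for a normed space $X$, $\|T\|_{X\to X}:=\sup_{x\in X,\,x\neq0}\|Tx\|_X/\|x\|_X$. A Banach space $X$ is an interpolation space for subadditive operators between $X_0$ and $X_1$ if $X_0\cap X_1\subset X\subset X_0+X_1$ with continuous embeddings, every $T\in\mathcal{A}(X_0,X_1)$ maps $X$ into itself, and $\|T\|_{X\to X}\le C\max\{\|T\|_{X_0\to X_0},\|T\|_{X_1\to X_1}\}$ with a constant $C$ (the interpolation constant) independent of $T$. Orlicz spaces. An Orlicz function is a nondecreasing convex function $\varphi:[0,\infty)\to[0,\infty]$ such that $\varphi(0)=0$ and $\lim_{u\to0+}\varphi(u)=0$, but not identically zero or infinity on $(0,\infty)$. The modular of a measurable function $x$ is \[ I_\varphi(x):=\int_\Omega\varphi(|x(t)|)\,d\mu(t)=\int_0^\infty\varphi(x^*(s))\,ds,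 \] where $x^*$ is the non-increasing rearrangement of $x$; the second equality (rearrangement invariance of the modular) is part of the standing conventions on $\varphi$ and $I_\varphi$. The Orlicz space $L^\varphi=L^\varphi(\Omega,\Sigma,\mu)$ is the set of all (classes of) measurable functions $x$ with $I_\varphi(\lambda x)<\infty$ for some $\lambda=\lambda(x)>0$. It is a Banach space under the Luxemburg-Nakano norm $\|x\|_\varphi:=\inf\{\lambda>0:\ I_\varphi(x/\lambda)\le1\}$ and under the Orlicz norm (Amemiya form) $\|x\|_\varphi^0:=\inf_{k>0}\frac1k[1+I_\varphi(kx)]$. Quasi-concave functions. A function $\rho:[0,\infty)\to[0,\infty)$ is quasi-concave if it is continuous and positive on $\mathbb{R}_+$ and $\rho(s)\le\max(1,s/t)\rho(t)$ for all $s,t>0$. $\mathcal{P}$ is the set of all quasi-concave functions and $\widetilde{\mathcal{P}}$ is the subset of all concave functions in $\mathcal{P}$. In (b), $\varphi$ is the function with $\varphi(0)=0$ whose restriction to $(0,\infty)$ is the inverse of the increasing bijection $u\mapsto u^{1/p}\rho(u^{-1/p})$ of $(0,\infty)$; this $\varphi$ is convex, so that the Orlicz space $L^\varphi$ is well defined. *)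

theory Defs
  imports "HOL-Probability.Essential_Supremum"
begin

text \<open>
  Equivalence classes of functions are handled through representatives: a function space on
  \<open>M\<close> has as elements measurable functions \<open>'a \<Rightarrow> 'b\<close>, and identities,
  inequalities and well-definedness are understood modulo equality almost everywhere.
  The scalar type \<open>'b\<close> ranges over \<open>real_normed_field\<close>; by the theorem of
  Gelfand and Mazur its members are, up to isometric isomorphism, the reals and the complex numbers.
\<close>

record ('a, 'b) fun_space =
  elems :: "('a \<Rightarrow> 'b) set"
  nrm :: "('a \<Rightarrow> 'b) \<Rightarrow> real"

text \<open>The third and fourth clauses say that membership and norm depend only on the class of a function.\<close>

definition banach_fun_space ::
  "'a measure \<Rightarrow> ('a, 'b::{real_normed_field, second_countable_topology}) fun_space \<Rightarrow> bool" where
  "banach_fun_space M X \<longleftrightarrow>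
     elems X \<subseteq> borel_measurable M \<and>
     (\<lambda>t. 0) \<in> elems X \<and>
     (\<forall>f\<in>elems X. \<forall>g\<in>borel_measurable M. (AE t in M. f t = g t) \<longrightarrow> g \<in> elems X) \<and>
     (\<forall>f\<in>elems X. \<forall>g\<in>elems X. (AE t in M. f t = g t) \<longrightarrow> nrm X f = nrm X g) \<and>
     (\<forall>f\<in>elems X. \<forall>g\<in>elems X. (\<lambda>t. f t + g t) \<in> elems X) \<and>
     (\<forall>c. \<forall>f\<in>elems X. (\<lambda>t. c * f t) \<in> elems X) \<and>
     (\<forall>f\<in>elems X. 0 \<le> nrm X f) \<and>
     (\<forall>f\<in>elems X. nrm X f = 0 \<longleftrightarrow> (AE t in M. f t = 0)) \<and>
     (\<forall>f\<in>elems X. \<forall>g\<in>elems X. nrm X (\<lambda>t. f t + g t) \<le> nrm X f + nrm X g) \<and>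
     (\<forall>c. \<forall>f\<in>elems X. nrm X (\<lambda>t. c * f t) = norm c * nrm X f) \<and>
     (\<forall>F :: nat \<Rightarrow> 'a \<Rightarrow> 'b. (\<forall>n. F n \<in> elems X) \<and>
        (\<forall>e>0. \<exists>N. \<forall>m\<ge>N. \<forall>n\<ge>N. nrm X (\<lambda>t. F m t - F n t) < e) \<longrightarrow>
        (\<exists>f\<in>elems X. (\<lambda>n. nrm X (\<lambda>t. F n t - f t)) \<longlonglongrightarrow> 0))"

definition embeds :: "('a, 'b) fun_space \<Rightarrow> ('a, 'b) fun_space \<Rightarrow> bool" where
  "embeds X Y \<longleftrightarrow> elems X \<subseteq> elems Y \<and> (\<exists>c. \<forall>f\<in>elems X. nrm Y f \<le> c * nrm X f)"

definition inter_space :: "('a, 'b) fun_space \<Rightarrow> ('a, 'b) fun_space \<Rightarrow> ('a, 'b) fun_space" where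
  "inter_space X0 X1 =
     \<lparr>elems = elems X0 \<inter> elems X1, nrm = (\<lambda>f. max (nrm X0 f) (nrm X1 f))\<rparr>"

definition sum_space ::
  "'a measure \<Rightarrow> ('a, 'b::real_normed_vector) fun_space \<Rightarrow> ('a, 'b) fun_space \<Rightarrow> ('a, 'b) fun_space" where
  "sum_space M X0 X1 =
     \<lparr>elems = {f \<in> borel_measurable M.
                 \<exists>g\<in>elems X0. \<exists>h\<in>elems X1. AE t in M. f t = g t + h t},
      nrm = (\<lambda>f. Inf {nrm X0 g + nrm X1 h | g h.
                 g \<in> elems X0 \<and> h \<in> elems X1 \<and> (AE t in M. f t = g t + h t)})\<rparr>"

definition lp_space ::
  "'a measure \<Rightarrow> real \<Rightarrow> ('a, 'b::real_normed_vector) fun_space" where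
  "lp_space M p =
     \<lparr>elems = {f \<in> borel_measurable M. integrable M (\<lambda>t. norm (f t) powr p)},
      nrm = (\<lambda>f. (LINT t|M. norm (f t) powr p) powr (1 / p))\<rparr>"

definition linf_space :: "'a measure \<Rightarrow> ('a, 'b::real_normed_vector) fun_space" where
  "linf_space M =
     \<lparr>elems = {f \<in> borel_measurable M. esssup M (\<lambda>t. ennreal (norm (f t))) < \<infinity>},
      nrm = (\<lambda>f. enn2real (esssup M (\<lambda>t. ennreal (norm (f t)))))\<rparr>"

text \<open>The value is meaningful only if \<open>T\<close> maps \<open>elems X\<close> into itself; this is
  required separately wherever it is used.\<close>

definition opnorm ::
  "'a measure \<Rightarrow> ('a, 'b::real_normed_vector) fun_space \<Rightarrow> (('a \<Rightarrow> 'b) \<Rightarrow> ('a \<Rightarrow> 'b)) \<Rightarrow> ennreal" where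
  "opnorm M X T =
     (SUP f \<in> {f \<in> elems X. \<not> (AE t in M. f t = 0)}. ennreal (nrm X (T f)) / ennreal (nrm X f))"

text \<open>The second clause makes \<open>T\<close> an operator on classes of functions.\<close>

definition subadditive_op ::
  "'a measure \<Rightarrow> ('a, 'b::real_normed_vector) fun_space \<Rightarrow> (('a \<Rightarrow> 'b) \<Rightarrow> ('a \<Rightarrow> 'b)) \<Rightarrow> bool" where
  "subadditive_op M S T \<longleftrightarrow>
     (\<forall>f\<in>elems S. T f \<in> elems S) \<and>
     (\<forall>f\<in>elems S. \<forall>g\<in>elems S. (AE t in M. f t = g t) \<longrightarrow> (AE t in M. T f t = T g t)) \<and>
     (\<forall>f\<in>elems S. \<forall>g\<in>elems S.
        AE t in M. norm (T (\<lambda>s. f s + g s) t) \<le> norm (T f t) + norm (T g t))"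

definition subadditive_class ::
  "'a measure \<Rightarrow> ('a, 'b::real_normed_vector) fun_space \<Rightarrow> ('a, 'b) fun_space
     \<Rightarrow> (('a \<Rightarrow> 'b) \<Rightarrow> ('a \<Rightarrow> 'b)) set" where
  "subadditive_class M X0 X1 =
     {T. subadditive_op M (sum_space M X0 X1) T \<and>
         (\<forall>X\<in>{X0, X1}. (\<forall>f\<in>elems X. T f \<in> elems X) \<and> opnorm M X T < \<infinity>)}"

definition interpolation_const ::
  "'a measure \<Rightarrow> ('a, 'b::real_normed_vector) fun_space \<Rightarrow> ('a, 'b) fun_space
     \<Rightarrow> ('a, 'b) fun_space \<Rightarrow> real \<Rightarrow> bool" where
  "interpolation_const M X0 X1 X C \<longleftrightarrow> 0 \<le> C \<and>
     (\<forall>T \<in> subadditive_class M X0 X1.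
        opnorm M X T \<le> ennreal C * max (opnorm M X0 T) (opnorm M X1 T))"

definition interpolation_space ::
  "'a measure \<Rightarrow> ('a, 'b::{real_normed_field, second_countable_topology}) fun_space
     \<Rightarrow> ('a, 'b) fun_space \<Rightarrow> ('a, 'b) fun_space \<Rightarrow> bool" where
  "interpolation_space M X0 X1 X \<longleftrightarrow>
     banach_fun_space M X \<and>
     embeds (inter_space X0 X1) X \<and> embeds X (sum_space M X0 X1) \<and>
     (\<forall>T \<in> subadditive_class M X0 X1. \<forall>f\<in>elems X. T f \<in> elems X) \<and>
     (\<exists>C. interpolation_const M X0 X1 X C)"

text \<open>Functions on \<open>[0,\<infinity>)\<close> are functions on \<^typ>\<open>real\<close> whose values at negative
  arguments are irrelevant.\<close>

definition convex_fun :: "(real \<Rightarrow> ennreal) \<Rightarrow> bool" where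
  "convex_fun \<phi> \<longleftrightarrow>
     (\<forall>u\<ge>0. \<forall>v\<ge>0. \<forall>a\<in>{0..1}.
        \<phi> (a * u + (1 - a) * v) \<le> ennreal a * \<phi> u + ennreal (1 - a) * \<phi> v)"

definition orlicz_function :: "(real \<Rightarrow> ennreal) \<Rightarrow> bool" where
  "orlicz_function \<phi> \<longleftrightarrow>
     mono_on {0..} \<phi> \<and> convex_fun \<phi> \<and> \<phi> 0 = 0 \<and> (\<phi> \<longlongrightarrow> 0) (at_right 0) \<and>
     (\<exists>u>0. \<phi> u \<noteq> 0) \<and> (\<exists>u>0. \<phi> u \<noteq> \<infinity>)"

definition modular ::
  "'a measure \<Rightarrow> (real \<Rightarrow> ennreal) \<Rightarrow> ('a \<Rightarrow> 'b::real_normed_vector) \<Rightarrow> ennreal" where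
  "modular M \<phi> x = (\<integral>\<^sup>+ t. \<phi> (norm (x t)) \<partial>M)"

definition rearrangement ::
  "'a measure \<Rightarrow> ('a \<Rightarrow> 'b::real_normed_vector) \<Rightarrow> real \<Rightarrow> ennreal" where
  "rearrangement M x s =
     Inf {r :: ennreal. emeasure M {t \<in> space M. ennreal (norm (x t)) > r} \<le> ennreal s}"

text \<open>The rearrangement may be infinite, so \<open>\<phi>\<close> is evaluated with the convention
  \<open>\<phi>(\<infinity>) = \<infinity>\<close>. The equality below holds whenever \<open>\<phi>\<close> is
  left-continuous; it can fail for an Orlicz function that jumps at the end of the interval on which
  it is finite.\<close>

definition rearrangement_invariant ::
  "'a measure \<Rightarrow> 'b::real_normed_vector itself \<Rightarrow> (real \<Rightarrow> ennreal) \<Rightarrow> bool" where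
  "rearrangement_invariant M (_ :: 'b itself) \<phi> \<longleftrightarrow>
     (\<forall>x :: 'a \<Rightarrow> 'b. x \<in> borel_measurable M \<longrightarrow>
        modular M \<phi> x =
        (\<integral>\<^sup>+ s \<in> {0<..}. (if rearrangement M x s = \<infinity> then \<infinity>
                            else \<phi> (enn2real (rearrangement M x s))) \<partial>lborel))"

definition orlicz_set ::
  "'a measure \<Rightarrow> (real \<Rightarrow> ennreal) \<Rightarrow> ('a \<Rightarrow> 'b::real_normed_vector) set" where
  "orlicz_set M \<phi> = {x \<in> borel_measurable M. \<exists>l>0. modular M \<phi> (\<lambda>t. l *\<^sub>R x t) < \<infinity>}"

definition orlicz_luxemburg ::
  "'a measure \<Rightarrow> (real \<Rightarrow> ennreal) \<Rightarrow> ('a, 'b::real_normed_vector) fun_space" where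
  "orlicz_luxemburg M \<phi> =
     \<lparr>elems = orlicz_set M \<phi>,
      nrm = (\<lambda>x. Inf {l. l > 0 \<and> modular M \<phi> (\<lambda>t. x t /\<^sub>R l) \<le> 1})\<rparr>"

definition orlicz_amemiya ::
  "'a measure \<Rightarrow> (real \<Rightarrow> ennreal) \<Rightarrow> ('a, 'b::real_normed_vector) fun_space" where
  "orlicz_amemiya M \<phi> =
     \<lparr>elems = orlicz_set M \<phi>,
      nrm = (\<lambda>x. enn2real (INF k \<in> {0<..}.
               ennreal (1 / k) * (1 + modular M \<phi> (\<lambda>t. k *\<^sub>R x t))))\<rparr>"

definition quasi_concave :: "(real \<Rightarrow> real) \<Rightarrow> bool" where
  "quasi_concave \<rho> \<longleftrightarrow>
     (\<forall>s\<ge>0. 0 \<le> \<rho> s) \<and> continuous_on {0<..} \<rho> \<and> (\<forall>s>0. 0 < \<rho> s) \<and>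
     (\<forall>s>0. \<forall>t>0. \<rho> s \<le> max 1 (s / t) * \<rho> t)"

definition rho_star :: "(real \<Rightarrow> real) \<Rightarrow> real \<Rightarrow> real" where
  "rho_star \<rho> t = t * \<rho> (1 / t)"

definition phi_of_rho :: "real \<Rightarrow> (real \<Rightarrow> real) \<Rightarrow> real \<Rightarrow> ennreal" where
  "phi_of_rho p \<rho> v =
     (if v \<le> 0 then 0
      else ennreal (the_inv_into {0<..} (\<lambda>u. u powr (1 / p) * \<rho> (u powr (- 1 / p))) v))"

end

theory Submission
  imports Defs
begin

text \<open>
  Write \<open>\<phi> u = \<psi> (u\<^sup>p)\<close> with \<open>\<psi>\<close> convex. A nondecreasing convex function that vanishes
  at \<open>0\<close> is, up to a jump discussed below, a limit of nonnegative combinations of the hinge functions \<open>v \<mapsto> (v - s)\<^sub>+\<close>, so an inequality between modulars of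
  \<open>T x / (2\<^sup>1\<^sup>-\<^sup>1\<^sup>/\<^sup>p K)\<close> and \<open>x\<close> for all such \<open>\<phi>\<close> follows from the inequalities for the functions \<open>(u\<^sup>p - s)\<^sub>+\<close>
  alone (\<open>nn_integral_convex_mono\<close>). For those, truncate \<open>x\<close> at height \<open>r = s\<^sup>1\<^sup>/\<^sup>p\<close>, use the bound on \<open>L\<^sup>\<infinity>\<close>
  for the truncated part and the bound on \<open>L\<^sup>p\<close> for the excess; subadditivity and the convexity
  inequality \<open>(a + b)\<^sup>p \<le> 2\<^sup>p\<^sup>-\<^sup>1 (a\<^sup>p + b\<^sup>p)\<close> combine the two at the cost of the stated constant
  (\<open>op_excess_le\<close>).

  An Orlicz function may jump to a larger value at the end of the interval on which it is
  finite, and the hinge functions recover only its left-continuous version. The jump is handled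
  separately by comparing the measures of the sets where its end point is reached;
  rearrangement invariance excludes the case in which this comparison would fail
  (\<open>modular_infinite_of_tails_infinite\<close>).

  For the norm statement, the modular inequality at every scale passes to the Luxemburg and to
  the Orlicz norm at once, as both are determined by the values of the modular on all multiples of a
  function (\<open>modular_norm\<close>). Besides the Banach space properties this requires that the function
  \<open>\<phi>\<close> generated by a concave \<open>\<rho>\<close> have the convexity in question. A supporting line of \<open>\<rho>\<close>
  gives for the \<open>p\<close>-th power of \<open>\<phi>\<^sup>-\<^sup>1\<close> a majorant \<open>(a w\<^sup>1\<^sup>/\<^sup>p + b)\<^sup>p\<close> that is concave and touches it at a
  prescribed point, so this \<open>p\<close>-th power is concave and \<open>u \<mapsto> \<phi> (u\<^sup>1\<^sup>/\<^sup>p)\<close>, its inverse, is convex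
  (\<open>phi_inverse_powr_concave\<close>).
\<close>

section \<open>Convex functions as limits of nonnegative combinations of hinge functions\<close>

text \<open>
  The supremum over \<open>[0, u)\<close> is the left limit because the functions \<open>\<psi>\<close> considered are nondecreasing.
  It turns an Orlicz function into a left-continuous one and changes it in at most one point,
  the right end of the interval on which it is finite.
\<close>

definition left_lim :: "(real \<Rightarrow> ennreal) \<Rightarrow> real \<Rightarrow> ennreal" where
  "left_lim \<psi> u = (SUP v\<in>{0..<u}. \<psi> v)"

lemma left_lim_upper: "0 \<le> v \<Longrightarrow> v < u \<Longrightarrow> \<psi> v \<le> left_lim \<psi> u"
  unfolding left_lim_def by (rule SUP_upper) auto

lemma left_lim_le: "mono_on {0..} \<psi> \<Longrightarrow> left_lim \<psi> u \<le> \<psi> u"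
  unfolding left_lim_def by (auto intro!: SUP_least elim!: mono_onD)

lemma left_lim_mono: "u \<le> v \<Longrightarrow> left_lim \<psi> u \<le> left_lim \<psi> v"
  unfolding left_lim_def by (rule SUP_subset_mono) auto

lemma convex_funD_real:
  assumes "convex_fun \<psi>" "0 \<le> u" "0 \<le> v" "0 \<le> a" "a \<le> 1" "0 \<le> x" "0 \<le> y"
    and "\<psi> u = ennreal x" "\<psi> v = ennreal y" "\<psi> (a * u + (1 - a) * v) = ennreal z"
  shows "z \<le> a * x + (1 - a) * y"
proof -
  have "ennreal z \<le> ennreal a * ennreal x + ennreal (1 - a) * ennreal y"
    using assms unfolding convex_fun_def by (metis atLeastAtMost_iff)
  also have "\<dots> = ennreal (a * x + (1 - a) * y)"
    using assms by (simp add: ennreal_mult ennreal_plus)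
  finally have "ennreal z \<le> ennreal (a * x + (1 - a) * y)" .
  moreover have "0 \<le> a * x + (1 - a) * y" using assms(4-7) by simp
  ultimately show ?thesis by (simp only: ennreal_le_iff)
qed

text \<open>
  With a point \<open>w > u\<close> where \<open>\<psi>\<close> is finite, convexity bounds \<open>\<psi> u\<close> by
  \<open>a * S + (1 - a) * \<psi> w\<close>, where \<open>S\<close> is the left limit at \<open>u\<close> and \<open>a < 1\<close> is close to \<open>1\<close>.
\<close>

lemma left_lim_eq_of_finite_beyond:
  assumes mono: "mono_on {0..} \<psi>" and conv: "convex_fun \<psi>" and zero: "\<psi> 0 = 0"
    and uw: "0 \<le> u" "u < w" and fin: "\<psi> w < \<infinity>"
  shows "left_lim \<psi> u = \<psi> u"
proof (cases "u = 0")
  case True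
  then show ?thesis by (simp add: left_lim_def zero bot_ennreal)
next
  case False
  with uw have u: "0 < u" by simp
  obtain z where z: "\<psi> w = ennreal z" "0 \<le> z" using fin by (cases "\<psi> w") auto
  have le: "left_lim \<psi> u \<le> \<psi> u" by (rule left_lim_le[OF mono])
  have "\<psi> u \<le> \<psi> w" using mono uw by (auto elim!: mono_onD)
  then obtain y where y: "\<psi> u = ennreal y" "0 \<le> y" using z by (cases "\<psi> u") (auto simp: top_unique)
  obtain S where S: "left_lim \<psi> u = ennreal S" "0 \<le> S"
    using le y by (cases "left_lim \<psi> u") (auto simp: top_unique)
  have key: "y \<le> a * S + (1 - a) * z" if a: "0 < a" "a < 1" "w * (1 - a) \<le> u" for a
  proof -
    define v where "v = (u - (1 - a) * w) / a"
    have v0: "0 \<le> v" using a by (simp add: v_def mult.commute)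
    have vu: "v < u"
    proof -
      have "u * (1 - a) < w * (1 - a)" using uw a by simp
      then show ?thesis using a by (simp add: v_def field_simps)
    qed
    have vle: "\<psi> v \<le> ennreal S" using left_lim_upper[OF v0 vu, of \<psi>] S by simp
    then obtain x where x: "\<psi> v = ennreal x" "0 \<le> x" "x \<le> S"
      by (cases "\<psi> v") (auto simp: top_unique S ennreal_le_iff)
    have "a * v + (1 - a) * w = u" using a by (simp add: v_def)
    then have "y \<le> a * x + (1 - a) * z"
      by (intro convex_funD_real[OF conv v0, of w a x z y]) (use uw a x z y in auto)
    also have "\<dots> \<le> a * S + (1 - a) * z" using x a by (simp add: mult_left_mono)
    finally show ?thesis .
  qed
  have "y \<le> 1 * S + (1 - 1) * z"
  proof (rule tendsto_lowerbound[where F = "at_left (1::real)" and f = "\<lambda>a. a * S + (1 - a) * z"])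
    show "((\<lambda>a. a * S + (1 - a) * z) \<longlongrightarrow> 1 * S + (1 - 1) * z) (at_left 1)"
      by (intro tendsto_intros)
    have l: "max 0 (1 - u / w) < 1" using u uw by auto
    show "\<forall>\<^sub>F a in at_left 1. y \<le> a * S + (1 - a) * z"
      unfolding eventually_at_left[OF l]
    proof (intro exI[of _ "max 0 (1 - u / w)"] conjI allI impI l)
      fix a :: real assume a: "max 0 (1 - u / w) < a" "a < 1"
      then have "w * (1 - a) \<le> u" using u uw by (simp add: field_simps)
      then show "y \<le> a * S + (1 - a) * z" using key a by simp
    qed
  qed auto
  then have "\<psi> u \<le> left_lim \<psi> u" using y S by (simp add: ennreal_leI)
  with le show ?thesis by simp
qed

text \<open>
  The sum is the piecewise linear function with value \<open>\<psi> ((i - 1) * h)\<close> at the node \<open>i * h\<close>: it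
  interpolates \<open>\<psi>\<close> shifted to the right by \<open>h\<close>, and \<open>c i\<close> is the change of slope at \<open>i * h\<close>,
  nonnegative by convexity. Chords of a convex function lie above it; the shift by one step is
  what pushes the interpolant below \<open>\<psi>\<close>, even below its left limit, while it still dominates
  \<open>\<psi>\<close> shifted by two steps.
\<close>

lemma chord_interpolant:
  fixes h :: real and N :: nat
  assumes mono: "mono_on {0..} \<psi>" and conv: "convex_fun \<psi>" and zero: "\<psi> 0 = 0"
    and h: "0 < h" and fin: "\<psi> (real N * h) < \<infinity>"
  obtains c :: "nat \<Rightarrow> real" where "\<And>i. i \<in> {1..N} \<Longrightarrow> 0 \<le> c i"
    and "\<And>u. 0 \<le> u \<Longrightarrow>
      \<psi> (max 0 (min u (real N * h) - 2 * h)) \<le> ennreal (\<Sum>i\<in>{1..N}. c i * max 0 (u - real i * h))"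
    and "\<And>u. 0 \<le> u \<Longrightarrow> ennreal (\<Sum>i\<in>{1..N}. c i * max 0 (u - real i * h)) \<le> left_lim \<psi> u"
proof -
  define a where "a i = enn2real (\<psi> (real i * h))" for i :: nat
  \<comment> \<open>As \<open>0 - 1 = 0\<close> on the natural numbers, \<open>d 0 = 0\<close>: the function is flat before the first node.\<close>
  define d where "d i = a i - a (i - 1)" for i
  define c where "c i = (d i - d (i - 1)) / h" for i
  define G where "G n u = (\<Sum>i\<in>{1..n}. c i * max 0 (u - real i * h))" for n u
  have psi_a: "\<psi> (real i * h) = ennreal (a i)" if "i \<le> N" for i
  proof -
    have "\<psi> (real i * h) \<le> \<psi> (real N * h)"
      using that h by (intro mono_onD[OF mono]) auto
    then show ?thesis using fin unfolding a_def by (simp add: top.not_eq_extremum less_le_trans)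
  qed
  have a_nn: "0 \<le> a i" for i by (simp add: a_def)
  have a0: "a 0 = 0" by (simp add: a_def zero)
  have d_nn: "0 \<le> d i" if "i \<le> N" for i
  proof -
    have "\<psi> (real (i - 1) * h) \<le> \<psi> (real i * h)"
      using h by (intro mono_onD[OF mono]) auto
    then show ?thesis using that psi_a[of i] psi_a[of "i - 1"] a_nn by (simp add: d_def ennreal_le_iff)
  qed
  have d0: "d 0 = 0" by (simp add: d_def)
  have d_mono: "d (i - 1) \<le> d i" if i: "i \<in> {1..N}" for i
  proof (cases "i = 1")
    case True
    then show ?thesis using d_nn[of 1] i d0 by simp
  next
    case False
    define j where "j = i - 2"
    have j: "i = Suc (Suc j)" using False i by (auto simp: j_def)
    have "a (Suc j) \<le> (1/2) * a j + (1 - 1/2) * a (Suc (Suc j))"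
    proof (rule convex_funD_real[OF conv])
      have "(1/2) * (real j * h) + (1 - 1/2) * (real (Suc (Suc j)) * h) = real (Suc j) * h"
        by (simp add: field_simps)
      then show "\<psi> ((1/2) * (real j * h) + (1 - 1/2) * (real (Suc (Suc j)) * h)) = ennreal (a (Suc j))"
        using psi_a[of "Suc j"] i j by (metis Suc_leD atLeastAtMost_iff)
      show "\<psi> (real j * h) = ennreal (a j)" "\<psi> (real (Suc (Suc j)) * h) = ennreal (a (Suc (Suc j)))"
        using psi_a[of j] psi_a[of "Suc (Suc j)"] i j by auto
    qed (use h a_nn in auto)
    then show ?thesis by (simp add: d_def j)
  qed
  have c_nn: "0 \<le> c i" if "i \<in> {1..N}" for i using d_mono[OF that] h by (simp add: c_def)
  \<comment> \<open>To the right of the last node it contains, a partial sum is affine with slope \<open>d n / h\<close>.\<close>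
  have G_above: "G n u = a (n - 1) + d n * (u - real n * h) / h" if "real n * h \<le> u" for n u
    using that
  proof (induction n)
    case 0
    then show ?case by (simp add: G_def a0 d0)
  next
    case (Suc n)
    have le: "real n * h \<le> u" using Suc.prems h by (simp add: algebra_simps)
    have "G (Suc n) u = G n u + c (Suc n) * (u - real (Suc n) * h)"
      using Suc.prems by (simp add: G_def)
    also have "\<dots> = a (n - 1) + d n * (u - real n * h) / h + (d (Suc n) - d n) / h * (u - real (Suc n) * h)"
      using Suc.IH[OF le] by (simp add: c_def)
    also have "\<dots> = a (n - 1) + d n + d (Suc n) * (u - real (Suc n) * h) / h"
      using h by (simp add: field_simps)
    also have "a (n - 1) + d n = a n" by (simp add: d_def)
    finally show ?case by simp
  qed
  have G_cut: "G N u = G n u" if "n \<le> N" "n < N \<Longrightarrow> u \<le> real (Suc n) * h" for n u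
  proof (cases "n < N")
    case True
    have "max 0 (u - real i * h) = 0" if "i \<in> {1..N} - {1..n}" for i
    proof -
      have "Suc n \<le> i" using that by auto
      then have "real (Suc n) * h \<le> real i * h" using h by (intro mult_right_mono) auto
      then show ?thesis using \<open>n < N \<Longrightarrow> u \<le> real (Suc n) * h\<close>[OF True] by auto
    qed
    then show ?thesis unfolding G_def using that(1)
      by (intro sum.mono_neutral_right) auto
  qed (use that in auto)
  have lower: "\<psi> (max 0 (min u (real N * h) - 2 * h)) \<le> ennreal (G N u)" if u: "0 \<le> u" for u
  proof -
    define n where "n = min N (nat \<lfloor>u / h\<rfloor>)"
    have fl: "real (nat \<lfloor>u / h\<rfloor>) * h \<le> u" "u < (real (nat \<lfloor>u / h\<rfloor>) + 1) * h"
    proof -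
      have "real (nat \<lfloor>u / h\<rfloor>) = of_int \<lfloor>u / h\<rfloor>" using u h by simp
      then show "real (nat \<lfloor>u / h\<rfloor>) * h \<le> u" "u < (real (nat \<lfloor>u / h\<rfloor>) + 1) * h"
        using h floor_correct[of "u / h"] by (auto simp only: pos_le_divide_eq pos_divide_less_eq of_int_add of_int_1)
    qed
    have nN: "n \<le> N" by (simp add: n_def)
    have "real n * h \<le> real (nat \<lfloor>u / h\<rfloor>) * h" using h by (intro mult_right_mono) (auto simp: n_def)
    with fl have nu: "real n * h \<le> u" by simp
    have un: "u \<le> real (Suc n) * h" if "n < N" using fl that by (auto simp: n_def min_def algebra_simps split: if_splits)
    have "a (n - 1) \<le> G N u"
      using G_cut[OF nN un] G_above[OF nu] d_nn[OF nN] nu h by simp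
    moreover have "max 0 (min u (real N * h) - 2 * h) \<le> real (n - 1) * h"
    proof (cases "n = 0")
      case True
      then show ?thesis using un h by (cases "N = 0") auto
    next
      case False
      then have n1: "real (n - 1) * h = real n * h - h" by (simp add: of_nat_diff algebra_simps)
      have "h \<le> real n * h" using False h by simp
      moreover have "min u (real N * h) \<le> real n * h + h"
        using un h nN by (cases "n < N") (auto simp: algebra_simps)
      ultimately show ?thesis unfolding n1 using h by linarith
    qed
    then have "\<psi> (max 0 (min u (real N * h) - 2 * h)) \<le> \<psi> (real (n - 1) * h)"
      using h by (intro mono_onD[OF mono]) auto
    ultimately show ?thesis using psi_a[of "n - 1"] nN by (auto intro: order_trans ennreal_leI)
  qed
  have upper: "ennreal (G N u) \<le> left_lim \<psi> u" if u: "0 \<le> u" for u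
  proof (cases "u = 0")
    case True
    then have "G N u = 0" using h by (auto simp: G_def intro!: sum.neutral)
    then show ?thesis by simp
  next
    case False
    with u have u: "0 < u" by simp
    define m where "m = nat \<lceil>u / h\<rceil> - 1"
    define n where "n = min N m"
    have ce: "real m * h < u" "u \<le> real (Suc m) * h"
    proof -
      have "0 < \<lceil>u / h\<rceil>" using u h by simp
      then have "int m = \<lceil>u / h\<rceil> - 1" unfolding m_def by linarith
      then have "real m = of_int \<lceil>u / h\<rceil> - 1" by (metis of_int_1 of_int_diff of_int_of_nat_eq)
      moreover have "of_int \<lceil>u / h\<rceil> - 1 < u / h" "u / h \<le> of_int \<lceil>u / h\<rceil>"
        using ceiling_correct[of "u / h"] by auto
      ultimately have "real m < u / h" "u / h \<le> real (Suc m)" by simp_all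
      then show "real m * h < u" "u \<le> real (Suc m) * h" using h by (auto simp: field_simps)
    qed
    have nN: "n \<le> N" by (simp add: n_def)
    have "real n * h \<le> real m * h" using h by (intro mult_right_mono) (auto simp: n_def)
    with ce have nu: "real n * h < u" by simp
    have un: "u \<le> real (Suc n) * h" if "n < N" using that ce by (auto simp: n_def min_def split: if_splits)
    have Gn: "G N u = a (n - 1) + d n * (u - real n * h) / h"
      using G_cut[OF nN un] G_above[of n u] nu by simp
    show ?thesis
    proof (cases "u \<le> real (Suc n) * h")
      case True
      have "(u - real n * h) / h \<le> 1" using True h by (simp add: field_simps)
      then have "d n * ((u - real n * h) / h) \<le> d n * 1"
        by (rule mult_left_mono) (rule d_nn[OF nN])
      then have "G N u \<le> a n" unfolding Gn by (simp add: d_def)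
      then have "ennreal (G N u) \<le> \<psi> (real n * h)" using psi_a[OF nN] by (simp add: ennreal_leI)
      also have "\<dots> \<le> left_lim \<psi> u" using nu h by (intro left_lim_upper) auto
      finally show ?thesis .
    next
      case False
      then have n: "n = N" using un nN by (cases "n < N") auto
      show ?thesis
      proof (cases "N = 0")
        case True
        then show ?thesis by (simp add: G_def)
      next
        case N: False
        define v where "v = u - h"
        define x where "x = real (N - 1) * h"
        have v: "real N * h < v" "v < u" using False h by (auto simp: v_def n algebra_simps)
        have xN: "real N * h = x + h" using N by (simp add: x_def algebra_simps of_nat_diff)
        have x0: "0 \<le> x" using h by (simp add: x_def)
        have G': "G N u = a (N - 1) + d N * (v - x) / h"
        proof -
          have "u - real N * h = v - x" by (simp add: xN v_def)
          then show ?thesis using Gn unfolding n by (simp only:)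
        qed
        \<comment> \<open>Beyond the last node the last chord is extrapolated. One step to the left of \<open>u\<close>, at \<open>v\<close>, the extrapolation of the chord of \<open>\<psi>\<close> over \<open>[x, x + h]\<close> has the same value, and it lies below \<open>\<psi>\<close>.\<close>
        have "ennreal (G N u) \<le> \<psi> v"
        proof (cases "\<psi> v")
          case (real y)
          define b where "b = (v - x - h) / (v - x)"
          have vx: "0 < v - x" "h < v - x" using v xN h by auto
          have b: "0 \<le> b" "b \<le> 1" "1 - b = h / (v - x)" using vx h by (auto simp: b_def field_simps)
          have pt: "b * x + (1 - b) * v = real N * h"
          proof -
            have "b * x + (1 - b) * v = v - b * (v - x)" by (simp add: algebra_simps)
            then show ?thesis using vx by (simp add: b_def xN)
          qed
          have "a N \<le> b * a (N - 1) + (1 - b) * y"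
          proof (rule convex_funD_real[OF conv x0])
            show "\<psi> x = ennreal (a (N - 1))" using psi_a[of "N - 1"] by (simp add: x_def)
            show "\<psi> (b * x + (1 - b) * v) = ennreal (a N)" unfolding pt using psi_a[of N] by blast
          qed (use x0 vx b a_nn real in auto)
          then have "d N \<le> (1 - b) * (y - a (N - 1))" by (simp add: d_def algebra_simps)
          then have "d N * (v - x) \<le> (1 - b) * (y - a (N - 1)) * (v - x)"
            using vx by (intro mult_right_mono) auto
          also have "\<dots> = h * (y - a (N - 1))" using vx b(3) by simp
          finally have "G N u \<le> y" unfolding G' using h by (simp add: field_simps)
          then show ?thesis using real by (simp add: ennreal_leI)
        qed auto
        also have "\<dots> \<le> left_lim \<psi> u" using v xN x0 h by (intro left_lim_upper) auto
        finally show ?thesis .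
      qed
    qed
  qed
  show ?thesis
    by (rule that[of c]) (use c_nn lower upper in \<open>auto simp: G_def\<close>)
qed

section \<open>Majorisation\<close>

lemma measurable_mono_comp:
  fixes \<psi> :: "real \<Rightarrow> ennreal"
  assumes mono: "mono_on {0..} \<psi>" and x: "x \<in> borel_measurable M" and nn: "\<And>t. 0 \<le> x t"
  shows "(\<lambda>t. \<psi> (x t)) \<in> borel_measurable M"
proof -
  have "(\<lambda>u. \<psi> (max 0 u)) \<in> borel_measurable borel"
  proof (rule borel_measurableI_greater)
    fix c
    have "is_interval {u \<in> space borel. c < \<psi> (max 0 u)}"
      unfolding is_interval_1
    proof (intro ballI allI impI)
      fix a b z assume "a \<in> {u \<in> space borel. c < \<psi> (max 0 u)}" and az: "a \<le> z \<and> z \<le> b"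
      then have "c < \<psi> (max 0 a)" by simp
      also have "\<dots> \<le> \<psi> (max 0 z)" using az by (intro mono_onD[OF mono]) auto
      finally show "z \<in> {u \<in> space borel. c < \<psi> (max 0 u)}" by simp
    qed
    then show "{u \<in> space borel. c < \<psi> (max 0 u)} \<in> sets borel"
      by (rule real_interval_borel_measurable)
  qed
  from measurable_compose[OF x this] show ?thesis using nn by (simp add: max_def)
qed

lemma finiteness_threshold:
  fixes \<psi> :: "real \<Rightarrow> ennreal"
  assumes mono: "mono_on {0..} \<psi>" and w0: "0 < w0" "\<psi> w0 < \<infinity>"
    and inf: "\<not> (\<forall>w\<ge>0. \<psi> w < \<infinity>)"
  obtains b :: real where "0 < b" "\<And>w. 0 \<le> w \<Longrightarrow> \<psi> w < \<infinity> \<Longrightarrow> w \<le> b"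
    "\<And>w. 0 \<le> w \<Longrightarrow> w < b \<Longrightarrow> \<psi> w < \<infinity>"
proof -
  obtain z where z0: "0 \<le> z" and "\<not> \<psi> z < \<infinity>" using inf by blast
  then have z: "0 \<le> z" "\<psi> z = \<infinity>" by (simp_all add: less_top[symmetric])
  define B where "B = {w. 0 \<le> w \<and> \<psi> w < \<infinity>}"
  define b where "b = Sup B"
  have zB: "w \<le> z" if "w \<in> B" for w
  proof (rule ccontr)
    assume "\<not> w \<le> z"
    then have "\<psi> z \<le> \<psi> w" using z by (intro mono_onD[OF mono]) auto
    then show False using that z by (simp add: B_def top_unique)
  qed
  then have bdd: "bdd_above B" by (auto simp: bdd_above_def)
  have w0B: "w0 \<in> B" using w0 by (simp add: B_def)
  then have b: "0 < b" using cSup_upper[OF w0B bdd] w0 by (simp add: b_def)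
  have leb: "w \<le> b" if "0 \<le> w" "\<psi> w < \<infinity>" for w
    using cSup_upper[OF _ bdd, of w] that by (simp add: b_def B_def)
  have fin: "\<psi> w < \<infinity>" if w: "0 \<le> w" "w < b" for w
  proof -
    obtain v where v: "v \<in> B" "w < v" using w less_cSup_iff[of B w] w0B bdd by (auto simp: b_def)
    then have "\<psi> w \<le> \<psi> v" using w by (intro mono_onD[OF mono]) auto
    then show ?thesis using v by (auto simp: B_def)
  qed
  show ?thesis by (rule that[OF b leb fin])
qed

text \<open>
  Points that exhaust the interval on which \<open>\<psi>\<close> is finite, growing so slowly that the mesh
  \<open>S n / (n + 2)\<^sup>2\<close> tends to \<open>0\<close>.
\<close>

lemma finite_nodes:
  fixes \<psi> :: "real \<Rightarrow> ennreal"
  assumes mono: "mono_on {0..} \<psi>" and w0: "0 < w0" "\<psi> w0 < \<infinity>"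
  obtains S :: "nat \<Rightarrow> real" where "\<And>n. 0 < S n" "\<And>n. \<psi> (S n) < \<infinity>" "\<And>n. S n \<le> S 0 * real (n + 2)"
    "\<And>v w. 0 \<le> v \<Longrightarrow> v < w \<Longrightarrow> \<psi> w < \<infinity> \<Longrightarrow> \<forall>\<^sub>F n in sequentially. v < S n"
proof (cases "\<forall>w\<ge>0. \<psi> w < \<infinity>")
  case True
  show ?thesis
  proof (rule that[of "\<lambda>n. real (n + 1)"])
    fix v w :: real assume "0 \<le> v" "v < w"
    show "\<forall>\<^sub>F n in sequentially. v < real (n + 1)" by real_asymp
  qed (use True in auto)
next
  case False
  then obtain b where b: "0 < b" and leb: "\<And>w. 0 \<le> w \<Longrightarrow> \<psi> w < \<infinity> \<Longrightarrow> w \<le> b"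
    and fin: "\<And>w. 0 \<le> w \<Longrightarrow> w < b \<Longrightarrow> \<psi> w < \<infinity>"
    using finiteness_threshold[OF mono w0] by metis
  show ?thesis
  proof (rule that[of "\<lambda>n. b * (real (n + 1) / real (n + 2))"])
    fix n
    show "0 < b * (real (n + 1) / real (n + 2))" using b by simp
    show "\<psi> (b * (real (n + 1) / real (n + 2))) < \<infinity>"
      using b by (intro fin) (auto simp: field_simps)
    show "b * (real (n + 1) / real (n + 2)) \<le> b * (real (0 + 1) / real (0 + 2)) * real (n + 2)"
      using b by (simp add: field_simps)
  next
    fix v w assume v: "0 \<le> v" "v < w" "\<psi> w < \<infinity>"
    then have "w \<le> b" by (intro leb) auto
    then have vb: "v < b" using v by simp
    have "(\<lambda>n. b * (real (n + 1) / real (n + 2))) \<longlonglongrightarrow> b * 1"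
      by (intro tendsto_mult tendsto_const) real_asymp
    then show "\<forall>\<^sub>F n in sequentially. v < b * (real (n + 1) / real (n + 2))"
      using vb by (intro order_tendstoD(1)) auto
  qed
qed

text \<open>
  The interpolants of \<open>chord_interpolant\<close> are nonnegative combinations of the functions
  \<open>u \<mapsto> (u - s)\<^sub>+\<close>, so the assumption gives the inequality for each of them. They lie below the left
  limit of \<open>\<psi>\<close> and their lower limit is at least that left limit; Fatou's lemma concludes. As
  \<open>ennreal\<close> maps negative reals to \<open>0\<close>, \<open>ennreal (y t - s)\<close> is the positive part.
\<close>

lemma nn_integral_left_lim_mono:
  assumes mono: "mono_on {0..} \<psi>" and conv: "convex_fun \<psi>" and zero: "\<psi> 0 = 0"
    and w0: "0 < w0" "\<psi> w0 < \<infinity>"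
    and y[measurable]: "y \<in> borel_measurable M" and x[measurable]: "x \<in> borel_measurable M"
    and y0: "\<And>t. 0 \<le> y t" and x0: "\<And>t. 0 \<le> x t"
    and H: "\<And>s. 0 \<le> s \<Longrightarrow> (\<integral>\<^sup>+t. ennreal (y t - s) \<partial>M) \<le> (\<integral>\<^sup>+t. ennreal (x t - s) \<partial>M)"
    and reach: "AE t in M. \<forall>v. 0 \<le> v \<longrightarrow> v < y t \<longrightarrow> \<psi> v < \<infinity>"
  shows "(\<integral>\<^sup>+t. left_lim \<psi> (y t) \<partial>M) \<le> (\<integral>\<^sup>+t. left_lim \<psi> (x t) \<partial>M)"
proof -
  obtain S :: "nat \<Rightarrow> real" where S: "\<And>n. 0 < S n" "\<And>n. \<psi> (S n) < \<infinity>" "\<And>n. S n \<le> S 0 * real (n + 2)"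
    and S_ev: "\<And>v w. 0 \<le> v \<Longrightarrow> v < w \<Longrightarrow> \<psi> w < \<infinity> \<Longrightarrow> \<forall>\<^sub>F n in sequentially. v < S n"
    using finite_nodes[OF mono w0] by metis
  define N where "N n = (n + 2) * (n + 2)" for n :: nat
  define h where "h n = S n / real (N n)" for n
  have "0 < real (N n)" for n unfolding N_def of_nat_0_less_iff by simp
  then have h0: "0 < h n" for n using S(1)[of n] by (simp add: h_def)
  have Nh: "real (N n) * h n = S n" for n using \<open>0 < real (N n)\<close> by (simp add: h_def)
  have h_le: "h n \<le> S 0 / real (n + 2)" for n
  proof -
    have "h n \<le> (S 0 * real (n + 2)) / real (N n)"
      unfolding h_def by (intro divide_right_mono S(3)) simp
    also have "\<dots> = S 0 / real (n + 2)" unfolding N_def of_nat_mult by simp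
    finally show ?thesis .
  qed
  have "h \<longlonglongrightarrow> 0"
  proof (rule tendsto_sandwich[where f = "\<lambda>_. 0" and h = "\<lambda>n. S 0 / real (n + 2)"])
    show "(\<lambda>n. S 0 / real (n + 2)) \<longlonglongrightarrow> 0" by real_asymp
  qed (use h_le h0 in \<open>auto simp: less_imp_le\<close>)
  define I where "I n c u = ennreal (\<Sum>i\<in>{1..N n}. c i * max 0 (u - real i * h n))" for n and c :: "nat \<Rightarrow> real" and u
  have "\<forall>n. \<exists>c. (\<forall>i\<in>{1..N n}. 0 \<le> c i) \<and>
      (\<forall>u\<ge>0. \<psi> (max 0 (min u (S n) - 2 * h n)) \<le> I n c u \<and> I n c u \<le> left_lim \<psi> u)"
  proof
    fix n
    obtain c where "\<And>i. i \<in> {1..N n} \<Longrightarrow> 0 \<le> c i"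
      "\<And>u. 0 \<le> u \<Longrightarrow> \<psi> (max 0 (min u (S n) - 2 * h n)) \<le> I n c u" "\<And>u. 0 \<le> u \<Longrightarrow> I n c u \<le> left_lim \<psi> u"
      using chord_interpolant[OF mono conv zero h0[of n], of "N n", unfolded Nh, OF S(2)]
      unfolding I_def by blast
    then show "\<exists>c. (\<forall>i\<in>{1..N n}. 0 \<le> c i) \<and>
      (\<forall>u\<ge>0. \<psi> (max 0 (min u (S n) - 2 * h n)) \<le> I n c u \<and> I n c u \<le> left_lim \<psi> u)" by blast
  qed
  then obtain c where c: "\<forall>n. (\<forall>i\<in>{1..N n}. 0 \<le> c n i) \<and>
      (\<forall>u\<ge>0. \<psi> (max 0 (min u (S n) - 2 * h n)) \<le> I n (c n) u \<and> I n (c n) u \<le> left_lim \<psi> u)"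
    by (rule choice[THEN exE]) blast
  then have c0: "\<And>n i. i \<in> {1..N n} \<Longrightarrow> 0 \<le> c n i"
    and lower: "\<And>n u. 0 \<le> u \<Longrightarrow> \<psi> (max 0 (min u (S n) - 2 * h n)) \<le> I n (c n) u"
    and upper: "\<And>n u. 0 \<le> u \<Longrightarrow> I n (c n) u \<le> left_lim \<psi> u"
    by blast+
  define g where "g n u = (\<Sum>i\<in>{1..N n}. ennreal (c n i) * ennreal (u - real i * h n))" for n u
  have g_eq: "g n u = I n (c n) u" for n u
  proof -
    have "ennreal (c n i) * ennreal (u - real i * h n) = ennreal (c n i * max 0 (u - real i * h n))"
      if "i \<in> {1..N n}" for i
    proof -
      have "ennreal (u - real i * h n) = ennreal (max 0 (u - real i * h n))"
        by (auto simp: max_def ennreal_neg)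
      then show ?thesis using c0[OF that] by (simp add: ennreal_mult)
    qed
    then show ?thesis
      unfolding g_def I_def using c0 by (subst sum_ennreal[symmetric]) (auto intro!: sum.cong)
  qed
  have g_int: "(\<integral>\<^sup>+t. g n (z t) \<partial>M) = (\<Sum>i\<in>{1..N n}. ennreal (c n i) * (\<integral>\<^sup>+t. ennreal (z t - real i * h n) \<partial>M))"
    if [measurable]: "z \<in> borel_measurable M" for n z
    unfolding g_def by (simp add: nn_integral_sum nn_integral_cmult)
  have step: "(\<integral>\<^sup>+t. g n (y t) \<partial>M) \<le> (\<integral>\<^sup>+t. left_lim \<psi> (x t) \<partial>M)" for n
  proof -
    have "(\<integral>\<^sup>+t. g n (y t) \<partial>M) \<le> (\<integral>\<^sup>+t. g n (x t) \<partial>M)"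
      unfolding g_int[OF y] g_int[OF x]
      by (intro sum_mono mult_left_mono H) (use h0[of n] in auto)
    also have "\<dots> \<le> (\<integral>\<^sup>+t. left_lim \<psi> (x t) \<partial>M)"
      by (intro nn_integral_mono) (simp add: g_eq upper x0)
    finally show ?thesis .
  qed
  have lim: "left_lim \<psi> u \<le> liminf (\<lambda>n. g n u)" if u: "0 \<le> u" and fin: "\<forall>v. 0 \<le> v \<longrightarrow> v < u \<longrightarrow> \<psi> v < \<infinity>" for u
    unfolding left_lim_def
  proof (rule SUP_least)
    fix v assume v: "v \<in> {0..<u}"
    define d where "d = (u - v) / 3"
    have d: "0 < d" "v + d < u" "v + 2 * d < u" using v by (auto simp: d_def field_simps)
    have "\<forall>\<^sub>F n in sequentially. v + d < S n"
      using d v fin by (intro S_ev[of "v + d" "v + 2 * d"]) auto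
    moreover have "\<forall>\<^sub>F n in sequentially. h n < d / 2"
      using \<open>h \<longlonglongrightarrow> 0\<close> d by (intro order_tendstoD(2)) auto
    ultimately have "\<forall>\<^sub>F n in sequentially. \<psi> v \<le> g n u"
    proof eventually_elim
      case (elim n)
      then have "\<psi> v \<le> \<psi> (max 0 (min u (S n) - 2 * h n))"
        using d v by (intro mono_onD[OF mono]) auto
      also have "\<dots> \<le> g n u" using lower[OF u] by (simp add: g_eq)
      finally show ?case .
    qed
    then show "\<psi> v \<le> liminf (\<lambda>n. g n u)" by (rule Liminf_bounded)
  qed
  have "(\<integral>\<^sup>+t. left_lim \<psi> (y t) \<partial>M) \<le> (\<integral>\<^sup>+t. liminf (\<lambda>n. g n (y t)) \<partial>M)"
    using reach by (intro nn_integral_mono_AE) (auto elim!: eventually_mono intro!: lim y0)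
  also have "\<dots> \<le> liminf (\<lambda>n. \<integral>\<^sup>+t. g n (y t) \<partial>M)"
    by (rule nn_integral_liminf) (simp add: g_def)
  also have "\<dots> \<le> (\<integral>\<^sup>+t. left_lim \<psi> (x t) \<partial>M)"
    by (rule order_trans[OF Liminf_le_Limsup Limsup_bounded]) (simp_all add: step)
  finally show ?thesis .
qed

text \<open>
  This is the majorisation principle of Hardy, Littlewood and Polya. What remains beyond the
  previous lemma is the jump \<open>J\<close> of \<open>\<psi>\<close> at the right end \<open>b\<close> of its interval of finiteness. It contributes
  \<open>J\<close> times the measure of \<open>{y \<ge> b}\<close>, and dividing the assumption at level \<open>s < b\<close> by \<open>b - s\<close> bounds
  this measure by that of \<open>{x > s}\<close>. Letting \<open>s\<close> tend to \<open>b\<close> requires one such set of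
  finite measure; \<open>tail\<close> says that otherwise the right hand side is infinite.
\<close>

theorem nn_integral_convex_mono:
  assumes mono: "mono_on {0..} \<psi>" and conv: "convex_fun \<psi>" and zero: "\<psi> 0 = 0"
    and w0: "0 < w0" "\<psi> w0 < \<infinity>"
    and y[measurable]: "y \<in> borel_measurable M" and x[measurable]: "x \<in> borel_measurable M"
    and y0: "\<And>t. 0 \<le> y t" and x0: "\<And>t. 0 \<le> x t"
    and H: "\<And>s. 0 \<le> s \<Longrightarrow> (\<integral>\<^sup>+t. ennreal (y t - s) \<partial>M) \<le> (\<integral>\<^sup>+t. ennreal (x t - s) \<partial>M)"
    and tail: "\<And>b. 0 < b \<Longrightarrow> 0 < \<psi> b \<Longrightarrow>
        (\<And>s. 0 \<le> s \<Longrightarrow> s < b \<Longrightarrow> emeasure M {t \<in> space M. s < x t} = \<infinity>) \<Longrightarrow>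
        (\<integral>\<^sup>+t. \<psi> (x t) \<partial>M) = \<infinity>"
  shows "(\<integral>\<^sup>+t. \<psi> (y t) \<partial>M) \<le> (\<integral>\<^sup>+t. \<psi> (x t) \<partial>M)"
proof (cases "(\<integral>\<^sup>+t. \<psi> (x t) \<partial>M) = \<infinity>")
  case finite: False
  have [measurable]: "(\<lambda>t. \<psi> (y t)) \<in> borel_measurable M" "(\<lambda>t. \<psi> (x t)) \<in> borel_measurable M"
    by (intro measurable_mono_comp[OF mono] y x y0 x0)+
  have llm: "mono_on {0..} (left_lim \<psi>)" by (auto intro!: mono_onI left_lim_mono)
  have [measurable]: "(\<lambda>t. left_lim \<psi> (y t)) \<in> borel_measurable M" "(\<lambda>t. left_lim \<psi> (x t)) \<in> borel_measurable M"
    by (intro measurable_mono_comp[OF llm] y x y0 x0)+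
  show ?thesis
  proof (cases "\<forall>w\<ge>0. \<psi> w < \<infinity>")
    case True
    have eq: "left_lim \<psi> u = \<psi> u" if "0 \<le> u" for u
      using True that by (intro left_lim_eq_of_finite_beyond[OF mono conv zero, of u "u + 1"]) auto
    have "(\<integral>\<^sup>+t. left_lim \<psi> (y t) \<partial>M) \<le> (\<integral>\<^sup>+t. left_lim \<psi> (x t) \<partial>M)"
      by (rule nn_integral_left_lim_mono[OF mono conv zero w0 y x y0 x0 H]) (use True in auto)
    then show ?thesis by (simp add: eq y0 x0)
  next
    case False
    then obtain b where b: "0 < b" and leb: "\<And>w. 0 \<le> w \<Longrightarrow> \<psi> w < \<infinity> \<Longrightarrow> w \<le> b"
      and fin: "\<And>w. 0 \<le> w \<Longrightarrow> w < b \<Longrightarrow> \<psi> w < \<infinity>"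
      using finiteness_threshold[OF mono w0] by metis
    have xb: "AE t in M. x t \<le> b"
      using nn_integral_PInf_AE[of "\<lambda>t. \<psi> (x t)" M] finite
      by (auto elim!: eventually_mono intro!: leb x0 simp: top.not_eq_extremum)
    \<comment> \<open>The assumption at level \<open>b\<close> carries the bound over from \<open>x\<close> to \<open>y\<close>.\<close>
    have yb: "AE t in M. y t \<le> b"
    proof -
      have "(\<integral>\<^sup>+t. ennreal (x t - b) \<partial>M) = (\<integral>\<^sup>+t. 0 \<partial>M)"
        using xb by (intro nn_integral_cong_AE) (auto elim!: eventually_mono simp: ennreal_neg)
      then have "(\<integral>\<^sup>+t. ennreal (y t - b) \<partial>M) = 0" using H[of b] b by simp
      then have "AE t in M. ennreal (y t - b) = 0" by (subst (asm) nn_integral_0_iff_AE) auto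
      then show ?thesis by eventually_elim (simp add: ennreal_eq_0_iff)
    qed
    have yr: "AE t in M. \<forall>v. 0 \<le> v \<longrightarrow> v < y t \<longrightarrow> \<psi> v < \<infinity>"
      using yb by eventually_elim (meson fin less_le_trans)
    have left: "(\<integral>\<^sup>+t. left_lim \<psi> (y t) \<partial>M) \<le> (\<integral>\<^sup>+t. left_lim \<psi> (x t) \<partial>M)"
      by (rule nn_integral_left_lim_mono[OF mono conv zero w0 y x y0 x0 H yr])
    have eq: "left_lim \<psi> u = \<psi> u" if "0 \<le> u" "u < b" for u
    proof -
      obtain w where "u < w" "w < b" using \<open>u < b\<close> dense by blast
      then show ?thesis
        using that fin by (intro left_lim_eq_of_finite_beyond[OF mono conv zero, of u w]) auto
    qed
    define J where "J = \<psi> b - left_lim \<psi> b"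
    have J: "\<psi> b = left_lim \<psi> b + J"
      unfolding J_def by (rule add_diff_inverse_ennreal[OF left_lim_le[OF mono], symmetric])
    have split: "(\<integral>\<^sup>+t. \<psi> (f t) \<partial>M) = (\<integral>\<^sup>+t. left_lim \<psi> (f t) \<partial>M) + J * emeasure M {t \<in> space M. b \<le> f t}"
      if f[measurable]: "f \<in> borel_measurable M" "(\<lambda>t. left_lim \<psi> (f t)) \<in> borel_measurable M"
        and f0: "\<And>t. 0 \<le> f t" and fb: "AE t in M. f t \<le> b" for f
    proof -
      have "(\<integral>\<^sup>+t. \<psi> (f t) \<partial>M) = (\<integral>\<^sup>+t. left_lim \<psi> (f t) + J * indicator {t \<in> space M. b \<le> f t} t \<partial>M)"
      proof (rule nn_integral_cong_AE)
        show "AE t in M. \<psi> (f t) = left_lim \<psi> (f t) + J * indicator {t \<in> space M. b \<le> f t} t"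
          using fb AE_space
        proof eventually_elim
          case (elim t)
          show ?case
          proof (cases "f t = b")
            case True
            then show ?thesis using elim J by simp
          next
            case False
            then show ?thesis using elim eq[of "f t"] f0[of t] by (simp add: indicator_def)
          qed
        qed
      qed
      also have "\<dots> = (\<integral>\<^sup>+t. left_lim \<psi> (f t) \<partial>M) + J * emeasure M {t \<in> space M. b \<le> f t}"
        by (simp add: nn_integral_add nn_integral_cmult_indicator)
      finally show ?thesis .
    qed
    have "J * emeasure M {t \<in> space M. b \<le> y t} \<le> J * emeasure M {t \<in> space M. b \<le> x t}"
    proof (cases "J = 0")
      case False
      then have "0 < \<psi> b" using J by (simp add: zero_less_iff_neq_zero)
      then obtain s0 where s0: "0 \<le> s0" "s0 < b" "emeasure M {t \<in> space M. s0 < x t} < \<infinity>"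
        using tail[OF b] finite by (metis infinity_ennreal_def top.not_eq_extremum)
      define s where "s n = b - (b - s0) / real (n + 1)" for n
      have s: "s0 \<le> s n" "s n < b" for n
      proof -
        have "(b - s0) / real (n + 1) \<le> (b - s0) / 1"
          using s0 by (intro divide_left_mono) auto
        then show "s0 \<le> s n" by (simp add: s_def)
        show "s n < b" using s0 by (simp add: s_def)
      qed
      have s_mono: "s m \<le> s n" if "m \<le> n" for m n
        unfolding s_def using s0 that by (intro diff_left_mono divide_left_mono) auto
      have s_lim: "s \<longlonglongrightarrow> b"
      proof -
        have "(\<lambda>n. b - (b - s0) / real (n + 1)) \<longlonglongrightarrow> b" by real_asymp
        then show ?thesis by (simp add: s_def[abs_def])
      qed
      have ineq: "emeasure M {t \<in> space M. b \<le> y t} \<le> emeasure M {t \<in> space M. s n < x t}" for n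
      proof -
        have bs: "0 < b - s n" using s by simp
        have "ennreal (b - s n) * emeasure M {t \<in> space M. b \<le> y t}
            = (\<integral>\<^sup>+t. ennreal (b - s n) * indicator {t \<in> space M. b \<le> y t} t \<partial>M)"
          by (simp add: nn_integral_cmult_indicator)
        also have "\<dots> \<le> (\<integral>\<^sup>+t. ennreal (y t - s n) \<partial>M)"
          by (intro nn_integral_mono) (auto simp: indicator_def intro!: ennreal_leI)
        also have "\<dots> \<le> (\<integral>\<^sup>+t. ennreal (x t - s n) \<partial>M)"
          using s[of n] s0 by (intro H) auto
        also have "\<dots> \<le> (\<integral>\<^sup>+t. ennreal (b - s n) * indicator {t \<in> space M. s n < x t} t \<partial>M)"
        proof (rule nn_integral_mono_AE)
          show "AE t in M. ennreal (x t - s n) \<le> ennreal (b - s n) * indicator {t \<in> space M. s n < x t} t"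
            using xb AE_space
            by eventually_elim (auto simp: indicator_def ennreal_neg not_less intro!: ennreal_leI)
        qed
        also have "\<dots> = ennreal (b - s n) * emeasure M {t \<in> space M. s n < x t}"
          by (simp add: nn_integral_cmult_indicator)
        finally show ?thesis using bs by (simp add: ennreal_mult_le_mult_iff)
      qed
      have "(\<lambda>n. emeasure M {t \<in> space M. s n < x t}) \<longlonglongrightarrow> emeasure M (\<Inter>n. {t \<in> space M. s n < x t})"
      proof (rule Lim_emeasure_decseq)
        show "decseq (\<lambda>n. {t \<in> space M. s n < x t})"
          using s_mono by (auto simp: decseq_def intro: le_less_trans)
        fix n
        have "emeasure M {t \<in> space M. s n < x t} \<le> emeasure M {t \<in> space M. s0 < x t}"
          using s(1)[of n] by (intro emeasure_mono) auto
        then show "emeasure M {t \<in> space M. s n < x t} \<noteq> \<infinity>" using s0 by (auto simp: top_unique)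
      qed auto
      moreover have "(\<Inter>n. {t \<in> space M. s n < x t}) = {t \<in> space M. b \<le> x t}"
      proof safe
        fix t assume "t \<in> (\<Inter>n. {t \<in> space M. s n < x t})"
        then have "\<And>n. s n \<le> x t" by (auto intro: less_imp_le)
        then show "b \<le> x t" by (intro LIMSEQ_le_const2[OF s_lim]) auto
      qed (use s(2) in \<open>auto intro: less_le_trans\<close>)
      ultimately have "emeasure M {t \<in> space M. b \<le> y t} \<le> emeasure M {t \<in> space M. b \<le> x t}"
        using ineq by (intro LIMSEQ_le_const[of "\<lambda>n. emeasure M {t \<in> space M. s n < x t}"]) auto
      then show ?thesis by (rule mult_left_mono) simp
    qed simp
    then show ?thesis
      using left xb yb by (simp add: split[OF y] split[OF x] y0 x0 add_mono)
  qed
qed simp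

section \<open>The modular inequality for subadditive operators\<close>

text \<open>
  The value of \<open>x\<close> is moved radially into the ball of radius \<open>r\<close>. Where \<open>x t = 0\<close> the quotient is \<open>0\<close>
  by convention and so is the result.
\<close>

definition radial_cut :: "real \<Rightarrow> ('a \<Rightarrow> 'b::real_normed_vector) \<Rightarrow> 'a \<Rightarrow> 'b" where
  "radial_cut r x t = min 1 (r / norm (x t)) *\<^sub>R x t"

lemma norm_radial_cut: "0 \<le> r \<Longrightarrow> norm (radial_cut r x t) = min (norm (x t)) r"
  by (cases "x t = 0") (auto simp: radial_cut_def min_def field_simps)

lemma norm_minus_radial_cut: "0 \<le> r \<Longrightarrow> norm (x t - radial_cut r x t) = max 0 (norm (x t) - r)"
proof -
  assume r: "0 \<le> r"
  have "x t - radial_cut r x t = (1 - min 1 (r / norm (x t))) *\<^sub>R x t" by (simp add: radial_cut_def scaleR_diff_left)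
  then have "norm (x t - radial_cut r x t) = (1 - min 1 (r / norm (x t))) * norm (x t)" by simp
  also have "\<dots> = max 0 (norm (x t) - r)"
    using r by (cases "x t = 0") (auto simp: min_def max_def field_simps)
  finally show ?thesis .
qed

lemma measurable_radial_cut [measurable]:
  fixes x :: "'a \<Rightarrow> 'b::{real_normed_vector, second_countable_topology}"
  shows "x \<in> borel_measurable M \<Longrightarrow> radial_cut r x \<in> borel_measurable M"
proof -
  assume [measurable]: "x \<in> borel_measurable M"
  show ?thesis unfolding radial_cut_def[abs_def] by (rule borel_measurable_scaleR) measurable
qed

lemma powr_superadditive:
  fixes a b p :: real
  assumes "0 \<le> a" "0 \<le> b" "1 \<le> p"
  shows "a powr p + b powr p \<le> (a + b) powr p"
proof (cases "a + b = 0")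
  case False
  then have c: "0 < a + b" using assms by simp
  have le: "u powr p \<le> u * (a + b) powr (p - 1)" if "0 \<le> u" "u \<le> a + b" for u
  proof (cases "u = 0")
    case False
    have "u powr p = u powr 1 * u powr (p - 1)" by (simp only: powr_add[symmetric]) simp
    also have "\<dots> \<le> u powr 1 * (a + b) powr (p - 1)"
      using that assms by (intro mult_left_mono powr_mono2) auto
    finally show ?thesis using that by simp
  qed simp
  have "a powr p + b powr p \<le> a * (a + b) powr (p - 1) + b * (a + b) powr (p - 1)"
    using assms by (intro add_mono le) auto
  also have "\<dots> = (a + b) powr 1 * (a + b) powr (p - 1)" using c by (simp add: algebra_simps)
  also have "\<dots> = (a + b) powr p" by (simp only: powr_add[symmetric]) simp
  finally show ?thesis .
next
  case True
  then have "a = 0" "b = 0" using assms by auto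
  then show ?thesis by simp
qed

lemma powr_sum_le:
  fixes a b p :: real
  assumes "0 \<le> a" "0 \<le> b" "1 \<le> p"
  shows "(a + b) powr p \<le> 2 powr (p - 1) * (a powr p + b powr p)"
proof -
  have one: "1 \<le> 2 powr (p - 1)" using assms ge_one_powr_ge_zero by force
  show ?thesis
  proof (cases "a = 0 \<or> b = 0")
    case True
    then show ?thesis using assms one mult_right_mono[OF one, of "a powr p + b powr p"] by auto
  next
    case False
    then have "((1 - 1/2) *\<^sub>R a + (1/2) *\<^sub>R b) powr p \<le> (1 - 1/2) * a powr p + (1/2) * b powr p"
      using assms by (intro convex_onD[OF powr_convex[OF assms(3)]]) auto
    then have "((a + b) / 2) powr p \<le> (a powr p + b powr p) / 2" by (simp add: add_divide_distrib)
    then have "(a + b) powr p \<le> 2 powr p * ((a powr p + b powr p) / 2)"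
      using assms by (simp add: powr_divide field_simps)
    also have "2 powr p = 2 * 2 powr (p - 1)"
      using powr_add[of 2 1 "p - 1"] by simp
    finally show ?thesis by simp
  qed
qed

lemma nrm_le_of_opnorm_le:
  assumes f: "f \<in> elems X" "\<not> (AE t in M. f t = 0)" "0 < nrm X f" and K: "0 \<le> K" "opnorm M X T \<le> ennreal K"
  shows "nrm X (T f) \<le> K * nrm X f"
proof (cases "0 \<le> nrm X (T f)")
  case True
  have "ennreal (nrm X (T f)) / ennreal (nrm X f) \<le> opnorm M X T"
    unfolding opnorm_def using f by (intro SUP_upper) auto
  also note K(2)
  finally have "ennreal (nrm X (T f) / nrm X f) \<le> ennreal K"
    using f True by (simp add: divide_ennreal)
  then have "nrm X (T f) / nrm X f \<le> K" using K by simp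
  then show ?thesis using f by (simp add: field_simps)
next
  case False
  then show ?thesis using f K by (smt (verit) mult_nonneg_nonneg)
qed

lemma lp_spaceD:
  assumes "f \<in> elems (lp_space M p)"
  shows "f \<in> borel_measurable M" "integrable M (\<lambda>t. norm (f t) powr p)"
    "(\<integral>\<^sup>+t. ennreal (norm (f t) powr p) \<partial>M) = ennreal (LINT t|M. norm (f t) powr p)"
  using assms by (auto simp: lp_space_def intro!: nn_integral_eq_integral)

lemma lp_spaceI:
  assumes f[measurable]: "f \<in> borel_measurable M" and fin: "(\<integral>\<^sup>+t. ennreal (norm (f t) powr p) \<partial>M) < \<infinity>"
  shows "f \<in> elems (lp_space M p)"
  using fin by (auto simp: lp_space_def integrable_iff_bounded)

lemma zero_in_lp_space: "(\<lambda>t. 0) \<in> elems (lp_space M p)" by (simp add: lp_space_def)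

lemma linf_spaceI:
  assumes f[measurable]: "f \<in> borel_measurable M" and s: "0 \<le> s" "AE t in M. norm (f t) \<le> s"
  shows "f \<in> elems (linf_space M)" "nrm (linf_space M) f \<le> s"
proof -
  have "esssup M (\<lambda>t. ennreal (norm (f t))) \<le> ennreal s"
    using s by (intro esssup_I) (auto elim!: eventually_mono intro!: ennreal_leI)
  then show "f \<in> elems (linf_space M)" "nrm (linf_space M) f \<le> s"
    using s by (auto simp: linf_space_def intro: le_less_trans dest: enn2real_leI)
qed

lemma linf_spaceD:
  assumes "f \<in> elems (linf_space M)"
  shows "f \<in> borel_measurable M" "AE t in M. norm (f t) \<le> nrm (linf_space M) f" "0 \<le> nrm (linf_space M) f"
proof -
  have fin: "esssup M (\<lambda>t. ennreal (norm (f t))) < \<infinity>" using assms by (simp add: linf_space_def)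
  show "f \<in> borel_measurable M" "0 \<le> nrm (linf_space M) f" using assms by (simp_all add: linf_space_def)
  show "AE t in M. norm (f t) \<le> nrm (linf_space M) f"
    using esssup_AE[of "\<lambda>t. ennreal (norm (f t))" M]
  proof eventually_elim
    case (elim t)
    have "ennreal (norm (f t)) \<le> ennreal (nrm (linf_space M) f)"
      using elim fin by (simp add: linf_space_def)
    then show ?case by (simp add: ennreal_le_iff linf_space_def)
  qed
qed

lemma zero_in_linf_space: "(\<lambda>t. 0) \<in> elems (linf_space M)"
  by (rule linf_spaceI[of _ _ 0]) auto

lemma lp_subset_sum: "f \<in> elems (lp_space M p) \<Longrightarrow> f \<in> elems (sum_space M (lp_space M p) (linf_space M))"
  using zero_in_linf_space lp_spaceD(1) unfolding sum_space_def by force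

lemma linf_subset_sum: "f \<in> elems (linf_space M) \<Longrightarrow> f \<in> elems (sum_space M (lp_space M p) (linf_space M))"
  using zero_in_lp_space linf_spaceD(1) unfolding sum_space_def by force

text \<open>
  From here on \<open>K\<close> is any positive bound for both operator norms, not necessarily their maximum,
  so that operators of norm \<open>0\<close> are covered as well.
\<close>

context
  fixes M :: "'a measure" and p K :: real
    and T :: "('a \<Rightarrow> 'b::{real_normed_field, second_countable_topology}) \<Rightarrow> ('a \<Rightarrow> 'b)"
  assumes p: "1 \<le> p" and K: "0 < K"
    and T: "T \<in> subadditive_class M (lp_space M p) (linf_space M)"
    and T_le: "opnorm M (lp_space M p) T \<le> ennreal K" "opnorm M (linf_space M) T \<le> ennreal K"
begin

lemma op_ae_cong: "f \<in> elems (sum_space M (lp_space M p) (linf_space M)) \<Longrightarrow> g \<in> elems (sum_space M (lp_space M p) (linf_space M)) \<Longrightarrow> AE t in M. f t = g t \<Longrightarrow> AE t in M. T f t = T g t"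
  using T unfolding subadditive_class_def subadditive_op_def by blast

lemma op_subadd: "f \<in> elems (sum_space M (lp_space M p) (linf_space M)) \<Longrightarrow> g \<in> elems (sum_space M (lp_space M p) (linf_space M)) \<Longrightarrow>
    AE t in M. norm (T (\<lambda>s. f s + g s) t) \<le> norm (T f t) + norm (T g t)"
  using T unfolding subadditive_class_def subadditive_op_def by blast

lemma op_lp: "f \<in> elems (lp_space M p) \<Longrightarrow> T f \<in> elems (lp_space M p)"
  and op_linf: "f \<in> elems (linf_space M) \<Longrightarrow> T f \<in> elems (linf_space M)"
  using T unfolding subadditive_class_def by blast+

lemma op_sup_bound_nonzero:
  assumes f: "f \<in> borel_measurable M" and s: "0 \<le> s" "AE t in M. norm (f t) \<le> s"
    and nz: "\<not> (AE t in M. f t = 0)"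
  shows "AE t in M. norm (T f t) \<le> K * s"
proof -
  have f': "f \<in> elems (linf_space M)" and n: "nrm (linf_space M) f \<le> s" by (rule linf_spaceI[OF f s])+
  have "nrm (linf_space M) f \<noteq> 0"
    using linf_spaceD(2)[OF f'] nz by (metis (mono_tags, lifting) eventually_mono norm_le_zero_iff)
  then have "0 < nrm (linf_space M) f" using linf_spaceD(3)[OF f'] by simp
  then have "nrm (linf_space M) (T f) \<le> K * nrm (linf_space M) f"
    using K by (intro nrm_le_of_opnorm_le[OF f' nz] T_le) auto
  also have "\<dots> \<le> K * s" using n K by simp
  finally show ?thesis
    using linf_spaceD(2)[OF op_linf[OF f']] by (auto elim!: eventually_mono)
qed

text \<open>
  Subadditivity does not give this, since \<open>T\<close> need not be homogeneous, and the operator norms only see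
  nonzero functions. But \<open>0 = c + (-c)\<close> for constant functions \<open>c\<close>, and boundedness on \<open>L\<^sup>\<infinity>\<close>
  makes \<open>T c\<close> and \<open>T (-c)\<close> as small as desired.
\<close>

lemma op_zero_ae: "AE t in M. T (\<lambda>_. 0) t = 0"
proof (cases "AE t in M. False")
  case True
  then show ?thesis by (auto elim!: eventually_mono)
next
  case False
  have each: "AE t in M. norm (T (\<lambda>_. 0) t) \<le> 2 * K / real (n + 1)" for n
  proof -
    define c where "c = (of_real (1 / real (n + 1)) :: 'b)"
    have nc: "norm c = 1 / real (n + 1)" unfolding c_def norm_of_real by simp
    then have c: "c \<noteq> 0" "norm c = 1 / real (n + 1)" by auto
    have b: "AE t in M. norm (T (\<lambda>_. d) t) \<le> K * (1 / real (n + 1))" if "d = c \<or> d = - c" for d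
      by (rule op_sup_bound_nonzero) (use c that False in auto)
    have e: "(\<lambda>_. d) \<in> elems (sum_space M (lp_space M p) (linf_space M))" if "d = c \<or> d = - c" for d
      by (rule linf_subset_sum, rule linf_spaceI[of _ _ "1 / real (n + 1)"]) (use c that in auto)
    have "AE t in M. norm (T (\<lambda>_. c + - c) t) \<le> norm (T (\<lambda>_. c) t) + norm (T (\<lambda>_. - c) t)"
      by (rule op_subadd[OF e e]) auto
    moreover have "AE t in M. norm (T (\<lambda>_. c) t) \<le> K * (1 / real (n + 1))" "AE t in M. norm (T (\<lambda>_. - c) t) \<le> K * (1 / real (n + 1))"
      by (rule b, simp)+
    ultimately show ?thesis by eventually_elim simp
  qed
  have "AE t in M. \<forall>n. norm (T (\<lambda>_. 0) t) \<le> 2 * K / real (n + 1)"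
    using each by (simp add: AE_all_countable)
  then show ?thesis
  proof eventually_elim
    case (elim t)
    have "(\<lambda>n. 2 * K / real (n + 1)) \<longlonglongrightarrow> 0" by real_asymp
    then have "norm (T (\<lambda>_. 0) t) \<le> 0" by (rule LIMSEQ_le_const) (use elim in auto)
    then show ?case by simp
  qed
qed

lemma op_sup_bound:
  assumes f: "f \<in> borel_measurable M" and s: "0 \<le> s" "AE t in M. norm (f t) \<le> s"
  shows "AE t in M. norm (T f t) \<le> K * s"
proof (cases "AE t in M. f t = 0")
  case True
  have "AE t in M. T f t = T (\<lambda>_. 0) t"
    using True by (intro op_ae_cong linf_subset_sum linf_spaceI[OF f s] zero_in_linf_space)
  with op_zero_ae show ?thesis by eventually_elim (use K s in simp)
qed (rule op_sup_bound_nonzero[OF f s])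

lemma op_lp_bound:
  assumes f: "f \<in> elems (lp_space M p)"
  shows "(\<integral>\<^sup>+t. ennreal (norm (T f t) powr p) \<partial>M) \<le> ennreal (K powr p) * (\<integral>\<^sup>+t. ennreal (norm (f t) powr p) \<partial>M)"
proof (cases "AE t in M. f t = 0")
  case True
  have "AE t in M. T f t = T (\<lambda>_. 0) t"
    using True by (intro op_ae_cong lp_subset_sum f zero_in_lp_space)
  with op_zero_ae have "AE t in M. ennreal (norm (T f t) powr p) = 0" by eventually_elim simp
  then have "(\<integral>\<^sup>+t. ennreal (norm (T f t) powr p) \<partial>M) = (\<integral>\<^sup>+t. 0 \<partial>M)" by (rule nn_integral_cong_AE)
  then show ?thesis by simp
next
  case nz: False
  define I where "I g = (LINT t|M. norm (g t) powr p)" for g :: "'a \<Rightarrow> 'b"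
  have I0: "0 \<le> I g" for g by (simp add: I_def)
  have nrm: "nrm (lp_space M p) g = I g powr (1 / p)" for g :: "'a \<Rightarrow> 'b"
    by (simp add: lp_space_def I_def)
  have "I f \<noteq> 0"
  proof
    assume "I f = 0"
    then have "AE t in M. norm (f t) powr p = 0"
      using integral_nonneg_eq_0_iff_AE[OF lp_spaceD(2)[OF f]] by (simp add: I_def)
    then show False using nz by (auto elim!: eventually_mono)
  qed
  then have If: "0 < I f" using I0[of f] by simp
  have "I (T f) powr (1 / p) \<le> K * I f powr (1 / p)"
    using nrm_le_of_opnorm_le[OF f nz _ _ T_le(1)] K If by (simp add: nrm)
  then have "(I (T f) powr (1 / p)) powr p \<le> (K * I f powr (1 / p)) powr p"
    using p by (intro powr_mono2) auto
  then have "I (T f) \<le> K powr p * I f"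
    using p K If I0 by (simp add: powr_powr powr_mult)
  then show ?thesis
    using lp_spaceD(3)[OF f] lp_spaceD(3)[OF op_lp[OF f]] If
    by (simp add: I_def[symmetric] ennreal_mult'[symmetric] ennreal_leI)
qed

text \<open>
  The heart of the matter. Put \<open>s = r\<^sup>p\<close> and split \<open>x = g + h\<close> with \<open>h\<close> the truncation of \<open>x\<close> at height \<open>r\<close>.
  Then \<open>|T x| \<le> |T g| + K r\<close>, and \<open>(a + b)\<^sup>p \<le> 2\<^sup>p\<^sup>-\<^sup>1 (a\<^sup>p + b\<^sup>p)\<close> shows that the left integrand is at most
  \<open>|T g|\<^sup>p / K\<^sup>p\<close>; this is where the constant \<open>2 powr (1 - 1 / p)\<close> comes from. The bound on \<open>L\<^sup>p\<close> leaves
  \<open>|g|\<^sup>p = (|x| - r)\<^sub>+\<^sup>p\<close>, which is at most \<open>(|x|\<^sup>p - s)\<^sub>+\<close> by superadditivity of the power.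
\<close>

lemma op_excess_le:
  assumes x[measurable]: "x \<in> borel_measurable M" and s: "0 \<le> s"
  shows "(\<integral>\<^sup>+t. ennreal ((norm (T x t) / (2 powr (1 - 1 / p) * K)) powr p - s) \<partial>M)
    \<le> (\<integral>\<^sup>+t. ennreal (norm (x t) powr p - s) \<partial>M)" (is "?L \<le> ?R")
proof (cases "?R < \<infinity>")
  case fin: True
  define r where "r = s powr (1 / p)"
  define C where "C = 2 powr (1 - 1 / p)"
  have r: "0 \<le> r" "r powr p = s" using s p by (auto simp: r_def powr_powr)
  have C: "0 < C" "C powr p = 2 powr (p - 1)" using p by (auto simp: C_def powr_powr algebra_simps)
  define h where "h = radial_cut r x"
  define g where "g = (\<lambda>t. x t - h t)"
  have [measurable]: "h \<in> borel_measurable M" "g \<in> borel_measurable M" by (simp_all add: h_def g_def)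
  have "(\<integral>\<^sup>+t. ennreal (norm (g t) powr p) \<partial>M) \<le> ?R"
  proof (intro nn_integral_mono)
    fix t
    show "ennreal (norm (g t) powr p) \<le> ennreal (norm (x t) powr p - s)"
    proof (cases "r \<le> norm (x t)")
      case True
      have "(norm (x t) - r) powr p + r powr p \<le> (norm (x t) - r + r) powr p"
        using True r p by (intro powr_superadditive) auto
      then show ?thesis
        using True r by (intro ennreal_leI) (simp add: g_def h_def norm_minus_radial_cut)
    qed (use r in \<open>simp add: g_def h_def norm_minus_radial_cut\<close>)
  qed
  note g_le = this
  have gp: "g \<in> elems (lp_space M p)" by (rule lp_spaceI) (use g_le fin in \<open>auto intro: le_less_trans\<close>)
  have hb: "AE t in M. norm (h t) \<le> r" using r by (simp add: h_def norm_radial_cut)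
  have hi: "h \<in> elems (linf_space M)" by (rule linf_spaceI[OF _ r(1) hb]) simp
  have "x = (\<lambda>t. g t + h t)" by (simp add: g_def)
  then have "AE t in M. norm (T x t) \<le> norm (T g t) + norm (T h t)"
    using op_subadd[OF lp_subset_sum[OF gp] linf_subset_sum[OF hi]] by simp
  moreover have "AE t in M. norm (T h t) \<le> K * r" by (rule op_sup_bound[OF _ r(1) hb]) simp
  ultimately have "AE t in M. ennreal ((norm (T x t) / (C * K)) powr p - s)
      \<le> ennreal (1 / K powr p) * ennreal (norm (T g t) powr p)"
  proof eventually_elim
    case (elim t)
    then have "norm (T x t) / (C * K) \<le> (norm (T g t) / K + r) / C"
      using C K by (simp add: field_simps)
    then have "(norm (T x t) / (C * K)) powr p \<le> ((norm (T g t) / K + r) / C) powr p"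
      using C K p by (intro powr_mono2) auto
    also have "\<dots> = (norm (T g t) / K + r) powr p / 2 powr (p - 1)"
      using C K r by (simp add: powr_divide)
    also have "\<dots> \<le> (norm (T g t) / K) powr p + r powr p"
      using powr_sum_le[of "norm (T g t) / K" r p] K r p by (simp add: field_simps)
    finally have "(norm (T x t) / (C * K)) powr p - s \<le> norm (T g t) powr p / K powr p"
      using K r by (simp add: powr_divide)
    then show ?case by (simp add: ennreal_mult'[symmetric] ennreal_leI)
  qed
  then have "?L \<le> (\<integral>\<^sup>+t. ennreal (1 / K powr p) * ennreal (norm (T g t) powr p) \<partial>M)"
    unfolding C_def by (rule nn_integral_mono_AE)
  also have "\<dots> = ennreal (1 / K powr p) * (\<integral>\<^sup>+t. ennreal (norm (T g t) powr p) \<partial>M)"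
    using lp_spaceD(1)[OF op_lp[OF gp]] by (intro nn_integral_cmult) simp
  also have "\<dots> \<le> ennreal (1 / K powr p) * (ennreal (K powr p) * (\<integral>\<^sup>+t. ennreal (norm (g t) powr p) \<partial>M))"
    by (intro mult_left_mono op_lp_bound gp) simp
  also have "\<dots> = (\<integral>\<^sup>+t. ennreal (norm (g t) powr p) \<partial>M)"
    using K by (simp add: mult.assoc[symmetric] ennreal_mult[symmetric])
  also note g_le
  finally show ?thesis .
qed (simp add: less_top[symmetric])

theorem op_convex_modular_le:
  assumes x[measurable]: "x \<in> borel_measurable M" and Tx[measurable]: "T x \<in> borel_measurable M"
    and mono: "mono_on {0..} \<psi>" and conv: "convex_fun \<psi>" and zero: "\<psi> 0 = 0"
    and w0: "0 < w0" "\<psi> w0 < \<infinity>"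
    and tail: "\<And>b. 0 < b \<Longrightarrow> 0 < \<psi> b \<Longrightarrow>
        (\<And>s. 0 \<le> s \<Longrightarrow> s < b \<Longrightarrow> emeasure M {t \<in> space M. s < norm (x t) powr p} = \<infinity>) \<Longrightarrow>
        (\<integral>\<^sup>+t. \<psi> (norm (x t) powr p) \<partial>M) = \<infinity>"
  shows "(\<integral>\<^sup>+t. \<psi> ((norm (T x t) / (2 powr (1 - 1 / p) * K)) powr p) \<partial>M) \<le> (\<integral>\<^sup>+t. \<psi> (norm (x t) powr p) \<partial>M)"
  by (rule nn_integral_convex_mono[OF mono conv zero w0 _ _ _ _ _ tail])
    (auto intro: op_excess_le[OF x, simplified])

end

lemma rearrangement_ge:
  assumes "\<And>v. 0 \<le> v \<Longrightarrow> v < b \<Longrightarrow> emeasure M {t \<in> space M. v < norm (x t)} = \<infinity>"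
  shows "ennreal b \<le> rearrangement M x s"
  unfolding rearrangement_def
proof (rule Inf_greatest, clarsimp)
  fix r assume r: "emeasure M {t \<in> space M. r < ennreal (norm (x t))} \<le> ennreal s"
  show "ennreal b \<le> r"
  proof (rule ccontr)
    assume "\<not> ennreal b \<le> r"
    then obtain v where v: "r = ennreal v" "0 \<le> v" "v < b"
      by (cases r) (auto simp: not_le ennreal_less_iff)
    then have "emeasure M {t \<in> space M. r < ennreal (norm (x t))} = \<infinity>"
      using assms[of v] by (simp add: ennreal_less_iff)
    then show False using r by (simp add: top_unique)
  qed
qed

text \<open>
  If all sets \<open>{|x| > v}\<close> with \<open>v < b\<close> have infinite measure, then the rearrangement of \<open>x\<close> is at least \<open>b\<close>
  everywhere on \<open>(0, \<infinity>)\<close>, so \<open>\<phi> b > 0\<close> makes the rearranged modular infinite. Without rearrangement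
  invariance, \<open>\<phi>\<close> could vanish below \<open>b\<close> and jump at \<open>b\<close>, while \<open>x\<close> stays below \<open>b\<close> and has modular \<open>0\<close>.
\<close>

lemma modular_infinite_of_tails_infinite:
  fixes x :: "'a \<Rightarrow> 'b::{real_normed_vector, second_countable_topology}"
  assumes ri: "rearrangement_invariant M TYPE('b) \<phi>" and mono: "mono_on {0..} \<phi>"
    and x: "x \<in> borel_measurable M" and b: "0 \<le> b" "0 < \<phi> b"
    and tails: "\<And>v. 0 \<le> v \<Longrightarrow> v < b \<Longrightarrow> emeasure M {t \<in> space M. v < norm (x t)} = \<infinity>"
  shows "modular M \<phi> x = \<infinity>"
proof -
  have "\<infinity> = (\<integral>\<^sup>+ s. \<phi> b * indicator {0::real<..} s \<partial>lborel)"
  proof -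
    have "emeasure lborel {0::real<..} = \<infinity>"
    proof (cases "emeasure lborel {0::real<..}")
      case (real r)
      have "emeasure lborel {0<..r + 1} \<le> emeasure lborel {0::real<..}" by (intro emeasure_mono) auto
      then show ?thesis using real by (simp add: ennreal_le_iff)
    qed simp
    then show ?thesis using b by (subst nn_integral_cmult_indicator) (auto simp: ennreal_mult_top)
  qed
  also have "\<dots> \<le> (\<integral>\<^sup>+ s \<in> {0<..}. (if rearrangement M x s = \<infinity> then \<infinity>
                            else \<phi> (enn2real (rearrangement M x s))) \<partial>lborel)"
  proof (intro nn_integral_mono mult_right_mono)
    fix s :: real
    show "\<phi> b \<le> (if rearrangement M x s = \<infinity> then \<infinity> else \<phi> (enn2real (rearrangement M x s)))"
    proof (cases "rearrangement M x s")
      case (real r)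
      then have "b \<le> r" using rearrangement_ge[of b M x s, OF tails] by simp
      then show ?thesis using real b by (auto intro!: mono_onD[OF mono])
    qed simp
  qed simp
  also have "\<dots> = modular M \<phi> x" using ri x unfolding rearrangement_invariant_def by auto
  finally show ?thesis by (simp add: top_unique)
qed

theorem modular_interpolation:
  fixes T :: "('a \<Rightarrow> 'b::{real_normed_field, second_countable_topology}) \<Rightarrow> ('a \<Rightarrow> 'b)"
  assumes p: "1 \<le> p" and orl: "orlicz_function \<phi>" and ri: "rearrangement_invariant M TYPE('b) \<phi>"
    and conv: "convex_fun (\<lambda>u. \<phi> (u powr (1 / p)))"
    and T: "T \<in> subadditive_class M (lp_space M p) (linf_space M)"
    and K: "K = enn2real (max (opnorm M (lp_space M p) T) (opnorm M (linf_space M) T))" "0 < K"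
    and x: "x \<in> elems (sum_space M (lp_space M p) (linf_space M))"
  shows "modular M \<phi> (\<lambda>t. T x t /\<^sub>R (2 powr (1 - 1 / p) * K)) \<le> modular M \<phi> x"
proof -
  have fin: "max (opnorm M (lp_space M p) T) (opnorm M (linf_space M) T) < \<infinity>"
    using T by (auto simp: subadditive_class_def)
  then have "ennreal K = max (opnorm M (lp_space M p) T) (opnorm M (linf_space M) T)"
    using K by simp
  then have T_le: "opnorm M (lp_space M p) T \<le> ennreal K" "opnorm M (linf_space M) T \<le> ennreal K"
    by (metis max.cobounded1, metis max.cobounded2)
  have xm: "x \<in> borel_measurable M" using x by (simp add: sum_space_def)
  have "T x \<in> elems (sum_space M (lp_space M p) (linf_space M))"
    using T x unfolding subadditive_class_def subadditive_op_def by blast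
  then have Txm: "T x \<in> borel_measurable M" by (simp add: sum_space_def)
  have mono: "mono_on {0..} \<phi>" and zero: "\<phi> 0 = 0" and lim: "(\<phi> \<longlongrightarrow> 0) (at_right 0)"
    using orl by (auto simp: orlicz_function_def)
  define \<psi> where "\<psi> u = \<phi> (u powr (1 / p))" for u
  have psi: "\<psi> (a powr p) = \<phi> a" if "0 \<le> a" for a using that p by (simp add: \<psi>_def powr_powr)
  have "\<forall>\<^sub>F u in at_right 0. \<phi> u < 1" using lim by (rule order_tendstoD) simp
  then obtain e where e: "0 < e" "\<And>u. 0 < u \<Longrightarrow> u < e \<Longrightarrow> \<phi> u < 1"
    by (auto simp: eventually_at_right[OF zero_less_one])
  have "\<phi> (e / 2) < 1" using e by simp
  then have w0: "0 < (e / 2) powr p" "\<psi> ((e / 2) powr p) < \<infinity>"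
    using e \<open>\<phi> (e / 2) < 1\<close> less_trans[of "\<phi> (e / 2)" 1 top] by (auto simp: psi)
  have "(\<integral>\<^sup>+t. \<psi> ((norm (T x t) / (2 powr (1 - 1 / p) * K)) powr p) \<partial>M) \<le> (\<integral>\<^sup>+t. \<psi> (norm (x t) powr p) \<partial>M)"
  proof (rule op_convex_modular_le[where \<psi> = \<psi>, OF p K(2) T T_le xm Txm _ _ _ w0])
    show "mono_on {0..} \<psi>"
      using p by (auto intro!: mono_onI mono_onD[OF mono] powr_mono2 simp: \<psi>_def)
    show "convex_fun \<psi>" using conv by (simp add: \<psi>_def[abs_def])
    show "\<psi> 0 = 0" by (simp add: \<psi>_def zero)
    fix b :: real assume b: "0 < b" "0 < \<psi> b"
      and tails: "\<And>s. 0 \<le> s \<Longrightarrow> s < b \<Longrightarrow> emeasure M {t \<in> space M. s < norm (x t) powr p} = \<infinity>"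
    have "modular M \<phi> x = \<infinity>"
    proof (rule modular_infinite_of_tails_infinite[OF ri mono xm])
      show "0 \<le> b powr (1 / p)" "0 < \<phi> (b powr (1 / p))" using b by (auto simp: \<psi>_def)
      fix v assume v: "0 \<le> v" "v < b powr (1 / p)"
      have "v powr p < (b powr (1 / p)) powr p" using v p by (intro powr_less_mono2) auto
      then have "v powr p < b" using b p by (simp add: powr_powr)
      then have "emeasure M {t \<in> space M. v powr p < norm (x t) powr p} = \<infinity>"
        by (intro tails) auto
      moreover have "v powr p < norm (x t) powr p \<longleftrightarrow> v < norm (x t)" for t
        using v p by (smt (verit, best) norm_ge_zero powr_less_mono2 powr_mono2)
      ultimately show "emeasure M {t \<in> space M. v < norm (x t)} = \<infinity>" by simp
    qed
    then show "(\<integral>\<^sup>+t. \<psi> (norm (x t) powr p) \<partial>M) = \<infinity>" by (simp add: modular_def psi)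
  qed
  then show ?thesis
    using K(2) by (simp add: modular_def psi divide_inverse_commute)
qed

section \<open>Orlicz spaces as Banach spaces\<close>

lemma le_mult_of_all_greater:
  fixes z c a :: real
  assumes "\<And>l. a < l \<Longrightarrow> z \<le> c * l"
  shows "z \<le> c * a"
proof (rule tendsto_lowerbound[where F = "at_right a" and f = "\<lambda>l. c * l"])
  show "((*) c \<longlongrightarrow> c * a) (at_right a)" by (intro tendsto_intros)
  show "\<forall>\<^sub>F l in at_right a. z \<le> c * l"
    using assms by (auto simp: eventually_at_right_field intro: exI[of _ "a + 1"])
qed simp

lemma modular_mono:
  assumes mono: "mono_on {0..} \<phi>" and le: "AE t in M. norm (x t) \<le> norm (y t)"
  shows "modular M \<phi> x \<le> modular M \<phi> y"
  unfolding modular_def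
  using le by (intro nn_integral_mono_AE) (auto elim!: eventually_mono intro!: mono_onD[OF mono])

lemma convex_fun_scale:
  assumes "convex_fun \<phi>" "\<phi> 0 = 0" "0 \<le> a" "a \<le> 1" "0 \<le> u"
  shows "\<phi> (a * u) \<le> ennreal a * \<phi> u"
proof -
  have "\<phi> (a * u + (1 - a) * 0) \<le> ennreal a * \<phi> u + ennreal (1 - a) * \<phi> 0"
    using assms unfolding convex_fun_def by (metis atLeastAtMost_iff order_refl)
  then show ?thesis using assms by simp
qed

text \<open>
  What the Luxemburg and the Orlicz norm have in common and all that interpolation needs. The
  first clause says that the norm is controlled by the modular at all scales. It yields
  homogeneity, invariance under equality almost everywhere, and the transfer of modular
  inequalities for an operator to norm inequalities. The last clause reduces definiteness and
  completeness to the Luxemburg norm.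
\<close>

definition modular_norm ::
  "'a measure \<Rightarrow> (real \<Rightarrow> ennreal) \<Rightarrow> (('a \<Rightarrow> 'b::real_normed_vector) \<Rightarrow> real) \<Rightarrow> bool" where
  "modular_norm M \<phi> n \<longleftrightarrow>
    (\<forall>x\<in>orlicz_set M \<phi>. \<forall>y\<in>orlicz_set M \<phi>. \<forall>D>0.
       (\<forall>l>0. modular M \<phi> (\<lambda>t. (l / D) *\<^sub>R y t) \<le> modular M \<phi> (\<lambda>t. l *\<^sub>R x t)) \<longrightarrow> n y \<le> D * n x) \<and>
    (\<forall>x\<in>orlicz_set M \<phi>. \<forall>y\<in>orlicz_set M \<phi>. n (\<lambda>t. x t + y t) \<le> n x + n y) \<and>
    (\<forall>x\<in>orlicz_set M \<phi>. nrm (orlicz_luxemburg M \<phi>) x \<le> n x \<and> n x \<le> 2 * nrm (orlicz_luxemburg M \<phi>) x)"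

text \<open>
  The Orlicz functions that come from \<open>\<rho>\<close> are finite and vanish only at \<open>0\<close>. Such functions are
  continuous, and equality almost everywhere to \<open>0\<close> is detected by the modular.
\<close>

locale finite_orlicz =
  fixes M :: "'a measure" and \<phi> :: "real \<Rightarrow> ennreal"
  assumes mono: "mono_on {0..} \<phi>" and conv: "convex_fun \<phi>" and zero: "\<phi> 0 = 0"
    and pos: "\<And>u. 0 < u \<Longrightarrow> 0 < \<phi> u" and fin: "\<And>u. 0 \<le> u \<Longrightarrow> \<phi> u < \<infinity>"
begin

abbreviation "lux \<equiv> nrm (orlicz_luxemburg M \<phi>)"

lemma scale: "0 \<le> a \<Longrightarrow> a \<le> 1 \<Longrightarrow> 0 \<le> u \<Longrightarrow> \<phi> (a * u) \<le> ennreal a * \<phi> u"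
  using convex_fun_scale[OF conv zero] .

lemma measurable_phi_norm:
  fixes x :: "'a \<Rightarrow> 'b::{real_normed_vector, second_countable_topology}"
  shows "x \<in> borel_measurable M \<Longrightarrow> (\<lambda>t. \<phi> (norm (x t))) \<in> borel_measurable M"
  by (rule measurable_mono_comp[OF mono]) auto

lemma modular_scale:
  fixes x :: "'a \<Rightarrow> 'b::{real_normed_vector, second_countable_topology}"
  assumes x: "x \<in> borel_measurable M" and a: "0 \<le> a" "a \<le> 1"
  shows "modular M \<phi> (\<lambda>t. a *\<^sub>R x t) \<le> ennreal a * modular M \<phi> x"
proof -
  have "modular M \<phi> (\<lambda>t. a *\<^sub>R x t) \<le> (\<integral>\<^sup>+t. ennreal a * \<phi> (norm (x t)) \<partial>M)"
    unfolding modular_def using a by (intro nn_integral_mono) (simp add: scale)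
  then show ?thesis unfolding modular_def by (simp add: nn_integral_cmult measurable_phi_norm[OF x])
qed

lemma modular_convex:
  fixes x y :: "'a \<Rightarrow> 'b::{real_normed_vector, second_countable_topology}"
  assumes x: "x \<in> borel_measurable M" and y: "y \<in> borel_measurable M" and a: "0 \<le> a" "a \<le> 1"
  shows "modular M \<phi> (\<lambda>t. a *\<^sub>R x t + (1 - a) *\<^sub>R y t)
    \<le> ennreal a * modular M \<phi> x + ennreal (1 - a) * modular M \<phi> y"
proof -
  note [measurable] = measurable_phi_norm[OF x] measurable_phi_norm[OF y]
  have "modular M \<phi> (\<lambda>t. a *\<^sub>R x t + (1 - a) *\<^sub>R y t)
      \<le> (\<integral>\<^sup>+t. ennreal a * \<phi> (norm (x t)) + ennreal (1 - a) * \<phi> (norm (y t)) \<partial>M)"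
    unfolding modular_def
  proof (intro nn_integral_mono)
    fix t
    have "norm (a *\<^sub>R x t + (1 - a) *\<^sub>R y t) \<le> a * norm (x t) + (1 - a) * norm (y t)"
      using a norm_triangle_ineq[of "a *\<^sub>R x t" "(1 - a) *\<^sub>R y t"] by simp
    then have "\<phi> (norm (a *\<^sub>R x t + (1 - a) *\<^sub>R y t)) \<le> \<phi> (a * norm (x t) + (1 - a) * norm (y t))"
      using a by (intro mono_onD[OF mono]) auto
    also have "\<dots> \<le> ennreal a * \<phi> (norm (x t)) + ennreal (1 - a) * \<phi> (norm (y t))"
      using conv a unfolding convex_fun_def by simp
    finally show "\<phi> (norm (a *\<^sub>R x t + (1 - a) *\<^sub>R y t)) \<le> \<dots>" .
  qed
  then show ?thesis unfolding modular_def by (simp add: nn_integral_add nn_integral_cmult)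
qed

lemma lower_semicontinuous:
  assumes u: "u \<longlonglongrightarrow> l" and u0: "\<And>n. 0 \<le> u n"
  shows "\<phi> l \<le> liminf (\<lambda>n. \<phi> (u n))"
proof -
  have "0 \<le> l" by (rule LIMSEQ_le_const[OF u]) (use u0 in auto)
  then have "\<phi> l = left_lim \<phi> l"
    using left_lim_eq_of_finite_beyond[OF mono conv zero, of l "l + 1"] fin[of "l + 1"] by simp
  also have "\<dots> \<le> liminf (\<lambda>n. \<phi> (u n))"
    unfolding left_lim_def
  proof (rule SUP_least)
    fix v assume v: "v \<in> {0..<l}"
    then have "\<forall>\<^sub>F n in sequentially. v < u n" by (intro order_tendstoD(1)[OF u]) auto
    then have "\<forall>\<^sub>F n in sequentially. \<phi> v \<le> \<phi> (u n)"
      by eventually_elim (use v in \<open>auto intro!: mono_onD[OF mono]\<close>)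
    then show "\<phi> v \<le> liminf (\<lambda>n. \<phi> (u n))" by (rule Liminf_bounded)
  qed
  finally show ?thesis .
qed

lemma orlicz_setD: "x \<in> orlicz_set M \<phi> \<Longrightarrow> x \<in> borel_measurable M"
  by (simp add: orlicz_set_def)

lemma orlicz_setI:
  "x \<in> borel_measurable M \<Longrightarrow> 0 < l \<Longrightarrow> modular M \<phi> (\<lambda>t. l *\<^sub>R x t) < \<infinity> \<Longrightarrow> x \<in> orlicz_set M \<phi>"
  by (auto simp: orlicz_set_def)

lemma lux_eq: "lux x = Inf {l. l > 0 \<and> modular M \<phi> (\<lambda>t. x t /\<^sub>R l) \<le> 1}"
  by (simp add: orlicz_luxemburg_def)

lemma lux_le: "0 < l \<Longrightarrow> modular M \<phi> (\<lambda>t. x t /\<^sub>R l) \<le> 1 \<Longrightarrow> lux x \<le> l"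
  unfolding lux_eq by (rule cInf_lower) (auto intro!: bdd_belowI[of _ 0])

lemma lux_candidates_nonempty:
  fixes x :: "'a \<Rightarrow> 'b::{real_normed_vector, second_countable_topology}"
  assumes x: "x \<in> orlicz_set M \<phi>"
  shows "{l. l > 0 \<and> modular M \<phi> (\<lambda>t. x t /\<^sub>R l) \<le> 1} \<noteq> {}"
proof -
  obtain l where l: "0 < l" "modular M \<phi> (\<lambda>t. l *\<^sub>R x t) < \<infinity>" using x by (auto simp: orlicz_set_def)
  then obtain r where r: "modular M \<phi> (\<lambda>t. l *\<^sub>R x t) = ennreal r" "0 \<le> r"
    by (cases "modular M \<phi> (\<lambda>t. l *\<^sub>R x t)") auto
  define a where "a = 1 / (1 + r)"
  have a: "0 < a" "a \<le> 1" "a * r \<le> 1" using r by (auto simp: a_def field_simps)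
  have "(\<lambda>t. l *\<^sub>R x t) \<in> borel_measurable M" using orlicz_setD[OF x] by simp
  from modular_scale[OF this, of a] a r have "modular M \<phi> (\<lambda>t. a *\<^sub>R l *\<^sub>R x t) \<le> ennreal (a * r)"
    by (simp add: ennreal_mult)
  also have "\<dots> \<le> 1" using a by simp
  finally have "1 / (a * l) \<in> {l. l > 0 \<and> modular M \<phi> (\<lambda>t. x t /\<^sub>R l) \<le> 1}"
    using a l by simp
  then show ?thesis by blast
qed

lemma lux_nonneg:
  fixes x :: "'a \<Rightarrow> 'b::{real_normed_vector, second_countable_topology}"
  shows "x \<in> orlicz_set M \<phi> \<Longrightarrow> 0 \<le> lux x"
  unfolding lux_eq by (rule cInf_greatest[OF lux_candidates_nonempty]) auto

lemma modular_le_one_of_lux_less: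
  fixes x :: "'a \<Rightarrow> 'b::{real_normed_vector, second_countable_topology}"
  assumes x: "x \<in> orlicz_set M \<phi>" and l: "lux x < l"
  shows "modular M \<phi> (\<lambda>t. x t /\<^sub>R l) \<le> 1"
proof -
  obtain k where k: "0 < k" "modular M \<phi> (\<lambda>t. x t /\<^sub>R k) \<le> 1" "k < l"
    using cInf_lessD[OF lux_candidates_nonempty[OF x] l[unfolded lux_eq]] by auto
  have "modular M \<phi> (\<lambda>t. x t /\<^sub>R l) \<le> modular M \<phi> (\<lambda>t. x t /\<^sub>R k)"
    using k by (intro modular_mono[OF mono]) (auto intro!: mult_right_mono)
  with k show ?thesis by simp
qed

text \<open>
  With \<open>a = m / (k + m)\<close> the function on the left is the convex combination of \<open>k x\<close> and \<open>m y\<close> with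
  weights \<open>a\<close> and \<open>1 - a\<close>. The harmonic scale \<open>k * m / (k + m)\<close> makes both norms subadditive.
\<close>

lemma modular_sum_scaled:
  fixes x y :: "'a \<Rightarrow> 'b::{real_normed_vector, second_countable_topology}"
  assumes x: "x \<in> borel_measurable M" and y: "y \<in> borel_measurable M" and k: "0 < k" "0 < m"
  shows "modular M \<phi> (\<lambda>t. (k * m / (k + m)) *\<^sub>R (x t + y t))
    \<le> ennreal (m / (k + m)) * modular M \<phi> (\<lambda>t. k *\<^sub>R x t) + ennreal (k / (k + m)) * modular M \<phi> (\<lambda>t. m *\<^sub>R y t)"
proof -
  define a where "a = m / (k + m)"
  have a: "0 \<le> a" "a \<le> 1" "1 - a = k / (k + m)" using k by (auto simp: a_def field_simps)
  have eq: "a *\<^sub>R k *\<^sub>R x t + (1 - a) *\<^sub>R m *\<^sub>R y t = (k * m / (k + m)) *\<^sub>R (x t + y t)" for t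
    unfolding a(3) by (simp add: a_def scaleR_add_right mult.commute)
  have "modular M \<phi> (\<lambda>t. a *\<^sub>R k *\<^sub>R x t + (1 - a) *\<^sub>R m *\<^sub>R y t)
      \<le> ennreal a * modular M \<phi> (\<lambda>t. k *\<^sub>R x t) + ennreal (1 - a) * modular M \<phi> (\<lambda>t. m *\<^sub>R y t)"
    by (rule modular_convex) (use x y a in auto)
  from this[unfolded eq, unfolded a(3), unfolded a_def] show ?thesis .
qed

lemma orlicz_set_add:
  fixes x y :: "'a \<Rightarrow> 'b::{real_normed_vector, second_countable_topology}"
  assumes x: "x \<in> orlicz_set M \<phi>" and y: "y \<in> orlicz_set M \<phi>"
  shows "(\<lambda>t. x t + y t) \<in> orlicz_set M \<phi>"
proof -
  obtain k m where k: "0 < k" "modular M \<phi> (\<lambda>t. k *\<^sub>R x t) < \<infinity>" and m: "0 < m" "modular M \<phi> (\<lambda>t. m *\<^sub>R y t) < \<infinity>"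
    using x y by (auto simp: orlicz_set_def)
  have [measurable]: "x \<in> borel_measurable M" "y \<in> borel_measurable M" using x y by (auto dest: orlicz_setD)
  show ?thesis
  proof (rule orlicz_setI)
    show "0 < k * m / (k + m)" using k m by simp
    show "modular M \<phi> (\<lambda>t. (k * m / (k + m)) *\<^sub>R (x t + y t)) < \<infinity>"
      by (rule le_less_trans[OF modular_sum_scaled])
        (use k m in \<open>auto simp: ennreal_mult_less_top\<close>)
  qed simp
qed

lemma orlicz_set_scale:
  fixes x :: "'a \<Rightarrow> 'b::{real_normed_field, second_countable_topology}"
  assumes x: "x \<in> orlicz_set M \<phi>"
  shows "(\<lambda>t. c * x t) \<in> orlicz_set M \<phi>"
proof -
  obtain k where k: "0 < k" "modular M \<phi> (\<lambda>t. k *\<^sub>R x t) < \<infinity>" using x by (auto simp: orlicz_set_def)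
  have [measurable]: "x \<in> borel_measurable M" using x by (rule orlicz_setD)
  show ?thesis
  proof (rule orlicz_setI)
    show "0 < k / (norm c + 1)" using k by (simp add: add_nonneg_pos)
    have "modular M \<phi> (\<lambda>t. (k / (norm c + 1)) *\<^sub>R (c * x t)) \<le> modular M \<phi> (\<lambda>t. k *\<^sub>R x t)"
    proof (intro modular_mono[OF mono] AE_I2)
      fix t
      have "norm c / (norm c + 1) \<le> 1" by (simp add: add_nonneg_pos)
      then have "(norm c / (norm c + 1)) * (k * norm (x t)) \<le> 1 * (k * norm (x t))"
        using k by (intro mult_right_mono) auto
      then show "norm ((k / (norm c + 1)) *\<^sub>R (c * x t)) \<le> norm (k *\<^sub>R x t)"
        using k by (simp add: norm_mult mult.commute mult.left_commute)
    qed
    then show "modular M \<phi> (\<lambda>t. (k / (norm c + 1)) *\<^sub>R (c * x t)) < \<infinity>" by (rule le_less_trans[OF _ k(2)])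
  qed simp
qed

lemma orlicz_set_minus:
  fixes x y :: "'a \<Rightarrow> 'b::{real_normed_field, second_countable_topology}"
  assumes x: "x \<in> orlicz_set M \<phi>" and y: "y \<in> orlicz_set M \<phi>"
  shows "(\<lambda>t. x t - y t) \<in> orlicz_set M \<phi>"
  using orlicz_set_add[OF x orlicz_set_scale[OF y, of "-1"]] by simp

lemma orlicz_set_cong:
  assumes x: "x \<in> orlicz_set M \<phi>" and y: "y \<in> borel_measurable M" and eq: "AE t in M. x t = y t"
  shows "y \<in> orlicz_set M \<phi>"
proof -
  obtain k where k: "0 < k" "modular M \<phi> (\<lambda>t. k *\<^sub>R x t) < \<infinity>" using x by (auto simp: orlicz_set_def)
  have "modular M \<phi> (\<lambda>t. k *\<^sub>R y t) \<le> modular M \<phi> (\<lambda>t. k *\<^sub>R x t)"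
    using eq by (intro modular_mono[OF mono]) (auto elim!: eventually_mono)
  then show ?thesis using k by (intro orlicz_setI[OF y k(1)]) (rule le_less_trans)
qed

lemma lux_le_mult:
  fixes x :: "'a \<Rightarrow> 'b::{real_normed_vector, second_countable_topology}"
  assumes x: "x \<in> orlicz_set M \<phi>" and le: "\<And>l. lux x < l \<Longrightarrow> 0 < l \<Longrightarrow> modular M \<phi> (\<lambda>t. x t /\<^sub>R l) \<le> 1 \<Longrightarrow> z \<le> c * l"
  shows "z \<le> c * lux x"
  by (rule le_mult_of_all_greater)
    (use le modular_le_one_of_lux_less[OF x] lux_nonneg[OF x] in force)

lemma lux_eq_0D:
  fixes x :: "'a \<Rightarrow> 'b::{real_normed_vector, second_countable_topology}"
  assumes x: "x \<in> orlicz_set M \<phi>" and z: "lux x = 0"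
  shows "AE t in M. x t = 0"
proof -
  have [measurable]: "x \<in> borel_measurable M" using x by (rule orlicz_setD)
  have le: "modular M \<phi> x \<le> ennreal e" if e: "0 < e" "e \<le> 1" for e
  proof -
    have "modular M \<phi> (\<lambda>t. e *\<^sub>R (x t /\<^sub>R e)) \<le> ennreal e * modular M \<phi> (\<lambda>t. x t /\<^sub>R e)"
      by (rule modular_scale) (use e in auto)
    also have "\<dots> \<le> ennreal e * 1"
      using modular_le_one_of_lux_less[OF x, of e] e z by (intro mult_left_mono) auto
    finally show ?thesis using e by simp
  qed
  have "modular M \<phi> x = 0"
  proof (cases "modular M \<phi> x")
    case (real r)
    have "r \<le> min 1 (r / 2)" if "r \<noteq> 0"
      using le[of "min 1 (r / 2)"] real that by simp
    then show ?thesis using real by (cases "r = 0") auto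
  qed (use le[of 1] in \<open>auto simp: top_unique\<close>)
  then have "AE t in M. \<phi> (norm (x t)) = 0"
    unfolding modular_def by (subst (asm) nn_integral_0_iff_AE) (auto intro: measurable_phi_norm)
  then show ?thesis
  proof eventually_elim
    case (elim t)
    then show ?case using pos[of "norm (x t)"] by fastforce
  qed
qed

lemma lux_eq_0I:
  assumes "AE t in M. x t = 0"
  shows "lux x = 0"
proof -
  have "modular M \<phi> (\<lambda>t. x t /\<^sub>R l) = 0" for l
  proof -
    have "modular M \<phi> (\<lambda>t. x t /\<^sub>R l) = (\<integral>\<^sup>+t. 0 \<partial>M)"
      unfolding modular_def using assms by (intro nn_integral_cong_AE) (auto elim!: eventually_mono simp: zero)
    then show ?thesis by simp
  qed
  then have "{l. l > 0 \<and> modular M \<phi> (\<lambda>t. x t /\<^sub>R l) \<le> 1} = {0<..}" by auto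
  then show ?thesis unfolding lux_eq by simp
qed

lemma modular_norm_lux: "modular_norm M \<phi> (lux :: ('a \<Rightarrow> 'b::{real_normed_vector, second_countable_topology}) \<Rightarrow> real)"
  unfolding modular_norm_def
proof (intro conjI ballI allI impI)
  fix x y :: "'a \<Rightarrow> 'b" and D :: real
  assume x: "x \<in> orlicz_set M \<phi>" and y: "y \<in> orlicz_set M \<phi>" and D: "0 < D"
    and le: "\<forall>l>0. modular M \<phi> (\<lambda>t. (l / D) *\<^sub>R y t) \<le> modular M \<phi> (\<lambda>t. l *\<^sub>R x t)"
  show "lux y \<le> D * lux x"
  proof (rule lux_le_mult[OF x])
    fix l assume l: "0 < l" "modular M \<phi> (\<lambda>t. x t /\<^sub>R l) \<le> 1"
    have "modular M \<phi> (\<lambda>t. (inverse l / D) *\<^sub>R y t) \<le> 1"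
      using le l by (meson order_trans positive_imp_inverse_positive)
    then show "lux y \<le> D * l" using D l by (intro lux_le) (auto simp: field_simps)
  qed
next
  fix x y :: "'a \<Rightarrow> 'b" assume x: "x \<in> orlicz_set M \<phi>" and y: "y \<in> orlicz_set M \<phi>"
  have *: "lux (\<lambda>t. x t + y t) \<le> a + b" if a: "lux x < a" and b: "lux y < b" for a b
  proof -
    have ab: "0 < a" "0 < b" using lux_nonneg[OF x] lux_nonneg[OF y] a b by auto
    define k m where "k = inverse a" and "m = inverse b"
    have km: "0 < k" "0 < m" "k * m / (k + m) = inverse (a + b)"
      using ab by (auto simp: k_def m_def field_simps)
    have "modular M \<phi> (\<lambda>t. (x t + y t) /\<^sub>R (a + b))
        \<le> ennreal (m / (k + m)) * modular M \<phi> (\<lambda>t. k *\<^sub>R x t) + ennreal (k / (k + m)) * modular M \<phi> (\<lambda>t. m *\<^sub>R y t)"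
      using modular_sum_scaled[OF orlicz_setD[OF x] orlicz_setD[OF y] km(1,2)] unfolding km(3) .
    also have "\<dots> \<le> ennreal (m / (k + m)) * 1 + ennreal (k / (k + m)) * 1"
      using modular_le_one_of_lux_less[OF x a] modular_le_one_of_lux_less[OF y b]
      by (intro add_mono mult_left_mono) (auto simp: k_def m_def)
    also have "\<dots> = ennreal (m / (k + m) + k / (k + m))" using km by (simp add: ennreal_plus)
    also have "m / (k + m) + k / (k + m) = 1" using km by (simp add: add_divide_distrib[symmetric])
    finally show ?thesis using ab by (intro lux_le) auto
  qed
  show "lux (\<lambda>t. x t + y t) \<le> lux x + lux y"
  proof (rule field_le_epsilon)
    fix e :: real assume "0 < e"
    then show "lux (\<lambda>t. x t + y t) \<le> lux x + lux y + e" using *[of "lux x + e / 2" "lux y + e / 2"] by simp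
  qed
qed (auto dest: lux_nonneg)

abbreviation "amem \<equiv> nrm (orlicz_amemiya M \<phi>)"

lemma amem_le:
  fixes x :: "'a \<Rightarrow> 'b::real_normed_vector"
  assumes "0 < k" "modular M \<phi> (\<lambda>t. k *\<^sub>R x t) \<le> ennreal i" "0 \<le> i"
  shows "amem x \<le> (1 + i) / k"
proof -
  have "(INF k \<in> {0<..}. ennreal (1 / k) * (1 + modular M \<phi> (\<lambda>t. k *\<^sub>R x t)))
      \<le> ennreal (1 / k) * (1 + modular M \<phi> (\<lambda>t. k *\<^sub>R x t))"
    using assms by (intro INF_lower) auto
  also have "\<dots> \<le> ennreal (1 / k) * (1 + ennreal i)" using assms by (intro mult_left_mono add_left_mono) auto
  also have "\<dots> = ennreal ((1 + i) / k)"
    using assms by (simp add: ennreal_mult''[symmetric] ennreal_1[symmetric] ennreal_plus[symmetric] del: ennreal_1 ennreal_plus)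
  finally show ?thesis using assms by (simp add: orlicz_amemiya_def enn2real_leI)
qed

text \<open>
  The infimum in the Amemiya formula is taken in the extended reals and then converted by
  \<open>enn2real\<close>; on the Orlicz space it is finite, so a real bound above it is witnessed by
  some \<open>k\<close> with finite modular.
\<close>

lemma amem_lessE:
  fixes x :: "'a \<Rightarrow> 'b::{real_normed_vector, second_countable_topology}"
  assumes x: "x \<in> orlicz_set M \<phi>" and r: "amem x < r"
  obtains k i where "0 < k" "modular M \<phi> (\<lambda>t. k *\<^sub>R x t) = ennreal i" "0 \<le> i" "(1 + i) / k < r"
proof -
  let ?J = "INF k \<in> {0<..}. ennreal (1 / k) * (1 + modular M \<phi> (\<lambda>t. k *\<^sub>R x t))"
  have am: "amem x = enn2real ?J" by (simp add: orlicz_amemiya_def)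
  obtain k where k: "0 < k" "modular M \<phi> (\<lambda>t. k *\<^sub>R x t) < \<infinity>" using x by (auto simp: orlicz_set_def)
  have "?J \<le> ennreal (1 / k) * (1 + modular M \<phi> (\<lambda>t. k *\<^sub>R x t))"
    using k by (intro INF_lower) auto
  also have "\<dots> < \<infinity>" using k by (simp add: ennreal_mult_less_top)
  finally have "?J = ennreal (amem x)" by (simp add: am)
  moreover have "0 \<le> amem x" by (simp add: am)
  ultimately have "?J < ennreal r" using r by (simp add: ennreal_less_iff)
  then obtain k where k: "0 < k" "ennreal (1 / k) * (1 + modular M \<phi> (\<lambda>t. k *\<^sub>R x t)) < ennreal r"
    unfolding INF_less_iff by auto
  show ?thesis
  proof (cases "modular M \<phi> (\<lambda>t. k *\<^sub>R x t)")
    case (real i)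
    have "ennreal ((1 + i) / k) < ennreal r"
      using k real by (simp add: ennreal_mult''[symmetric] ennreal_1[symmetric] ennreal_plus[symmetric] del: ennreal_1 ennreal_plus)
    then have "(1 + i) / k < r" using real k by (simp add: ennreal_less_iff)
    then show ?thesis using that k real by blast
  next
    case top
    then have "ennreal (1 / k) * (1 + modular M \<phi> (\<lambda>t. k *\<^sub>R x t)) = top"
      using k by (simp add: ennreal_mult_top)
    then show ?thesis using k by simp
  qed
qed

lemma modular_norm_amem: "modular_norm M \<phi> (amem :: ('a \<Rightarrow> 'b::{real_normed_vector, second_countable_topology}) \<Rightarrow> real)"
  unfolding modular_norm_def
proof (intro conjI ballI allI impI)
  fix x y :: "'a \<Rightarrow> 'b" and D :: real
  assume x: "x \<in> orlicz_set M \<phi>" and y: "y \<in> orlicz_set M \<phi>" and D: "0 < D"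
    and le: "\<forall>l>0. modular M \<phi> (\<lambda>t. (l / D) *\<^sub>R y t) \<le> modular M \<phi> (\<lambda>t. l *\<^sub>R x t)"
  show "amem y \<le> D * amem x"
  proof (rule le_mult_of_all_greater)
    fix r assume "amem x < r"
    then obtain k i where k: "0 < k" "modular M \<phi> (\<lambda>t. k *\<^sub>R x t) = ennreal i" "0 \<le> i" "(1 + i) / k < r"
      using amem_lessE[OF x] by metis
    have "amem y \<le> (1 + i) / (k / D)"
      using le k D by (intro amem_le) auto
    also have "\<dots> = D * ((1 + i) / k)" by simp
    also have "\<dots> \<le> D * r" by (rule mult_left_mono) (use k D in auto)
    finally show "amem y \<le> D * r" .
  qed
next
  fix x y :: "'a \<Rightarrow> 'b" assume x: "x \<in> orlicz_set M \<phi>" and y: "y \<in> orlicz_set M \<phi>"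
  have *: "amem (\<lambda>t. x t + y t) \<le> r + s" if r: "amem x < r" and s: "amem y < s" for r s
  proof -
    obtain k i where k: "0 < k" "modular M \<phi> (\<lambda>t. k *\<^sub>R x t) = ennreal i" "0 \<le> i" "(1 + i) / k < r"
      using amem_lessE[OF x r] by metis
    obtain m j where m: "0 < m" "modular M \<phi> (\<lambda>t. m *\<^sub>R y t) = ennreal j" "0 \<le> j" "(1 + j) / m < s"
      using amem_lessE[OF y s] by metis
    have "modular M \<phi> (\<lambda>t. (k * m / (k + m)) *\<^sub>R (x t + y t))
        \<le> ennreal (m / (k + m)) * ennreal i + ennreal (k / (k + m)) * ennreal j"
      using modular_sum_scaled[OF orlicz_setD[OF x] orlicz_setD[OF y] k(1) m(1)] k m by simp
    also have "\<dots> = ennreal (m / (k + m) * i + k / (k + m) * j)"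
    proof -
      have "0 \<le> m / (k + m) * i" "0 \<le> k / (k + m) * j" using k m by auto
      then show ?thesis using k m by (simp only: ennreal_plus ennreal_mult''[OF k(3)] ennreal_mult''[OF m(3)])
    qed
    finally have "amem (\<lambda>t. x t + y t) \<le> (1 + (m / (k + m) * i + k / (k + m) * j)) / (k * m / (k + m))"
      using k m by (intro amem_le) auto
    also have "\<dots> = (1 + i) / k + (1 + j) / m"
    proof -
      have nz: "k + m \<noteq> 0" "k \<noteq> 0" "m \<noteq> 0" using k m by auto
      then show ?thesis by (simp add: divide_simps) (simp add: algebra_simps)
    qed
    finally show ?thesis using k m by simp
  qed
  show "amem (\<lambda>t. x t + y t) \<le> amem x + amem y"
  proof (rule field_le_epsilon)
    fix e :: real assume "0 < e"
    then show "amem (\<lambda>t. x t + y t) \<le> amem x + amem y + e" using *[of "amem x + e / 2" "amem y + e / 2"] by simp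
  qed
next
  fix x :: "'a \<Rightarrow> 'b" assume x: "x \<in> orlicz_set M \<phi>"
  show "amem x \<le> 2 * lux x"
  proof (rule lux_le_mult[OF x])
    fix l assume l: "0 < l" "modular M \<phi> (\<lambda>t. x t /\<^sub>R l) \<le> 1"
    then have "amem x \<le> (1 + 1) / inverse l" by (intro amem_le) auto
    then show "amem x \<le> 2 * l" using l by (simp add: field_simps)
  qed
  have "lux x \<le> 1 * amem x"
  proof (rule le_mult_of_all_greater)
    fix r assume "amem x < r"
    then obtain k i where k: "0 < k" "modular M \<phi> (\<lambda>t. k *\<^sub>R x t) = ennreal i" "0 \<le> i" "(1 + i) / k < r"
      using amem_lessE[OF x] by metis
    have [measurable]: "x \<in> borel_measurable M" using x by (rule orlicz_setD)
    have "modular M \<phi> (\<lambda>t. (1 / (1 + i)) *\<^sub>R k *\<^sub>R x t) \<le> ennreal (1 / (1 + i)) * modular M \<phi> (\<lambda>t. k *\<^sub>R x t)"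
      by (rule modular_scale) (use k in auto)
    also have "\<dots> = ennreal (i / (1 + i))" using k by (simp add: ennreal_mult''[symmetric])
    also have "\<dots> \<le> 1" using k by simp
    finally have "lux x \<le> (1 + i) / k" using k by (intro lux_le) auto
    then show "lux x \<le> 1 * r" using k by simp
  qed
  then show "lux x \<le> amem x" by simp
qed

text \<open>
  Along a subsequence with increments \<open>d k\<close> of norm below \<open>4\<^sup>-\<^sup>k\<close>, convexity gives modulars of
  \<open>2\<^sup>k d k\<close> at most \<open>2\<^sup>-\<^sup>k\<close>. Their sum is finite, so for almost every \<open>t\<close> the values \<open>\<phi> (2\<^sup>k |d k t|)\<close> tend to \<open>0\<close>
  and \<open>|d k t| \<le> 2\<^sup>-\<^sup>k\<close> from some \<open>k\<close> on. Hence the subsequence converges almost everywhere,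
  and Fatou's lemma turns its pointwise limit into a limit in norm.
\<close>

lemma orlicz_complete:
  fixes F :: "nat \<Rightarrow> 'a \<Rightarrow> 'b::{real_normed_field, banach, second_countable_topology}"
  assumes F: "\<And>n. F n \<in> orlicz_set M \<phi>"
    and cauchy: "\<And>e. 0 < e \<Longrightarrow> \<exists>N. \<forall>m\<ge>N. \<forall>n\<ge>N. lux (\<lambda>t. F m t - F n t) < e"
  obtains f where "f \<in> orlicz_set M \<phi>" "(\<lambda>n. lux (\<lambda>t. F n t - f t)) \<longlonglongrightarrow> 0"
proof -
  have Fm[measurable]: "F n \<in> borel_measurable M" for n using F by (rule orlicz_setD)
  have E: "(\<lambda>t. F m t - F n t) \<in> orlicz_set M \<phi>" for m n by (rule orlicz_set_minus[OF F F])
  have "\<forall>k. \<exists>N. \<forall>m\<ge>N. \<forall>n\<ge>N. lux (\<lambda>t. F m t - F n t) < (1/4) ^ k" by (intro allI cauchy) simp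
  then obtain Q where Q: "\<And>k m n. Q k \<le> m \<Longrightarrow> Q k \<le> n \<Longrightarrow> lux (\<lambda>t. F m t - F n t) < (1/4) ^ k"
    by metis
  \<comment> \<open>Summing the indices makes \<open>r\<close> monotone, so that both \<open>r k\<close> and \<open>r (Suc k)\<close> lie above \<open>Q k\<close>.\<close>
  define r where "r k = (\<Sum>i\<le>k. Q i) + k" for k
  have rQ: "Q k \<le> r k" "Q k \<le> r (Suc k)" "k \<le> r k" for k
  proof -
    have "Q k \<le> sum Q {..k}" by (rule member_le_sum) auto
    then show "Q k \<le> r k" "Q k \<le> r (Suc k)" "k \<le> r k" by (auto simp: r_def)
  qed
  define d where "d k t = F (r (Suc k)) t - F (r k) t" for k t
  have dm[measurable]: "d k \<in> borel_measurable M" for k unfolding d_def[abs_def] by measurable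
  have d_mod: "modular M \<phi> (\<lambda>t. (2 ^ k) *\<^sub>R d k t) \<le> ennreal ((1/2) ^ k)" for k
  proof -
    have "modular M \<phi> (\<lambda>t. d k t /\<^sub>R ((1/4) ^ k)) \<le> 1"
      unfolding d_def by (rule modular_le_one_of_lux_less[OF E Q]) (rule rQ)+
    moreover have "modular M \<phi> (\<lambda>t. (1/2) ^ k *\<^sub>R (d k t /\<^sub>R ((1/4) ^ k)))
        \<le> ennreal ((1/2) ^ k) * modular M \<phi> (\<lambda>t. d k t /\<^sub>R ((1/4) ^ k))"
      by (rule modular_scale) (auto simp: power_le_one)
    ultimately have "modular M \<phi> (\<lambda>t. (1/2) ^ k *\<^sub>R (d k t /\<^sub>R ((1/4) ^ k))) \<le> ennreal ((1/2) ^ k) * 1"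
      by (meson mult_left_mono order_trans zero_le)
    moreover have "(1/2 :: real) ^ k * inverse ((1/4) ^ k) = 2 ^ k"
      by (simp add: power_inverse[symmetric] power_mult_distrib[symmetric])
    ultimately show ?thesis by simp
  qed
  have dphi[measurable]: "(\<lambda>t. \<phi> (norm (2 ^ k *\<^sub>R d k t))) \<in> borel_measurable M" for k
    by (rule measurable_phi_norm) simp
  have "(\<integral>\<^sup>+t. (\<Sum>k. \<phi> (norm (2 ^ k *\<^sub>R d k t))) \<partial>M) = (\<Sum>k. modular M \<phi> (\<lambda>t. (2 ^ k) *\<^sub>R d k t))"
    unfolding modular_def by (rule nn_integral_suminf) (rule dphi)
  also have "\<dots> \<le> (\<Sum>k. ennreal ((1/2) ^ k))" by (intro suminf_le d_mod) auto
  also have "\<dots> = ennreal (\<Sum>k. (1/2) ^ k)" by (rule suminf_ennreal2) (auto intro: summable_geometric)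
  also have "\<dots> < \<infinity>" by simp
  finally have "AE t in M. (\<Sum>k. \<phi> (norm (2 ^ k *\<^sub>R d k t))) \<noteq> \<infinity>"
    by (intro nn_integral_PInf_AE borel_measurable_suminf_order dphi) simp
  then have conv_ae: "AE t in M. convergent (\<lambda>k. F (r k) t)"
  proof eventually_elim
    case (elim t)
    define a where "a k = enn2real (\<phi> (norm (2 ^ k *\<^sub>R d k t)))" for k
    have a: "\<phi> (norm (2 ^ k *\<^sub>R d k t)) = ennreal (a k)" for k
      using fin[of "norm (2 ^ k *\<^sub>R d k t)"] by (simp add: a_def)
    have "(\<Sum>k. ennreal (a k)) \<noteq> top" using elim unfolding a infinity_ennreal_def .
    then have "summable a" by (rule summable_suminf_not_top[rotated]) (simp add: a_def)
    then have "a \<longlonglongrightarrow> 0" by (rule summable_LIMSEQ_zero)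
    moreover have one: "0 < enn2real (\<phi> 1)" "ennreal (enn2real (\<phi> 1)) = \<phi> 1"
      using pos[of 1] fin[of 1] by (auto simp: enn2real_positive_iff)
    ultimately have "\<forall>\<^sub>F k in sequentially. a k < enn2real (\<phi> 1)" by (intro order_tendstoD(2)) auto
    then have "\<forall>\<^sub>F k in sequentially. norm (norm (d k t)) \<le> (1/2) ^ k"
    proof eventually_elim
      case (elim k)
      then have "ennreal (a k) < ennreal (enn2real (\<phi> 1))" by (intro ennreal_lessI) (auto simp: one)
      then have "\<phi> (norm (2 ^ k *\<^sub>R d k t)) < \<phi> 1" by (simp only: a one)
      then have "\<not> 1 \<le> norm (2 ^ k *\<^sub>R d k t)" using mono_onD[OF mono, of 1 "norm (2 ^ k *\<^sub>R d k t)"] by auto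
      then show ?case by (simp add: field_simps power_divide)
    qed
    then have "summable (\<lambda>k. norm (d k t))"
      by (rule summable_comparison_test_ev) (simp add: summable_geometric)
    then have "summable (\<lambda>k. d k t)" by (rule summable_norm_cancel)
    then have "convergent (\<lambda>n. \<Sum>k<n. d k t)" by (simp add: summable_iff_convergent)
    moreover have "(\<Sum>k<n. d k t) = F (r n) t - F (r 0) t" for n
      unfolding d_def by (rule sum_lessThan_telescope[of "\<lambda>k. F (r k) t"])
    ultimately have "convergent (\<lambda>n. F (r n) t - F (r 0) t)" by simp
    then have "convergent (\<lambda>n. (F (r n) t - F (r 0) t) + F (r 0) t)"
      by (intro convergent_add convergent_const)
    then show ?case by simp
  qed
  define f where "f t = lim (\<lambda>k. F (r k) t)" for t
  have [measurable]: "f \<in> borel_measurable M"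
    unfolding f_def[abs_def] by (rule borel_measurable_lim_metric) simp
  have f_lim: "AE t in M. (\<lambda>k. F (r k) t) \<longlonglongrightarrow> f t"
    using conv_ae by eventually_elim (simp add: f_def convergent_LIMSEQ_iff)
  have close: "modular M \<phi> (\<lambda>t. (F m t - f t) /\<^sub>R e) \<le> 1"
    if e: "0 < e" and N: "\<And>m n. N \<le> m \<Longrightarrow> N \<le> n \<Longrightarrow> lux (\<lambda>t. F m t - F n t) < e" and m: "N \<le> m" for e N m
  proof -
    have "modular M \<phi> (\<lambda>t. (F m t - f t) /\<^sub>R e) \<le> (\<integral>\<^sup>+t. liminf (\<lambda>k. \<phi> (norm ((F m t - F (r k) t) /\<^sub>R e))) \<partial>M)"
      unfolding modular_def
    proof (rule nn_integral_mono_AE)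
      show "AE t in M. \<phi> (norm ((F m t - f t) /\<^sub>R e)) \<le> liminf (\<lambda>k. \<phi> (norm ((F m t - F (r k) t) /\<^sub>R e)))"
        using f_lim
      proof eventually_elim
        case (elim t)
        show ?case by (rule lower_semicontinuous) (auto intro!: tendsto_intros elim)
      qed
    qed
    also have "\<dots> \<le> liminf (\<lambda>k. \<integral>\<^sup>+t. \<phi> (norm ((F m t - F (r k) t) /\<^sub>R e)) \<partial>M)"
      by (rule nn_integral_liminf) (rule measurable_phi_norm, measurable)
    also have "\<dots> \<le> limsup (\<lambda>k. \<integral>\<^sup>+t. \<phi> (norm ((F m t - F (r k) t) /\<^sub>R e)) \<partial>M)"
      by (rule Liminf_le_Limsup) simp
    also have "\<dots> \<le> 1"
    proof (rule Limsup_bounded)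
      show "\<forall>\<^sub>F k in sequentially. (\<integral>\<^sup>+t. \<phi> (norm ((F m t - F (r k) t) /\<^sub>R e)) \<partial>M) \<le> 1"
        using eventually_ge_at_top[of N]
      proof eventually_elim
        case (elim k)
        then have "N \<le> r k" using rQ(3)[of k] by simp
        then show ?case using modular_le_one_of_lux_less[OF E N[OF m]] by (simp add: modular_def)
      qed
    qed
    finally show ?thesis .
  qed
  show ?thesis
  proof (rule that[of f])
    obtain N where N: "\<And>m n. N \<le> m \<Longrightarrow> N \<le> n \<Longrightarrow> lux (\<lambda>t. F m t - F n t) < 1"
      using cauchy[of 1] by auto
    have "modular M \<phi> (\<lambda>t. (F N t - f t) /\<^sub>R 1) \<le> 1" by (rule close[OF _ N]) auto
    then have "modular M \<phi> (\<lambda>t. 1 *\<^sub>R (F N t - f t)) < \<infinity>" by (simp add: le_less_trans[of _ 1])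
    then have "(\<lambda>t. F N t - f t) \<in> orlicz_set M \<phi>" by (intro orlicz_setI[where l = 1]) auto
    from orlicz_set_minus[OF F[of N] this] show f: "f \<in> orlicz_set M \<phi>" by simp
    show "(\<lambda>n. lux (\<lambda>t. F n t - f t)) \<longlonglongrightarrow> 0"
    proof (rule LIMSEQ_I)
      fix e :: real assume e: "0 < e"
      then obtain N where N: "\<And>m n. N \<le> m \<Longrightarrow> N \<le> n \<Longrightarrow> lux (\<lambda>t. F m t - F n t) < e / 2"
        using cauchy[of "e / 2"] by auto
      have "norm (lux (\<lambda>t. F n t - f t) - 0) < e" if "N \<le> n" for n
      proof -
        have "lux (\<lambda>t. F n t - f t) \<le> e / 2"
          using e by (intro lux_le close[OF _ N that]) auto
        moreover have "0 \<le> lux (\<lambda>t. F n t - f t)" by (rule lux_nonneg[OF orlicz_set_minus[OF F f]])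
        ultimately show ?thesis using e by simp
      qed
      then show "\<exists>N. \<forall>n\<ge>N. norm (lux (\<lambda>t. F n t - f t) - 0) < e" by blast
    qed
  qed
qed

lemma banach_of_modular_norm:
  fixes n :: "('a \<Rightarrow> 'b::{real_normed_field, banach, second_countable_topology}) \<Rightarrow> real"
  assumes n: "modular_norm M \<phi> n"
  shows "banach_fun_space M \<lparr>elems = orlicz_set M \<phi>, nrm = n\<rparr>"
proof -
  have dom: "n y \<le> D * n x" if "x \<in> orlicz_set M \<phi>" "y \<in> orlicz_set M \<phi>" "0 < D"
    "\<And>l. 0 < l \<Longrightarrow> modular M \<phi> (\<lambda>t. (l / D) *\<^sub>R y t) \<le> modular M \<phi> (\<lambda>t. l *\<^sub>R x t)" for x y D
    using n that unfolding modular_norm_def by blast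
  have tri: "n (\<lambda>t. x t + y t) \<le> n x + n y" if "x \<in> orlicz_set M \<phi>" "y \<in> orlicz_set M \<phi>" for x y
    using n that unfolding modular_norm_def by blast
  have equiv: "lux x \<le> n x" "n x \<le> 2 * lux x" if "x \<in> orlicz_set M \<phi>" for x
    using n that unfolding modular_norm_def by blast+
  have le_ae: "n y \<le> n x" if "x \<in> orlicz_set M \<phi>" "y \<in> orlicz_set M \<phi>" "AE t in M. x t = y t" for x y
  proof -
    have "n y \<le> 1 * n x"
      using that by (intro dom modular_mono[OF mono]) (auto elim!: eventually_mono)
    then show ?thesis by simp
  qed
  have z_mem: "(\<lambda>t. 0 :: 'b) \<in> orlicz_set M \<phi>"
    by (rule orlicz_setI[where l = 1]) (auto simp: modular_def zero)
  have n0: "n x = 0 \<longleftrightarrow> (AE t in M. x t = 0)" if x: "x \<in> orlicz_set M \<phi>" for x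
    using equiv[OF x] lux_eq_0D[OF x] lux_eq_0I[of x] lux_nonneg[OF x] by fastforce
  have nn: "0 \<le> n x" if x: "x \<in> orlicz_set M \<phi>" for x
    using equiv[OF x] lux_nonneg[OF x] by simp
  have hom_le: "n (\<lambda>t. c * x t) \<le> norm c * n x" if x: "x \<in> orlicz_set M \<phi>" and c: "c \<noteq> 0" for c x
  proof (rule dom[OF x orlicz_set_scale[OF x]])
    fix l :: real assume l: "0 < l"
    show "modular M \<phi> (\<lambda>t. (l / norm c) *\<^sub>R (c * x t)) \<le> modular M \<phi> (\<lambda>t. l *\<^sub>R x t)"
      using c l by (intro modular_mono[OF mono]) (simp add: norm_mult)
  qed (use c in simp)
  have hom: "n (\<lambda>t. c * x t) = norm c * n x" if x: "x \<in> orlicz_set M \<phi>" for c x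
  proof (cases "c = 0")
    case True
    then show ?thesis using n0[OF z_mem] by simp
  next
    case False
    have "n (\<lambda>t. inverse c * (c * x t)) \<le> norm (inverse c) * n (\<lambda>t. c * x t)"
      by (rule hom_le[OF orlicz_set_scale[OF x]]) (use False in simp)
    also have "(\<lambda>t. inverse c * (c * x t)) = x" using False by (simp add: mult.assoc[symmetric])
    also have "norm (inverse c) = inverse (norm c)" by (rule nonzero_norm_inverse[OF False])
    finally have "norm c * n x \<le> n (\<lambda>t. c * x t)" using False by (simp add: field_simps)
    with hom_le[OF x False] show ?thesis by simp
  qed
  have complete: "\<exists>f\<in>orlicz_set M \<phi>. (\<lambda>k. n (\<lambda>t. F k t - f t)) \<longlonglongrightarrow> 0"
    if F: "\<forall>k. F k \<in> orlicz_set M \<phi>" and cauchy: "\<forall>e>0. \<exists>N. \<forall>k\<ge>N. \<forall>m\<ge>N. n (\<lambda>t. F k t - F m t) < e" for F :: "nat \<Rightarrow> 'a \<Rightarrow> 'b"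
  proof -
    have "\<exists>N. \<forall>k\<ge>N. \<forall>m\<ge>N. lux (\<lambda>t. F k t - F m t) < e" if e: "0 < e" for e
    proof -
      obtain N where "\<forall>k\<ge>N. \<forall>m\<ge>N. n (\<lambda>t. F k t - F m t) < e" using cauchy[rule_format, OF e] by blast
      then show ?thesis using equiv(1)[OF orlicz_set_minus] F by (meson le_less_trans)
    qed
    with F obtain f where f: "f \<in> orlicz_set M \<phi>" "(\<lambda>k. lux (\<lambda>t. F k t - f t)) \<longlonglongrightarrow> 0"
      using orlicz_complete[of F] by blast
    have m: "(\<lambda>t. F k t - f t) \<in> orlicz_set M \<phi>" for k using F f by (intro orlicz_set_minus) auto
    have "(\<lambda>k. n (\<lambda>t. F k t - f t)) \<longlonglongrightarrow> 0"
    proof (rule tendsto_sandwich[where f = "\<lambda>_. 0" and h = "\<lambda>k. 2 * lux (\<lambda>t. F k t - f t)"])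
      show "(\<lambda>k. 2 * lux (\<lambda>t. F k t - f t)) \<longlonglongrightarrow> 0" using tendsto_mult_left[OF f(2), of 2] by simp
    qed (use nn[OF m] equiv(2)[OF m] in auto)
    with f show ?thesis by blast
  qed
  show ?thesis
    unfolding banach_fun_space_def fun_space.simps
  proof (intro conjI ballI allI impI)
    show "orlicz_set M \<phi> \<subseteq> borel_measurable M" by (auto dest: orlicz_setD)
  next
    fix f g :: "'a \<Rightarrow> 'b" assume "f \<in> orlicz_set M \<phi>" "g \<in> orlicz_set M \<phi>" and eq: "AE t in M. f t = g t"
    moreover have "AE t in M. g t = f t" using eq by (auto elim!: eventually_mono)
    ultimately show "n f = n g" by (intro antisym le_ae)
  qed (auto intro: z_mem orlicz_set_cong orlicz_set_add orlicz_set_scale nn tri complete simp: n0 hom)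
qed

end

section \<open>Interpolation between Lebesgue spaces and bounded functions\<close>

text \<open>
  Convexity of \<open>u \<mapsto> \<phi> (u powr (1 / p))\<close> places \<open>\<phi>\<close> between \<open>L\<^sup>p\<close> and \<open>L\<^sup>\<infinity>\<close>: compared with the multiple of
  \<open>u\<^sup>p\<close> that agrees with it at \<open>u = 1\<close>, it is at most this multiple before that point and at least this multiple after it. These two
  comparisons are the two embeddings.
\<close>

locale p_convex_orlicz = finite_orlicz M \<phi> for M :: "'a measure" and \<phi> :: "real \<Rightarrow> ennreal" +
  fixes p :: real
  assumes p: "1 \<le> p" and conv_p: "convex_fun (\<lambda>u. \<phi> (u powr (1 / p)))"
begin

definition phi_one where "phi_one = enn2real (\<phi> 1)"

lemma phi_one: "0 < phi_one" "\<phi> 1 = ennreal phi_one"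
  using pos[of 1] fin[of 1] by (auto simp: phi_one_def enn2real_positive_iff)

lemma phi_le_powr:
  assumes "0 \<le> u" "u \<le> 1"
  shows "\<phi> u \<le> ennreal (phi_one * u powr p)"
proof -
  have "\<phi> ((u powr p * 1) powr (1 / p)) \<le> ennreal (u powr p) * \<phi> (1 powr (1 / p))"
    using assms p by (intro convex_fun_scale[OF conv_p]) (auto simp: zero powr_le1)
  then show ?thesis using assms p phi_one by (simp add: powr_powr ennreal_mult mult.commute)
qed

lemma powr_le_phi:
  assumes "1 \<le> u"
  shows "ennreal (phi_one * u powr p) \<le> \<phi> u"
proof -
  have u: "1 \<le> u powr p" using assms p by (simp add: ge_one_powr_ge_zero)
  have "\<phi> ((1 / u powr p * u powr p) powr (1 / p)) \<le> ennreal (1 / u powr p) * \<phi> ((u powr p) powr (1 / p))"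
    using assms p u by (intro convex_fun_scale[OF conv_p]) (auto simp: zero)
  then have "ennreal phi_one \<le> ennreal (1 / u powr p) * \<phi> u" using assms p phi_one by (simp add: powr_powr)
  then have "ennreal (u powr p) * ennreal phi_one \<le> ennreal (u powr p) * (ennreal (1 / u powr p) * \<phi> u)"
    by (rule mult_left_mono) simp
  also have "\<dots> = \<phi> u" using assms by (simp add: mult.assoc[symmetric] ennreal_mult[symmetric])
  finally show ?thesis using phi_one by (simp add: ennreal_mult mult.commute)
qed

text \<open>
  If \<open>l\<close> exceeds both norms, then \<open>|f| / l \<le> 1\<close>, where \<open>\<phi> u \<le> \<phi>(1) u\<^sup>p\<close>; hence the modular of \<open>f / l\<close> is at
  most \<open>\<phi>(1)\<close>, and one more scaling by \<open>max 1 \<phi>(1)\<close> brings it below \<open>1\<close>.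
\<close>

lemma inter_lux_le:
  fixes f :: "'a \<Rightarrow> 'b::{real_normed_field, second_countable_topology}"
  assumes f: "f \<in> elems (inter_space (lp_space M p) (linf_space M))"
  shows "f \<in> orlicz_set M \<phi>" "lux f \<le> max 1 phi_one * nrm (inter_space (lp_space M p) (linf_space M)) f"
proof -
  have fp: "f \<in> elems (lp_space M p)" and fi: "f \<in> elems (linf_space M)" using f by (auto simp: inter_space_def)
  have fm[measurable]: "f \<in> borel_measurable M" by (rule lp_spaceD(1)[OF fp])
  define I where "I = (LINT t|M. norm (f t) powr p)"
  have I0: "0 \<le> I" by (simp add: I_def)
  have n: "nrm (inter_space (lp_space M p) (linf_space M)) f = max (I powr (1 / p)) (nrm (linf_space M) f)"
    by (simp add: inter_space_def lp_space_def I_def)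
  have small: "modular M \<phi> (\<lambda>t. f t /\<^sub>R l) \<le> ennreal phi_one"
    if l: "max (I powr (1 / p)) (nrm (linf_space M) f) < l" for l
  proof -
    have l0: "0 < l" using l I0 by (smt (verit) powr_ge_zero)
    have Il: "I \<le> l powr p"
    proof -
      have "(I powr (1 / p)) powr p \<le> l powr p" using l p by (intro powr_mono2) auto
      then show ?thesis using I0 p by (simp add: powr_powr)
    qed
    have "modular M \<phi> (\<lambda>t. f t /\<^sub>R l) \<le> (\<integral>\<^sup>+t. ennreal (phi_one / l powr p) * ennreal (norm (f t) powr p) \<partial>M)"
      unfolding modular_def
    proof (rule nn_integral_mono_AE)
      show "AE t in M. \<phi> (norm (f t /\<^sub>R l)) \<le> ennreal (phi_one / l powr p) * ennreal (norm (f t) powr p)"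
        using linf_spaceD(2)[OF fi]
      proof eventually_elim
        case (elim t)
        then have "norm (f t /\<^sub>R l) \<le> 1" using l l0 by (simp add: field_simps)
        then have "\<phi> (norm (f t /\<^sub>R l)) \<le> ennreal (phi_one * norm (f t /\<^sub>R l) powr p)" by (intro phi_le_powr) auto
        also have "phi_one * norm (f t /\<^sub>R l) powr p = phi_one / l powr p * norm (f t) powr p"
          using l0 by (simp add: powr_mult powr_divide divide_inverse inverse_powr[symmetric] powr_minus)
        finally show ?case by (simp only: ennreal_mult''[OF powr_ge_zero])
      qed
    qed
    also have "\<dots> = ennreal (phi_one / l powr p) * ennreal I"
      by (simp add: nn_integral_cmult lp_spaceD(3)[OF fp] I_def)
    also have "\<dots> = ennreal (phi_one / l powr p * I)" by (rule ennreal_mult''[OF I0, symmetric])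
    also have "\<dots> \<le> ennreal phi_one" using Il l0 phi_one I0 by (intro ennreal_leI) (simp add: field_simps)
    finally show ?thesis .
  qed
  show "f \<in> orlicz_set M \<phi>"
  proof (rule orlicz_setI[OF fm])
    define l where "l = max (I powr (1 / p)) (nrm (linf_space M) f) + 1"
    show "0 < inverse l" unfolding l_def by (simp add: add_nonneg_pos le_max_iff_disj)
    show "modular M \<phi> (\<lambda>t. inverse l *\<^sub>R f t) < \<infinity>"
      by (rule le_less_trans[OF small]) (auto simp: l_def)
  qed
  show "lux f \<le> max 1 phi_one * nrm (inter_space (lp_space M p) (linf_space M)) f"
    unfolding n
  proof (rule le_mult_of_all_greater)
    fix l assume l: "max (I powr (1 / p)) (nrm (linf_space M) f) < l"
    have l0: "0 < l" using l I0 by (smt (verit) powr_ge_zero)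
    define c where "c = max 1 phi_one"
    have c: "1 \<le> c" "phi_one \<le> c" by (auto simp: c_def)
    have "modular M \<phi> (\<lambda>t. (1 / c) *\<^sub>R (f t /\<^sub>R l)) \<le> ennreal (1 / c) * modular M \<phi> (\<lambda>t. f t /\<^sub>R l)"
      by (rule modular_scale) (use c in auto)
    also have "\<dots> \<le> ennreal (1 / c) * ennreal phi_one" by (intro mult_left_mono small[OF l]) simp
    also have "\<dots> = ennreal (phi_one / c)" using c phi_one by (simp add: ennreal_mult''[symmetric])
    also have "\<dots> \<le> 1" using c by simp
    finally show "lux f \<le> max 1 phi_one * l" using c l0 unfolding c_def[symmetric]
      by (intro lux_le) (auto simp: divide_inverse)
  qed
qed

text \<open>
  For \<open>l\<close> above the Luxemburg norm, \<open>f\<close> is truncated at height \<open>l\<close>. The excess lives where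
  \<open>|f| / l \<ge> 1\<close>, and there its \<open>p\<close>-th power is at most \<open>l\<^sup>p \<phi>(|f| / l) / \<phi>(1)\<close>.
\<close>

lemma orlicz_subset_sum:
  fixes f :: "'a \<Rightarrow> 'b::{real_normed_field, second_countable_topology}"
  assumes f: "f \<in> orlicz_set M \<phi>"
  shows "f \<in> elems (sum_space M (lp_space M p) (linf_space M))"
    "nrm (sum_space M (lp_space M p) (linf_space M)) f \<le> (1 + (1 / phi_one) powr (1 / p)) * lux f"
proof -
  have fm[measurable]: "f \<in> borel_measurable M" by (rule orlicz_setD[OF f])
  define c where "c = (1 / phi_one) powr (1 / p)"
  have main: "(\<lambda>t. f t - radial_cut l f t) \<in> elems (lp_space M p) \<and> radial_cut l f \<in> elems (linf_space M) \<and>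
      nrm (lp_space M p) (\<lambda>t. f t - radial_cut l f t) \<le> c * l \<and> nrm (linf_space M) (radial_cut l f) \<le> l"
    if l: "lux f < l" for l
  proof -
    have l0: "0 < l" using l lux_nonneg[OF f] by simp
    define g where "g t = f t - radial_cut l f t" for t
    have gm[measurable]: "g \<in> borel_measurable M" unfolding g_def[abs_def] by measurable
    have "(\<integral>\<^sup>+t. ennreal (norm (g t) powr p) \<partial>M) \<le> (\<integral>\<^sup>+t. ennreal (l powr p / phi_one) * \<phi> (norm (f t /\<^sub>R l)) \<partial>M)"
    proof (rule nn_integral_mono)
      fix t
      show "ennreal (norm (g t) powr p) \<le> ennreal (l powr p / phi_one) * \<phi> (norm (f t /\<^sub>R l))"
      proof (cases "l \<le> norm (f t)")
        case True
        have "norm (g t) powr p \<le> norm (f t) powr p"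
          using True l0 p by (intro powr_mono2) (auto simp: g_def norm_minus_radial_cut)
        also have "\<dots> = l powr p / phi_one * (phi_one * norm (f t /\<^sub>R l) powr p)"
        proof -
          have "l * norm (f t /\<^sub>R l) = norm (f t)" using l0 by simp
          moreover have "(l * norm (f t /\<^sub>R l)) powr p = l powr p * norm (f t /\<^sub>R l) powr p"
            by (rule powr_mult)
          ultimately have e: "norm (f t) powr p = l powr p * norm (f t /\<^sub>R l) powr p" by (simp only:)
          show ?thesis unfolding e using phi_one by simp
        qed
        finally have "ennreal (norm (g t) powr p) \<le> ennreal (l powr p / phi_one) * ennreal (phi_one * norm (f t /\<^sub>R l) powr p)"
          using phi_one by (subst ennreal_mult[symmetric]) (auto intro!: ennreal_leI)
        also have "\<dots> \<le> ennreal (l powr p / phi_one) * \<phi> (norm (f t /\<^sub>R l))"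
          using True l0 by (intro mult_left_mono powr_le_phi) (auto simp: field_simps)
        finally show ?thesis .
      qed (use l0 in \<open>simp add: g_def norm_minus_radial_cut\<close>)
    qed
    also have "\<dots> = ennreal (l powr p / phi_one) * modular M \<phi> (\<lambda>t. f t /\<^sub>R l)"
      unfolding modular_def by (rule nn_integral_cmult) (rule measurable_phi_norm, measurable)
    also have "\<dots> \<le> ennreal (l powr p / phi_one) * 1"
      by (intro mult_left_mono modular_le_one_of_lux_less[OF f l]) simp
    finally have int: "(\<integral>\<^sup>+t. ennreal (norm (g t) powr p) \<partial>M) \<le> ennreal (l powr p / phi_one)" by simp
    then have gp: "g \<in> elems (lp_space M p)" by (intro lp_spaceI[OF gm]) (auto intro: le_less_trans)
    have "(LINT t|M. norm (g t) powr p) \<le> l powr p / phi_one"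
      using int phi_one lp_spaceD(3)[OF gp] by (simp add: ennreal_le_iff)
    then have "(LINT t|M. norm (g t) powr p) powr (1 / p) \<le> (l powr p / phi_one) powr (1 / p)"
      using p by (intro powr_mono2) auto
    also have "\<dots> = c * l" using l0 p phi_one by (simp add: c_def powr_divide powr_powr)
    finally have "nrm (lp_space M p) g \<le> c * l" by (simp add: lp_space_def)
    moreover have "AE t in M. norm (radial_cut l f t) \<le> l" using l0 by (simp add: norm_radial_cut)
    ultimately show ?thesis
      using gp linf_spaceI[of "radial_cut l f" M l] l0 by (simp add: g_def[abs_def])
  qed
  show "f \<in> elems (sum_space M (lp_space M p) (linf_space M))"
    using main[of "lux f + 1"] fm unfolding sum_space_def
    by simp (rule bexI[of _ "\<lambda>t. f t - radial_cut (lux f + 1) f t"], rule bexI[of _ "radial_cut (lux f + 1) f"], auto)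
  have "nrm (sum_space M (lp_space M p) (linf_space M)) f \<le> (1 + c) * lux f"
  proof (rule le_mult_of_all_greater)
    fix l assume l: "lux f < l"
    let ?S = "{nrm (lp_space M p) g + nrm (linf_space M) h |g h.
      g \<in> elems (lp_space M p) \<and> h \<in> elems (linf_space M) \<and> (AE t in M. f t = g t + h t)}"
    have "nrm (sum_space M (lp_space M p) (linf_space M)) f = Inf ?S" by (simp add: sum_space_def)
    also have "\<dots> \<le> nrm (lp_space M p) (\<lambda>t. f t - radial_cut l f t) + nrm (linf_space M) (radial_cut l f)"
    proof (rule cInf_lower)
      show "bdd_below ?S"
        by (rule bdd_belowI[of _ 0]) (auto intro!: add_nonneg_nonneg simp: lp_space_def linf_space_def)
      show "nrm (lp_space M p) (\<lambda>t. f t - radial_cut l f t) + nrm (linf_space M) (radial_cut l f) \<in> ?S"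
        using main[OF l] by fastforce
    qed
    also have "\<dots> \<le> (1 + c) * l" using main[OF l] by (simp add: algebra_simps)
    finally show "nrm (sum_space M (lp_space M p) (linf_space M)) f \<le> (1 + c) * l" .
  qed
  then show "nrm (sum_space M (lp_space M p) (linf_space M)) f \<le> (1 + (1 / phi_one) powr (1 / p)) * lux f"
    by (simp add: c_def)
qed

text \<open>
  Since \<open>T\<close> need not be homogeneous, the scale \<open>l\<close> cannot be moved into its argument. It is put into the
  convex function instead: the modular inequality for \<open>\<phi>\<close> scaled by \<open>l\<close> is applied to \<open>x\<close> itself.
\<close>

lemma operator_modular_le:
  fixes T :: "('a \<Rightarrow> 'b::{real_normed_field, second_countable_topology}) \<Rightarrow> ('a \<Rightarrow> 'b)"
  assumes T: "T \<in> subadditive_class M (lp_space M p) (linf_space M)" and K: "0 < K"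
    and T_le: "opnorm M (lp_space M p) T \<le> ennreal K" "opnorm M (linf_space M) T \<le> ennreal K"
    and x: "x \<in> orlicz_set M \<phi>" and l: "0 < l"
  shows "modular M \<phi> (\<lambda>t. (l / (2 powr (1 - 1 / p) * K)) *\<^sub>R T x t) \<le> modular M \<phi> (\<lambda>t. l *\<^sub>R x t)"
proof -
  have xS: "x \<in> elems (sum_space M (lp_space M p) (linf_space M))" by (rule orlicz_subset_sum(1)[OF x])
  have xm: "x \<in> borel_measurable M" by (rule orlicz_setD[OF x])
  have "T x \<in> elems (sum_space M (lp_space M p) (linf_space M))"
    using T xS unfolding subadditive_class_def subadditive_op_def by blast
  then have Txm: "T x \<in> borel_measurable M" by (simp add: sum_space_def)
  define \<psi> where "\<psi> u = \<phi> (l * u powr (1 / p))" for u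
  have psi: "\<psi> (a powr p) = \<phi> (l * a)" if "0 \<le> a" for a using that p by (simp add: \<psi>_def powr_powr)
  have "(\<integral>\<^sup>+t. \<psi> ((norm (T x t) / (2 powr (1 - 1 / p) * K)) powr p) \<partial>M) \<le> (\<integral>\<^sup>+t. \<psi> (norm (x t) powr p) \<partial>M)"
  proof (rule op_convex_modular_le[where \<psi> = \<psi>, OF p K T T_le xm Txm])
    show "mono_on {0..} \<psi>"
      using p l by (auto intro!: mono_onI mono_onD[OF mono] powr_mono2 mult_left_mono simp: \<psi>_def)
    have "l * u powr (1 / p) = (l powr p * u) powr (1 / p)" if "0 \<le> u" for u
      using that l p by (simp add: powr_mult powr_powr)
    then have psi_eq: "\<psi> u = \<phi> ((l powr p * u) powr (1 / p))" if "0 \<le> u" for u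
      using that by (simp add: \<psi>_def)
    show "convex_fun \<psi>"
      unfolding convex_fun_def
    proof (intro allI impI ballI)
      fix u v a :: real assume uva: "0 \<le> u" "0 \<le> v" "a \<in> {0..1}"
      have "\<psi> (a * u + (1 - a) * v) = \<phi> ((a * (l powr p * u) + (1 - a) * (l powr p * v)) powr (1 / p))"
      proof -
        have "0 \<le> a * u + (1 - a) * v" using uva by simp
        from psi_eq[OF this] show ?thesis by (simp add: algebra_simps)
      qed
      also have "\<dots> \<le> ennreal a * \<phi> ((l powr p * u) powr (1 / p)) + ennreal (1 - a) * \<phi> ((l powr p * v) powr (1 / p))"
        using conv_p uva unfolding convex_fun_def by simp
      finally show "\<psi> (a * u + (1 - a) * v) \<le> ennreal a * \<psi> u + ennreal (1 - a) * \<psi> v"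
        using uva by (simp add: psi_eq)
    qed
    show "\<psi> 0 = 0" by (simp add: \<psi>_def zero)
    show "(0::real) < 1" by simp
    show "\<psi> 1 < \<infinity>" using fin[of l] l by (simp add: \<psi>_def)
    fix b :: real assume b: "0 < b"
      and tails: "\<And>s. 0 \<le> s \<Longrightarrow> s < b \<Longrightarrow> emeasure M {t \<in> space M. s < norm (x t) powr p} = \<infinity>"
    \<comment> \<open>As \<open>\<psi>\<close> is positive at \<open>b / 2\<close>, an infinite tail at that level makes the modular infinite.\<close>
    have inf: "emeasure M {t \<in> space M. b / 2 < norm (x t) powr p} = \<infinity>" using b by (intro tails) auto
    have meas: "{t \<in> space M. b / 2 < norm (x t) powr p} \<in> sets M" using xm by measurable
    have "0 < \<psi> (b / 2)" using pos b l by (simp add: \<psi>_def)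
    then have "\<infinity> = \<psi> (b / 2) * emeasure M {t \<in> space M. b / 2 < norm (x t) powr p}"
      unfolding inf by (simp add: ennreal_mult_top)
    also have "\<dots> = (\<integral>\<^sup>+t. \<psi> (b / 2) * indicator {t \<in> space M. b / 2 < norm (x t) powr p} t \<partial>M)"
      by (rule nn_integral_cmult_indicator[OF meas, symmetric])
    also have "\<dots> \<le> (\<integral>\<^sup>+t. \<psi> (norm (x t) powr p) \<partial>M)"
      using b \<open>mono_on {0..} \<psi>\<close> by (intro nn_integral_mono) (auto simp: indicator_def elim!: mono_onD)
    finally show "(\<integral>\<^sup>+t. \<psi> (norm (x t) powr p) \<partial>M) = \<infinity>" by (simp add: top_unique)
  qed
  then show ?thesis
    using l K by (simp add: modular_def psi)
qed

lemma interpolation_of_modular_norm: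
  fixes n :: "('a \<Rightarrow> 'b::{real_normed_field, banach, second_countable_topology}) \<Rightarrow> real"
  assumes n: "modular_norm M \<phi> n"
  defines "X \<equiv> \<lparr>elems = orlicz_set M \<phi>, nrm = n\<rparr>"
  shows "interpolation_space M (lp_space M p) (linf_space M) X"
    "interpolation_const M (lp_space M p) (linf_space M) X (2 powr (1 - 1 / p))"
proof -
  let ?C = "2 powr (1 - 1 / p)"
  have dom: "n y \<le> D * n x" if "x \<in> orlicz_set M \<phi>" "y \<in> orlicz_set M \<phi>" "0 < D"
    "\<And>l. 0 < l \<Longrightarrow> modular M \<phi> (\<lambda>t. (l / D) *\<^sub>R y t) \<le> modular M \<phi> (\<lambda>t. l *\<^sub>R x t)" for x y D
    using n that unfolding modular_norm_def by blast
  have equiv: "lux x \<le> n x" "n x \<le> 2 * lux x" if "x \<in> orlicz_set M \<phi>" for x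
    using n that unfolding modular_norm_def by blast+
  have banach: "banach_fun_space M X" unfolding X_def by (rule banach_of_modular_norm[OF n])
  have maps: "T f \<in> orlicz_set M \<phi>" and bound: "n (T f) \<le> (?C * K) * n f"
    if T: "T \<in> subadditive_class M (lp_space M p) (linf_space M)" and K: "0 < K"
      and T_le: "opnorm M (lp_space M p) T \<le> ennreal K" "opnorm M (linf_space M) T \<le> ennreal K"
      and f: "f \<in> orlicz_set M \<phi>" for T :: "('a \<Rightarrow> 'b) \<Rightarrow> ('a \<Rightarrow> 'b)" and f K
  proof -
    have CK: "0 < ?C * K" using K by simp
    obtain l where l: "0 < l" "modular M \<phi> (\<lambda>t. l *\<^sub>R f t) < \<infinity>" using f by (auto simp: orlicz_set_def)
    have "T f \<in> elems (sum_space M (lp_space M p) (linf_space M))"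
      using T orlicz_subset_sum(1)[OF f] unfolding subadditive_class_def subadditive_op_def by blast
    then have Tfm: "T f \<in> borel_measurable M" by (simp add: sum_space_def)
    show Tf: "T f \<in> orlicz_set M \<phi>"
      by (rule orlicz_setI[OF Tfm divide_pos_pos[OF l(1) CK]])
        (rule le_less_trans[OF operator_modular_le[OF T K T_le f l(1)] l(2)])
    show "n (T f) \<le> (?C * K) * n f"
      by (rule dom[OF f Tf CK]) (rule operator_modular_le[OF T K T_le f])
  qed
  have op_bound: "\<exists>m\<ge>0. max (opnorm M (lp_space M p) T) (opnorm M (linf_space M) T) = ennreal m"
    if T: "T \<in> subadditive_class M (lp_space M p) (linf_space M)" for T :: "('a \<Rightarrow> 'b) \<Rightarrow> ('a \<Rightarrow> 'b)"
  proof -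
    have "max (opnorm M (lp_space M p) T) (opnorm M (linf_space M) T) < \<infinity>"
      using T by (auto simp: subadditive_class_def)
    then show ?thesis by (cases "max (opnorm M (lp_space M p) T) (opnorm M (linf_space M) T)") auto
  qed
  have le_of_max: "opnorm M (lp_space M p) T \<le> ennreal K \<and> opnorm M (linf_space M) T \<le> ennreal K"
    if "max (opnorm M (lp_space M p) T) (opnorm M (linf_space M) T) = ennreal m" "m \<le> K"
    for T :: "('a \<Rightarrow> 'b) \<Rightarrow> ('a \<Rightarrow> 'b)" and m K
    using that by (metis ennreal_leI max.bounded_iff order_refl order_trans)
  show const: "interpolation_const M (lp_space M p) (linf_space M) X ?C"
    unfolding interpolation_const_def
  proof (intro conjI ballI)
    fix T :: "('a \<Rightarrow> 'b) \<Rightarrow> ('a \<Rightarrow> 'b)"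
    assume T: "T \<in> subadditive_class M (lp_space M p) (linf_space M)"
    then obtain m where m: "0 \<le> m" "max (opnorm M (lp_space M p) T) (opnorm M (linf_space M) T) = ennreal m"
      using op_bound by blast
    have "opnorm M X T \<le> ennreal (?C * m)"
      unfolding opnorm_def
    proof (rule SUP_least)
      fix f assume "f \<in> {f \<in> elems X. \<not> (AE t in M. f t = 0)}"
      then have f: "f \<in> orlicz_set M \<phi>" and nz: "\<not> (AE t in M. f t = 0)" by (auto simp: X_def)
      have nf: "0 < n f"
        using lux_eq_0D[OF f] nz lux_nonneg[OF f] equiv(1)[OF f] by fastforce
      have Tf: "T f \<in> orlicz_set M \<phi>"
        using maps[OF T _ _ _ f, of "m + 1"] le_of_max[OF m(2), of "m + 1"] m(1) by (simp del: ennreal_plus)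
      \<comment> \<open>The maximum \<open>m\<close> may be \<open>0\<close>; it is approached through positive bounds \<open>K > m\<close>.\<close>
      have "n (T f) \<le> (?C * n f) * m"
      proof (rule le_mult_of_all_greater)
        fix K assume "m < K"
        then show "n (T f) \<le> (?C * n f) * K"
          using bound[OF T _ _ _ f, of K] le_of_max[OF m(2), of K] m(1) by (simp add: mult.commute mult.left_commute)
      qed
      then have "n (T f) / n f \<le> ?C * m" using nf by (simp add: field_simps)
      moreover have "0 \<le> n (T f)" using lux_nonneg[OF Tf] equiv(1)[OF Tf] by simp
      ultimately show "ennreal (nrm X (T f)) / ennreal (nrm X f) \<le> ennreal (?C * m)"
        using nf by (simp add: X_def divide_ennreal ennreal_leI)
    qed
    then show "opnorm M X T \<le> ennreal ?C * max (opnorm M (lp_space M p) T) (opnorm M (linf_space M) T)"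
      unfolding m(2) using m(1) by (simp add: ennreal_mult)
  qed simp
  show "interpolation_space M (lp_space M p) (linf_space M) X"
    unfolding interpolation_space_def
  proof (intro conjI ballI)
    show "embeds (inter_space (lp_space M p) (linf_space M)) X"
      unfolding embeds_def
    proof (intro conjI exI ballI subsetI)
      fix f :: "'a \<Rightarrow> 'b" assume f: "f \<in> elems (inter_space (lp_space M p) (linf_space M))"
      show "f \<in> elems X" using inter_lux_le(1)[OF f] by (simp add: X_def)
      show "nrm X f \<le> (2 * max 1 phi_one) * nrm (inter_space (lp_space M p) (linf_space M)) f"
        using inter_lux_le(2)[OF f] equiv(2)[OF inter_lux_le(1)[OF f]] by (simp add: X_def)
    qed
    show "embeds X (sum_space M (lp_space M p) (linf_space M))"
      unfolding embeds_def
    proof (intro conjI exI ballI subsetI)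
      fix f assume "f \<in> elems X"
      then have f: "f \<in> orlicz_set M \<phi>" by (simp add: X_def)
      show "f \<in> elems (sum_space M (lp_space M p) (linf_space M))" by (rule orlicz_subset_sum(1)[OF f])
      have "(1 + (1 / phi_one) powr (1 / p)) * lux f \<le> (1 + (1 / phi_one) powr (1 / p)) * n f"
        using equiv(1)[OF f] by (intro mult_left_mono) auto
      with orlicz_subset_sum(2)[OF f]
      show "nrm (sum_space M (lp_space M p) (linf_space M)) f \<le> (1 + (1 / phi_one) powr (1 / p)) * nrm X f"
        by (simp add: X_def)
    qed
    fix T :: "('a \<Rightarrow> 'b) \<Rightarrow> ('a \<Rightarrow> 'b)" and f
    assume T: "T \<in> subadditive_class M (lp_space M p) (linf_space M)" and "f \<in> elems X"
    then have f: "f \<in> orlicz_set M \<phi>" by (simp add: X_def)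
    obtain m where m: "0 \<le> m" "max (opnorm M (lp_space M p) T) (opnorm M (linf_space M) T) = ennreal m"
      using op_bound[OF T] by blast
    show "T f \<in> elems X"
      using maps[OF T _ _ _ f, of "m + 1"] le_of_max[OF m(2), of "m + 1"] m(1)
      by (simp add: X_def del: ennreal_plus)
  qed (use banach const in blast)+
qed

end

section \<open>Orlicz functions generated by concave functions\<close>

text \<open>
  The derivative \<open>a (a + b w\<^sup>-\<^sup>1\<^sup>/\<^sup>p)\<^sup>p\<^sup>-\<^sup>1\<close> decreases in \<open>w\<close>. This is the reverse Minkowski inequality for
  the exponent \<open>1 / p\<close> in one variable.
\<close>

lemma concave_on_affine_powr:
  fixes a b p :: real
  assumes p: "1 \<le> p" and a: "0 \<le> a" and b: "0 \<le> b" and ab: "0 < a + b"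
  shows "concave_on {0<..} (\<lambda>w. (a * w powr (1 / p) + b) powr p)"
  unfolding concave_on_def
proof (rule convex_on_realI[where f' = "\<lambda>w. - (a * (a + b * w powr (- 1 / p)) powr (p - 1))"])
  show "connected {0::real<..}" by simp
next
  fix w :: real assume "w \<in> {0<..}"
  then have w: "0 < w" by simp
  have base: "0 < a * w powr (1 / p) + b"
    using a b ab w by (cases "a = 0") (auto intro: add_pos_nonneg)
  have "((\<lambda>w. (a * w powr (1 / p) + b) powr p) has_real_derivative
      p * (a * w powr (1 / p) + b) powr (p - 1) * (a * ((1 / p) * w powr (1 / p - 1)))) (at w)"
    using w base p by (auto intro!: derivative_eq_intros)
  also have "p * (a * w powr (1 / p) + b) powr (p - 1) * (a * ((1 / p) * w powr (1 / p - 1)))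
      = a * (a + b * w powr (- 1 / p)) powr (p - 1)"
  proof -
    have "a * w powr (1 / p) + b = w powr (1 / p) * (a + b * w powr (- 1 / p))"
      using w by (simp add: algebra_simps powr_add[symmetric])
    then have "(a * w powr (1 / p) + b) powr (p - 1)
        = (w powr (1 / p)) powr (p - 1) * (a + b * w powr (- 1 / p)) powr (p - 1)"
      by (simp add: powr_mult)
    moreover have "(w powr (1 / p)) powr (p - 1) * w powr (1 / p - 1) = 1"
    proof -
      have "(1 / p) * (p - 1) + (1 / p - 1) = 0" using p by (simp add: field_simps)
      then show ?thesis using w by (simp add: powr_powr powr_add[symmetric] del: powr_zero_eq_one) simp
    qed
    ultimately show ?thesis using p by (simp add: algebra_simps)
  qed
  finally show "((\<lambda>w. - ((a * w powr (1 / p) + b) powr p)) has_real_derivative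
      - (a * (a + b * w powr (- 1 / p)) powr (p - 1))) (at w)" by (rule DERIV_minus)
next
  fix w z :: real assume wz: "w \<in> {0<..}" "z \<in> {0<..}" "w \<le> z"
  have "z powr (- 1 / p) \<le> w powr (- 1 / p)" using wz p by (intro powr_mono2') auto
  then have "a + b * z powr (- 1 / p) \<le> a + b * w powr (- 1 / p)"
    using b by (intro add_left_mono mult_left_mono)
  then have "(a + b * z powr (- 1 / p)) powr (p - 1) \<le> (a + b * w powr (- 1 / p)) powr (p - 1)"
    using a b p by (intro powr_mono2) auto
  then show "- (a * (a + b * w powr (- 1 / p)) powr (p - 1)) \<le> - (a * (a + b * z powr (- 1 / p)) powr (p - 1))"
    using a by (simp add: mult_left_mono)
qed

text \<open>
  Nonnegativity at \<open>0\<close> and for large arguments forces intercept and slope of a supporting line to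
  be nonnegative.
\<close>

lemma concave_supporting_line:
  fixes \<rho> :: "real \<Rightarrow> real"
  assumes conc: "concave_on {0..} \<rho>" and nn: "\<And>s. 0 \<le> s \<Longrightarrow> 0 \<le> \<rho> s" and s0: "0 < s0"
  obtains a b where "0 \<le> a" "0 \<le> b" "\<rho> s0 = a + b * s0" "\<And>s. 0 \<le> s \<Longrightarrow> \<rho> s \<le> a + b * s"
proof -
  \<comment> \<open>The infimum of the difference quotients of \<open>- \<rho>\<close> to the right of \<open>s0\<close> is the slope of a supporting line.\<close>
  define b where "b = - Inf ((\<lambda>t. (- \<rho> s0 - - \<rho> t) / (s0 - t)) ` ({s0<..} \<inter> {0..}))"
  define a where "a = \<rho> s0 - b * s0"
  have line: "\<rho> s \<le> a + b * s" if s: "0 \<le> s" for s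
    using convex_le_Inf_differential[of "{0..}" "\<lambda>t. - \<rho> t" s0 s] conc s s0
    by (simp add: concave_on_def interior_real_atLeast b_def a_def algebra_simps)
  have a: "0 \<le> a" using line[of 0] nn[of 0] by simp
  have b: "0 \<le> b"
  proof (rule ccontr)
    assume "\<not> 0 \<le> b"
    then have b: "b < 0" by simp
    define s where "s = (a + 1) / (- b)"
    have "0 \<le> s" unfolding s_def by (rule divide_nonneg_pos) (use a b in auto)
    moreover have "a + b * s < 0" using b by (simp add: s_def field_simps)
    ultimately show False using line[of s] nn[of s] by simp
  qed
  show ?thesis by (rule that[OF a b _ line]) (simp add: a_def)
qed

locale concave_parameter =
  fixes p :: real and \<rho> :: "real \<Rightarrow> real"
  assumes p: "1 \<le> p" and qc: "quasi_concave \<rho>" and conc: "concave_on {0..} \<rho>"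
    and onto: "rho_star \<rho> ` {0<..} = {0<..}"
begin

definition phi_inverse where "phi_inverse u = u powr (1 / p) * \<rho> (u powr (- 1 / p))"

definition phi_real where "phi_real v = the_inv_into {0<..} phi_inverse v"

lemma rho_nonneg: "0 \<le> s \<Longrightarrow> 0 \<le> \<rho> s" and rho_pos: "0 < s \<Longrightarrow> 0 < \<rho> s"
  using qc by (auto simp: quasi_concave_def)

lemma rho_quasi_concave: "0 < s \<Longrightarrow> 0 < t \<Longrightarrow> \<rho> s \<le> max 1 (s / t) * \<rho> t"
  using qc unfolding quasi_concave_def by blast

lemma rho_mono: "0 < s \<Longrightarrow> s \<le> t \<Longrightarrow> \<rho> s \<le> \<rho> t"
proof -
  assume st: "0 < s" "s \<le> t"
  then have "\<rho> s \<le> max 1 (s / t) * \<rho> t" by (intro rho_quasi_concave) auto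
  then show ?thesis using st by (simp add: max_def split: if_splits)
qed

lemma phi_inverse_pos: "0 < u \<Longrightarrow> 0 < phi_inverse u"
  by (simp add: phi_inverse_def rho_pos)

lemma phi_inverse_eq_rho_star: "0 < u \<Longrightarrow> phi_inverse u = rho_star \<rho> (u powr (1 / p))"
  by (simp add: phi_inverse_def rho_star_def powr_minus_divide)

lemma phi_inverse_mono:
  assumes "0 < u" "u \<le> v"
  shows "phi_inverse u \<le> phi_inverse v"
proof -
  define s t where "s = 1 / (u powr (1 / p))" and "t = 1 / (v powr (1 / p))"
  have st: "0 < s" "0 < t" "t \<le> s"
    using assms p by (auto simp: s_def t_def intro!: divide_left_mono powr_mono2)
  have "\<rho> s \<le> max 1 (s / t) * \<rho> t" by (rule rho_quasi_concave[OF st(1,2)])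
  then have "\<rho> s \<le> s / t * \<rho> t" using st by (simp add: max_def split: if_splits)
  then have "1 / s * \<rho> s \<le> 1 / t * \<rho> t" using st by (simp add: field_simps)
  then show ?thesis using assms by (simp add: phi_inverse_eq_rho_star rho_star_def s_def t_def)
qed

text \<open>
  A supporting line \<open>a + b s\<close> of \<open>\<rho>\<close> bounds \<open>phi_inverse w powr p\<close> by \<open>(a w\<^sup>1\<^sup>/\<^sup>p + b)\<^sup>p\<close>, with equality at the
  point of support. So \<open>w \<mapsto> phi_inverse w powr p\<close> has a concave majorant touching it at every
  point, hence is concave; its inverse is \<open>u \<mapsto> \<phi> (u powr (1 / p))\<close>, which is therefore convex.
\<close>

lemma phi_inverse_powr_concave:
  assumes w: "0 < w" "0 < z" and c: "0 \<le> c" "c \<le> 1"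
  shows "c * phi_inverse w powr p + (1 - c) * phi_inverse z powr p \<le> phi_inverse (c * w + (1 - c) * z) powr p"
proof -
  define m where "m = c * w + (1 - c) * z"
  have m: "0 < m" using w c by (cases "c = 0") (auto simp: m_def intro: add_pos_nonneg)
  obtain a b where ab: "0 \<le> a" "0 \<le> b" "\<rho> (m powr (- 1 / p)) = a + b * m powr (- 1 / p)"
    "\<And>s. 0 \<le> s \<Longrightarrow> \<rho> s \<le> a + b * s"
    using concave_supporting_line[OF conc rho_nonneg, of "m powr (- 1 / p)"] m by auto
  define h where "h w = (a * w powr (1 / p) + b) powr p" for w
  have line: "u powr (1 / p) * (a + b * u powr (- 1 / p)) = a * u powr (1 / p) + b" if "0 < u" for u
    using that by (simp add: algebra_simps powr_add[symmetric])
  have F_le: "phi_inverse u powr p \<le> h u" if u: "0 < u" for u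
  proof -
    have "phi_inverse u \<le> u powr (1 / p) * (a + b * u powr (- 1 / p))"
      unfolding phi_inverse_def by (intro mult_left_mono ab) auto
    then show ?thesis unfolding h_def line[OF u] using phi_inverse_pos[OF u] p by (intro powr_mono2) auto
  qed
  have "0 < a + b * m powr (- 1 / p)" using rho_pos[of "m powr (- 1 / p)"] ab(3) m by simp
  then have "0 < a + b" using ab by (cases "a = 0") (auto intro: add_pos_nonneg simp: zero_less_mult_iff)
  then have "concave_on {0<..} h" unfolding h_def[abs_def] using concave_on_affine_powr[OF p ab(1,2)] by simp
  then have "c * h w + (1 - c) * h z \<le> h m"
    using concave_onD[of "{0<..}" h c z w] w c by (simp add: m_def algebra_simps)
  also have "h m = phi_inverse m powr p" using line[OF m] ab(3) by (simp add: h_def phi_inverse_def)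
  finally have "c * h w + (1 - c) * h z \<le> phi_inverse m powr p" .
  moreover have "c * phi_inverse w powr p + (1 - c) * phi_inverse z powr p \<le> c * h w + (1 - c) * h z"
    using F_le w c by (intro add_mono mult_left_mono) auto
  ultimately show ?thesis by (simp add: m_def)
qed

lemma phi_inverse_onto: "0 < y \<Longrightarrow> \<exists>u>0. phi_inverse u = y"
proof -
  assume "0 < y"
  then obtain t where t: "0 < t" "rho_star \<rho> t = y" using onto by (metis greaterThan_iff imageE)
  then have "phi_inverse (t powr p) = y" using p by (simp add: phi_inverse_eq_rho_star powr_powr)
  then show ?thesis using t by (intro exI[of _ "t powr p"]) simp
qed

text \<open>
  If a nondecreasing function took the same value at \<open>u < v\<close>, then by concavity of its \<open>p\<close>-th
  power it could not grow beyond \<open>v\<close> and would not be onto.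
\<close>

lemma phi_inverse_strict_mono:
  assumes uv: "0 < u" "u < v"
  shows "phi_inverse u < phi_inverse v"
proof (rule ccontr)
  assume "\<not> phi_inverse u < phi_inverse v"
  then have eq: "phi_inverse u = phi_inverse v" using phi_inverse_mono[of u v] uv by simp
  obtain w where w: "0 < w" "phi_inverse w = phi_inverse v + 1" using phi_inverse_onto[of "phi_inverse v + 1"] phi_inverse_pos[of v] uv by auto
  then have vw: "v < w" using phi_inverse_mono[of w v] by force
  \<comment> \<open>This weight exhibits \<open>v\<close> as a convex combination of \<open>u\<close> and \<open>w\<close>.\<close>
  define c where "c = (w - v) / (w - u)"
  have c: "0 \<le> c" "c < 1" "c * u + (1 - c) * w = v"
  proof -
    show "0 \<le> c" "c < 1" using uv vw by (auto simp: c_def)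
    have "c * (w - u) = w - v" using uv vw by (simp add: c_def)
    then show "c * u + (1 - c) * w = v" by (simp add: algebra_simps)
  qed
  have "c * phi_inverse u powr p + (1 - c) * phi_inverse w powr p \<le> phi_inverse v powr p"
    using phi_inverse_powr_concave[of u w c] uv w c by simp
  then have "(1 - c) * phi_inverse w powr p \<le> (1 - c) * phi_inverse v powr p" by (simp add: eq algebra_simps)
  then have "phi_inverse w powr p \<le> phi_inverse v powr p" using c by simp
  moreover have "phi_inverse v powr p < phi_inverse w powr p" using w phi_inverse_pos[of v] uv p by (intro powr_less_mono2) auto
  ultimately show False by simp
qed

lemma phi_inverse_less_iff: "0 < u \<Longrightarrow> 0 < v \<Longrightarrow> phi_inverse u < phi_inverse v \<longleftrightarrow> u < v"
  by (metis phi_inverse_strict_mono linorder_neqE order_less_asym)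

lemma inj_phi_inverse: "inj_on phi_inverse {0<..}"
  by (rule inj_onI) (metis phi_inverse_strict_mono greaterThan_iff less_irrefl linorder_neqE)

lemma phi_real:
  assumes "0 < v"
  shows "0 < phi_real v" "phi_inverse (phi_real v) = v"
proof -
  have "v \<in> phi_inverse ` {0<..}" using phi_inverse_onto[OF assms] by force
  then show "0 < phi_real v" "phi_inverse (phi_real v) = v"
    using the_inv_into_into[OF inj_phi_inverse, of v "{0<..}"] f_the_inv_into_f[OF inj_phi_inverse] by (auto simp: phi_real_def)
qed

lemma phi_real_less_iff: "0 < u \<Longrightarrow> 0 < v \<Longrightarrow> phi_real u < phi_real v \<longleftrightarrow> u < v"
  using phi_inverse_less_iff[of "phi_real u" "phi_real v"] phi_real[of u] phi_real[of v] by simp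

lemma phi_eq: "phi_of_rho p \<rho> v = (if v \<le> 0 then 0 else ennreal (phi_real v))"
  by (simp add: phi_of_rho_def phi_real_def phi_inverse_def[abs_def])

lemma phi_real_powr_convex:
  assumes uv: "0 < u" "0 < v" and c: "0 \<le> c" "c \<le> 1"
  shows "phi_real ((c * u + (1 - c) * v) powr (1 / p)) \<le> c * phi_real (u powr (1 / p)) + (1 - c) * phi_real (v powr (1 / p))"
proof (rule ccontr)
  let ?m = "c * u + (1 - c) * v" and ?i = "\<lambda>u. phi_real (u powr (1 / p))"
  define z where "z = c * ?i u + (1 - c) * ?i v"
  assume "\<not> ?thesis"
  then have "z < ?i ?m" by (simp add: z_def)
  have m: "0 < ?m" using uv c by (cases "c = 0") (auto intro: add_pos_nonneg)
  have i: "0 < ?i u" "0 < ?i v" "0 < ?i ?m" using uv m by (auto intro!: phi_real)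
  have z: "0 < z" using i c by (cases "c = 0") (auto simp: z_def intro: add_pos_nonneg)
  have Fi: "phi_inverse (?i x) powr p = x" if "0 < x" for x using that p by (simp add: phi_real powr_powr)
  have "phi_inverse z powr p < phi_inverse (?i ?m) powr p"
    using phi_inverse_strict_mono[OF z \<open>z < ?i ?m\<close>] phi_inverse_pos[OF z] p by (intro powr_less_mono2) auto
  also have "\<dots> = ?m" by (rule Fi[OF m])
  also have "\<dots> = c * phi_inverse (?i u) powr p + (1 - c) * phi_inverse (?i v) powr p" using uv by (simp add: Fi)
  also have "\<dots> \<le> phi_inverse z powr p" unfolding z_def by (rule phi_inverse_powr_concave[OF i(1,2) c])
  finally show False by simp
qed

text \<open>
  Convexity between a point and \<open>0\<close>, which the open half-line does not contain. It amounts to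
  \<open>\<rho>\<close> being nondecreasing.
\<close>

lemma phi_real_powr_scale:
  assumes u: "0 < u" and c: "0 < c" "c \<le> 1"
  shows "phi_real ((c * u) powr (1 / p)) \<le> c * phi_real (u powr (1 / p))"
proof -
  define w where "w = phi_real (u powr (1 / p))"
  have w: "0 < w" "phi_inverse w = u powr (1 / p)" using phi_real[of "u powr (1 / p)"] u by (auto simp: w_def)
  have "\<rho> (w powr (- 1 / p)) \<le> \<rho> ((c * w) powr (- 1 / p))"
    using w c p by (intro rho_mono powr_mono2') (auto simp: mult_left_le_one_le)
  then have "(c powr (1 / p) * w powr (1 / p)) * \<rho> (w powr (- 1 / p))
      \<le> (c powr (1 / p) * w powr (1 / p)) * \<rho> ((c * w) powr (- 1 / p))"
    by (rule mult_left_mono) simp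
  then have "c powr (1 / p) * phi_inverse w \<le> phi_inverse (c * w)"
    using powr_mult[of c w "1 / p"] by (simp only: phi_inverse_def mult.assoc)
  then have "(c * u) powr (1 / p) \<le> phi_inverse (c * w)" using w c u by (simp add: powr_mult)
  then have "\<not> phi_inverse (c * w) < phi_inverse (phi_real ((c * u) powr (1 / p)))" using phi_real[of "(c * u) powr (1 / p)"] c u by simp
  then show ?thesis using phi_inverse_less_iff[of "c * w" "phi_real ((c * u) powr (1 / p))"] w c u phi_real[of "(c * u) powr (1 / p)"]
    by (simp add: w_def)
qed

lemma phi_mono: "mono_on {0..} (phi_of_rho p \<rho>)"
proof (rule mono_onI)
  fix u v :: real assume "u \<in> {0..}" "v \<in> {0..}" "u \<le> v"
  then show "phi_of_rho p \<rho> u \<le> phi_of_rho p \<rho> v"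
    using phi_real_less_iff[of v u] by (auto simp: phi_eq not_less intro!: ennreal_leI)
qed

lemma phi_powr_convex: "convex_fun (\<lambda>u. phi_of_rho p \<rho> (u powr (1 / p)))"
  unfolding convex_fun_def
proof (intro allI impI ballI)
  fix u v c :: real assume u: "0 \<le> u" and v: "0 \<le> v" and "c \<in> {0..1}"
  then have c: "0 \<le> c" "c \<le> 1" by auto
  define \<psi> where "\<psi> u = phi_of_rho p \<rho> (u powr (1 / p))" for u
  have psi0: "\<psi> 0 = 0" by (simp add: \<psi>_def phi_eq)
  have psi: "\<psi> u = ennreal (phi_real (u powr (1 / p)))" "0 < phi_real (u powr (1 / p))" if "0 < u" for u
    using that phi_real[of "u powr (1 / p)"] by (auto simp: \<psi>_def phi_eq)
  have scale: "\<psi> (d * u) \<le> ennreal d * \<psi> u" if "0 \<le> d" "d \<le> 1" "0 \<le> u" for d u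
  proof (cases "d = 0 \<or> u = 0")
    case False
    then have "0 < d" "0 < u" using that by auto
    then show ?thesis using phi_real_powr_scale[of u d] that psi[of u] psi[of "d * u"]
      by (simp add: ennreal_mult[symmetric] ennreal_leI)
  qed (auto simp: psi0)
  have "\<psi> (c * u + (1 - c) * v) \<le> ennreal c * \<psi> u + ennreal (1 - c) * \<psi> v"
  proof (cases "u = 0 \<or> v = 0")
    case True
    then show ?thesis using scale[of c u] scale[of "1 - c" v] u v c by (auto simp: psi0)
  next
    case False
    then have uv: "0 < u" "0 < v" using u v by auto
    have m: "0 < c * u + (1 - c) * v" using uv c by (cases "c = 0") (auto intro: add_pos_nonneg)
    have "\<psi> (c * u + (1 - c) * v) \<le> ennreal (c * phi_real (u powr (1 / p)) + (1 - c) * phi_real (v powr (1 / p)))"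
      unfolding psi(1)[OF m] by (intro ennreal_leI phi_real_powr_convex uv c)
    also have "\<dots> = ennreal c * \<psi> u + ennreal (1 - c) * \<psi> v"
    proof -
      have "0 \<le> c * phi_real (u powr (1 / p))" "0 \<le> (1 - c) * phi_real (v powr (1 / p))"
        using c psi(2)[OF uv(1)] psi(2)[OF uv(2)] by auto
      then show ?thesis using c psi[OF uv(1)] psi[OF uv(2)] by (simp add: ennreal_plus ennreal_mult)
    qed
    finally show ?thesis .
  qed
  then show "phi_of_rho p \<rho> ((c * u + (1 - c) * v) powr (1 / p))
    \<le> ennreal c * phi_of_rho p \<rho> (u powr (1 / p)) + ennreal (1 - c) * phi_of_rho p \<rho> (v powr (1 / p))"
    by (simp add: \<psi>_def)
qed

lemma p_convex_orlicz_phi: "p_convex_orlicz (phi_of_rho p \<rho>) p"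
proof unfold_locales
  show "mono_on {0..} (phi_of_rho p \<rho>)" by (rule phi_mono)
  show "phi_of_rho p \<rho> 0 = 0" by (simp add: phi_eq)
  show "0 < phi_of_rho p \<rho> u" if "0 < u" for u using that phi_real[of u] by (simp add: phi_eq)
  show "phi_of_rho p \<rho> u < \<infinity>" for u by (simp add: phi_eq)
  show "1 \<le> p" by (rule p)
  show "convex_fun (\<lambda>u. phi_of_rho p \<rho> (u powr (1 / p)))" by (rule phi_powr_convex)
  show "convex_fun (phi_of_rho p \<rho>)"
    unfolding convex_fun_def
  proof (intro allI impI ballI)
    fix u v c :: real assume u: "0 \<le> u" and v: "0 \<le> v" and "c \<in> {0..1}"
    then have c: "0 \<le> c" "c \<le> 1" by auto
    have root: "(w powr p) powr (1 / p) = w" if "0 \<le> w" for w using that p by (simp add: powr_powr)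
    have jensen: "(c * u + (1 - c) * v) powr p \<le> c * u powr p + (1 - c) * v powr p"
    proof (cases "u = 0 \<or> v = 0")
      case True
      have "(d * w) powr p \<le> d * w powr p" if "0 \<le> d" "d \<le> 1" "0 \<le> w" for d w
      proof -
        have "d powr p \<le> d" using that p powr_mono'[of 1 p d] by (cases "d = 0") auto
        then show ?thesis using that by (simp add: powr_mult mult_right_mono)
      qed
      from this[of c u] this[of "1 - c" v] show ?thesis using True u v c by auto
    next
      case False
      then show ?thesis using convex_onD[OF powr_convex[OF p], of c v u] u v c by (simp add: algebra_simps)
    qed
    have m: "0 \<le> c * u + (1 - c) * v" using u v c by simp
    have "phi_of_rho p \<rho> (c * u + (1 - c) * v) = phi_of_rho p \<rho> (((c * u + (1 - c) * v) powr p) powr (1 / p))"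
      using root[OF m] by simp
    also have "\<dots> \<le> phi_of_rho p \<rho> ((c * u powr p + (1 - c) * v powr p) powr (1 / p))"
      using jensen p c by (intro mono_onD[OF phi_mono] powr_mono2) auto
    also have "\<dots> \<le> ennreal c * phi_of_rho p \<rho> ((u powr p) powr (1 / p)) + ennreal (1 - c) * phi_of_rho p \<rho> ((v powr p) powr (1 / p))"
      using phi_powr_convex c unfolding convex_fun_def by simp
    finally show "phi_of_rho p \<rho> (c * u + (1 - c) * v) \<le> ennreal c * phi_of_rho p \<rho> u + ennreal (1 - c) * phi_of_rho p \<rho> v"
      using root[OF u] root[OF v] by simp
  qed
qed

end

theorem theorem3:
  fixes M :: "'a measure" and p :: real
  assumes "complete_measure M" and "sigma_finite_measure M" and "1 \<le> p"
  shows
    "(\<forall>(\<phi> :: real \<Rightarrow> ennreal)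
        (T :: ('a \<Rightarrow> 'b::{real_normed_field, banach, second_countable_topology}) \<Rightarrow> ('a \<Rightarrow> 'b)) K.
        orlicz_function \<phi> \<longrightarrow>
        rearrangement_invariant M TYPE('b) \<phi> \<longrightarrow>
        convex_fun (\<lambda>u. \<phi> (u powr (1 / p))) \<longrightarrow>
        T \<in> subadditive_class M (lp_space M p) (linf_space M) \<longrightarrow>
        K = enn2real (max (opnorm M (lp_space M p) T) (opnorm M (linf_space M) T)) \<longrightarrow>
        K > 0 \<longrightarrow>
        (\<forall>x \<in> elems (sum_space M (lp_space M p) (linf_space M)).
           modular M \<phi> (\<lambda>t. T x t /\<^sub>R (2 powr (1 - 1 / p) * K)) \<le> modular M \<phi> x))
     \<and>
     (\<forall>\<rho> :: real \<Rightarrow> real.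
        quasi_concave \<rho> \<longrightarrow> concave_on {0..} \<rho> \<longrightarrow> rho_star \<rho> ` {0<..} = {0<..} \<longrightarrow>
        (\<forall>X \<in> {orlicz_luxemburg M (phi_of_rho p \<rho>), orlicz_amemiya M (phi_of_rho p \<rho>)}.
           interpolation_space M (lp_space M p) (linf_space M) (X :: ('a, 'b) fun_space) \<and>
           (\<exists>C \<le> 2 powr (1 - 1 / p).
              interpolation_const M (lp_space M p) (linf_space M) X C)))"
proof (intro conjI allI impI ballI)
  fix \<phi> :: "real \<Rightarrow> ennreal" and T :: "('a \<Rightarrow> 'b) \<Rightarrow> ('a \<Rightarrow> 'b)" and K and x :: "'a \<Rightarrow> 'b"
  assume "orlicz_function \<phi>" "rearrangement_invariant M TYPE('b) \<phi>"
    "convex_fun (\<lambda>u. \<phi> (u powr (1 / p)))" "T \<in> subadditive_class M (lp_space M p) (linf_space M)"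
    "K = enn2real (max (opnorm M (lp_space M p) T) (opnorm M (linf_space M) T))" "K > 0"
    "x \<in> elems (sum_space M (lp_space M p) (linf_space M))"
  then show "modular M \<phi> (\<lambda>t. T x t /\<^sub>R (2 powr (1 - 1 / p) * K)) \<le> modular M \<phi> x"
    by (rule modular_interpolation[OF assms(3)])
next
  fix \<rho> :: "real \<Rightarrow> real" and X :: "('a, 'b) fun_space"
  assume "quasi_concave \<rho>" "concave_on {0..} \<rho>" "rho_star \<rho> ` {0<..} = {0<..}"
    and X: "X \<in> {orlicz_luxemburg M (phi_of_rho p \<rho>), orlicz_amemiya M (phi_of_rho p \<rho>)}"
  then interpret concave_parameter p \<rho> using assms(3) by unfold_locales
  interpret p_convex_orlicz M "phi_of_rho p \<rho>" p by (rule p_convex_orlicz_phi)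
  have "\<exists>n. X = \<lparr>elems = orlicz_set M (phi_of_rho p \<rho>), nrm = n\<rparr> \<and> modular_norm M (phi_of_rho p \<rho>) n"
    using X modular_norm_lux[where 'b = 'b] modular_norm_amem[where 'b = 'b]
    by (auto simp: orlicz_luxemburg_def orlicz_amemiya_def)
  then obtain n where X_eq: "X = \<lparr>elems = orlicz_set M (phi_of_rho p \<rho>), nrm = n\<rparr>"
    and n: "modular_norm M (phi_of_rho p \<rho>) n" by blast
  show "interpolation_space M (lp_space M p) (linf_space M) X"
    unfolding X_eq by (rule interpolation_of_modular_norm(1)[OF n])
  show "\<exists>C \<le> 2 powr (1 - 1 / p). interpolation_const M (lp_space M p) (linf_space M) X C"
    unfolding X_eq using interpolation_of_modular_norm(2)[OF n] by blast
qed

end
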